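(* Assume the root system of $G$ is indecomposable. Then the rationality graph $\Gamma(W)$ is connected. Moreover, if $\epsilon$ denotes the Dynkin diagram automorphism with $w_0(\alpha) = -\epsilon(\alpha)$ for $\alpha \in \Delta$, extended to a group automorphism of $W$ by $\epsilon(s_\alpha) = s_{\epsilon(\alpha)}$, then for every $u \in W$, $u$ is rational if and only if $\epsilon(u)$ is rational (so $\epsilon$ induces an involutive automorphism of $\Gamma(W)$ fixing $w_0$). Finally, $\Gamma(W)$ has more than one vertex if and only if $w_0 \neq -\mathrm{id}$, i.e. if and only if the type is $A_r$ with $r \geq 2$, $D_r$ with $r$ odd, or $E_6$.
   Context: Let $G$ be a connected complex reductive algebraic group with Cartan subgroup $\mathcal{H}$ and Weyl group $W = N_G(\mathcal{H})/\mathcal{H}$; $\Pi$ the roots, $\Delta$ the simple roots, $\Pi_+$ the positive roots, $s_\alpha$ the simple reflections, $w_0$ the longest element. For roots, $\alpha \le \beta$ iff $\beta-\alpha$ is a nonnegative integer combination of simple roots. For $A \subseteq \Pi_+$ let $\mathrm{Adj}(A) = \{\alpha \in \Pi_+ : \exists\beta\in A,\ \alpha\le\beta\}$. For $u\in W$: $\nu^0(u) = u(\Pi_+)\cap\Pi_+$, $\nu^k(u) = u(\mathrm{Adj}\,\nu^{k-1}(u))\cap\Pi_+$; this sequence is descending and eventually constant with eventual value $\nu(u)$; $u$ is rational iff $\nu(u)=\emptyset$. The rationality graph $\Gamma(W)$ has as vertices the rational elements of $W$, with $u$ and $v$ joined by an edge iff $u = s_\alpha v$ for some $\alpha\in\Delta$.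 *)

theory Defs
  imports "HOL-Analysis.Analysis"
begin

text \<open>Reduced crystallographic root systems in a Euclidean space (possibly not spanning,
  as for the root system of a reductive group inside the real character space).\<close>

definition root_refl :: "'a::real_inner \<Rightarrow> 'a \<Rightarrow> 'a" where
  "root_refl \<alpha> x = x - (2 * (x \<bullet> \<alpha>) / (\<alpha> \<bullet> \<alpha>)) *\<^sub>R \<alpha>"

definition cartan :: "'a::real_inner \<Rightarrow> 'a \<Rightarrow> real" where
  "cartan a b = 2 * (a \<bullet> b) / (b \<bullet> b)"

definition root_system :: "'a::euclidean_space set \<Rightarrow> bool" where
  "root_system R \<longleftrightarrow> finite R \<and> 0 \<notin> R
     \<and> (\<forall>\<alpha>\<in>R. \<forall>\<beta>\<in>R. root_refl \<alpha> \<beta> \<in> R)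
     \<and> (\<forall>\<alpha>\<in>R. \<forall>\<beta>\<in>R. cartan \<beta> \<alpha> \<in> \<int>)
     \<and> (\<forall>\<alpha>\<in>R. \<forall>c::real. c *\<^sub>R \<alpha> \<in> R \<longrightarrow> c = 1 \<or> c = -1)"

definition indecomposable :: "'a::euclidean_space set \<Rightarrow> bool" where
  "indecomposable R \<longleftrightarrow> R \<noteq> {} \<and>
     \<not> (\<exists>R1 R2. R1 \<noteq> {} \<and> R2 \<noteq> {} \<and> R1 \<union> R2 = R \<and> (\<forall>a\<in>R1. \<forall>b\<in>R2. a \<bullet> b = 0))"

definition nonneg_comb :: "'a::euclidean_space set \<Rightarrow> 'a \<Rightarrow> bool" where
  "nonneg_comb \<Delta> v \<longleftrightarrow> (\<exists>c::'a \<Rightarrow> nat. v = (\<Sum>\<delta>\<in>\<Delta>. of_nat (c \<delta>) *\<^sub>R \<delta>))"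

definition is_base :: "'a::euclidean_space set \<Rightarrow> 'a set \<Rightarrow> bool" where
  "is_base R \<Delta> \<longleftrightarrow> \<Delta> \<subseteq> R \<and> independent \<Delta>
     \<and> (\<forall>\<alpha>\<in>R. nonneg_comb \<Delta> \<alpha> \<or> nonneg_comb \<Delta> (- \<alpha>))"

definition pos_roots :: "'a::euclidean_space set \<Rightarrow> 'a set \<Rightarrow> 'a set" where
  "pos_roots R \<Delta> = {\<alpha>\<in>R. nonneg_comb \<Delta> \<alpha>}"

definition root_le :: "'a::euclidean_space set \<Rightarrow> 'a \<Rightarrow> 'a \<Rightarrow> bool" where
  "root_le \<Delta> a b \<longleftrightarrow> nonneg_comb \<Delta> (b - a)"

definition Adj :: "'a::euclidean_space set \<Rightarrow> 'a set \<Rightarrow> 'a set \<Rightarrow> 'a set" where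
  "Adj R \<Delta> A = {\<alpha>\<in>pos_roots R \<Delta>. \<exists>\<beta>\<in>A. root_le \<Delta> \<alpha> \<beta>}"

primrec nu :: "'a::euclidean_space set \<Rightarrow> 'a set \<Rightarrow> ('a \<Rightarrow> 'a) \<Rightarrow> nat \<Rightarrow> 'a set" where
  "nu R \<Delta> u 0 = u ` pos_roots R \<Delta> \<inter> pos_roots R \<Delta>"
| "nu R \<Delta> u (Suc k) = u ` Adj R \<Delta> (nu R \<Delta> u k) \<inter> pos_roots R \<Delta>"

definition rational :: "'a::euclidean_space set \<Rightarrow> 'a set \<Rightarrow> ('a \<Rightarrow> 'a) \<Rightarrow> bool" where
  "rational R \<Delta> u \<longleftrightarrow> (\<exists>k. \<forall>m\<ge>k. nu R \<Delta> u m = {})"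

inductive_set weyl :: "'a::euclidean_space set \<Rightarrow> ('a \<Rightarrow> 'a) set" for R where
  weyl_id: "id \<in> weyl R"
| weyl_step: "\<alpha> \<in> R \<Longrightarrow> w \<in> weyl R \<Longrightarrow> root_refl \<alpha> \<circ> w \<in> weyl R"

definition word_prod :: "'a::euclidean_space list \<Rightarrow> 'a \<Rightarrow> 'a" where
  "word_prod ws = foldr (\<lambda>\<alpha> f. root_refl \<alpha> \<circ> f) ws id"

definition word_len :: "'a::euclidean_space set \<Rightarrow> ('a \<Rightarrow> 'a) \<Rightarrow> nat" where
  "word_len \<Delta> w = (LEAST n. \<exists>ws. set ws \<subseteq> \<Delta> \<and> length ws = n \<and> word_prod ws = w)"

definition longest :: "'a::euclidean_space set \<Rightarrow> 'a set \<Rightarrow> 'a \<Rightarrow> 'a" where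
  "longest R \<Delta> = (THE w. w \<in> weyl R \<and> (\<forall>v\<in>weyl R. word_len \<Delta> v \<le> word_len \<Delta> w))"

definition rat_vertices :: "'a::euclidean_space set \<Rightarrow> 'a set \<Rightarrow> ('a \<Rightarrow> 'a) set" where
  "rat_vertices R \<Delta> = {u \<in> weyl R. rational R \<Delta> u}"

definition rat_edge :: "'a::euclidean_space set \<Rightarrow> 'a set \<Rightarrow> ('a \<Rightarrow> 'a) \<Rightarrow> ('a \<Rightarrow> 'a) \<Rightarrow> bool" where
  "rat_edge R \<Delta> u v \<longleftrightarrow> u \<in> rat_vertices R \<Delta> \<and> v \<in> rat_vertices R \<Delta>
      \<and> (\<exists>\<alpha>\<in>\<Delta>. u = root_refl \<alpha> \<circ> v)"

definition rat_graph_connected :: "'a::euclidean_space set \<Rightarrow> 'a set \<Rightarrow> bool" where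
  "rat_graph_connected R \<Delta> \<longleftrightarrow> rat_vertices R \<Delta> \<noteq> {} \<and>
     (\<forall>u\<in>rat_vertices R \<Delta>. \<forall>v\<in>rat_vertices R \<Delta>. (rat_edge R \<Delta>)\<^sup>*\<^sup>* u v)"

definition diag_aut :: "'a::euclidean_space set \<Rightarrow> 'a set \<Rightarrow> 'a \<Rightarrow> 'a" where
  "diag_aut R \<Delta> \<alpha> = - longest R \<Delta> \<alpha>"

definition is_eps_ext :: "'a::euclidean_space set \<Rightarrow> 'a set \<Rightarrow> (('a \<Rightarrow> 'a) \<Rightarrow> ('a \<Rightarrow> 'a)) \<Rightarrow> bool" where
  "is_eps_ext R \<Delta> \<phi> \<longleftrightarrow> bij_betw \<phi> (weyl R) (weyl R)
     \<and> (\<forall>u\<in>weyl R. \<forall>v\<in>weyl R. \<phi> (u \<circ> v) = \<phi> u \<circ> \<phi> v)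
     \<and> (\<forall>\<alpha>\<in>\<Delta>. \<phi> (root_refl \<alpha>) = root_refl (diag_aut R \<Delta> \<alpha>))"

text \<open>Types via Cartan matrices (simply laced, Bourbaki numbering).\<close>
definition has_type :: "'a::euclidean_space set \<Rightarrow> nat \<Rightarrow> (nat \<Rightarrow> nat \<Rightarrow> bool) \<Rightarrow> bool" where
  "has_type \<Delta> r adj \<longleftrightarrow> (\<exists>f. bij_betw f {1..r} \<Delta> \<and>
     (\<forall>i\<in>{1..r}. \<forall>j\<in>{1..r}. cartan (f i) (f j) =
        (if i = j then 2 else if adj i j then -1 else 0)))"

definition adjA :: "nat \<Rightarrow> nat \<Rightarrow> bool" where
  "adjA i j \<longleftrightarrow> i + 1 = j \<or> j + 1 = i"

definition adjD :: "nat \<Rightarrow> nat \<Rightarrow> nat \<Rightarrow> bool" where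
  "adjD r i j \<longleftrightarrow> (i + 1 = j \<and> j \<le> r - 1) \<or> (j + 1 = i \<and> i \<le> r - 1)
      \<or> ({i, j} = {r - 2, r})"

definition adjE6 :: "nat \<Rightarrow> nat \<Rightarrow> bool" where
  "adjE6 i j \<longleftrightarrow> {i, j} \<in> {{1,3}, {3,4}, {4,5}, {5,6}, {2,4}}"

end

theory Submission
  imports Defs
begin

text \<open>An element \<open>u\<close> is irrational iff there is a nonempty set \<open>A\<close> of positive roots such that
  for every \<open>a \<in> A\<close> the root \<open>u\<^sup>-\<^sup>1 a\<close> is positive and lies below some element of \<open>A\<close>.
  Let \<open>u\<close> be rational and different from \<open>w\<^sub>0\<close>. If every simple \<open>a\<close> with \<open>u\<^sup>-\<^sup>1 a > 0\<close> had \<open>u a > 0\<close>,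
  the images \<open>u a\<close> would contain such a set \<open>A\<close>; so some simple \<open>a\<close> has \<open>u\<^sup>-\<^sup>1 a > 0\<close> and \<open>u a < 0\<close>.
  For this \<open>a\<close> the longer element \<open>s\<^sub>a u\<close> is again rational, because passing to the bottom of
  \<open>a\<close>-strings is monotone for the root order. Hence every rational element climbs to \<open>w\<^sub>0\<close> inside
  the graph, and the last vertex before \<open>w\<^sub>0\<close> is some \<open>s\<^sub>a w\<^sub>0\<close>, which is rational iff
  \<open>- w\<^sub>0 a \<noteq> a\<close>. The types are those connected diagrams that admit a nontrivial involution;
  among \<open>D\<^sub>r\<close> the parity is decided by the trivial action of \<open>W\<close> on weights modulo roots.\<close>

subsection \<open>Root systems with a base\<close>

text \<open>Left multiplication by a simple reflection does not preserve rationality in general: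
  already \<open>root_refl a \<circ> w0\<close> is irrational when \<open>ep a = a\<close>. What
  makes the climb work is the sign of \<open>u a\<close>: if \<open>- u a\<close> is positive,
  lowering \<open>b\<close> by multiples of \<open>a\<close> raises \<open>u b\<close>. The facts on
  root strings come from inner products, with \<open>root_triple\<close> in the role of the Jacobi
  identity. For the types no classification of Dynkin diagrams is assumed or proved. A path of
  simple roots reversed by \<open>ep\<close> is grown as far as possible; maximality forces any
  further neighbour to hang on the middle node and to be fixed by \<open>ep\<close>, and the rest is
  a second path of fixed nodes. The exclusions are norm estimates for unit vectors with nonpositive
  products; the only special coefficients are the null vectors of affine E6 and E7. The diagram
  alone cannot settle D_r, which has an involution for every r; what decides is that
  \<open>ep\<close> acts as -1 on weights modulo roots, tested on one explicit weight per
  type.\<close>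

lemma root_refl_linear: "linear (root_refl a)"
  unfolding root_refl_def
  by (intro linearI) (auto simp: inner_add_left algebra_simps add_divide_distrib scaleR_add_left)

lemma root_refl_self: "a \<noteq> 0 \<Longrightarrow> root_refl a a = - a"
  by (simp add: root_refl_def algebra_simps scaleR_2)

lemma root_refl_invol: "a \<noteq> 0 \<Longrightarrow> root_refl a (root_refl a x) = x"
  by (simp add: root_refl_def inner_diff_left algebra_simps divide_simps)

lemma root_refl_comp_self: "a \<noteq> 0 \<Longrightarrow> root_refl a \<circ> root_refl a = id"
  by (auto simp: root_refl_invol)

lemma root_refl_inner: "a \<noteq> 0 \<Longrightarrow> root_refl a x \<bullet> root_refl a y = x \<bullet> y"
  by (simp add: root_refl_def inner_diff_left inner_diff_right inner_commute algebra_simps divide_simps)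

lemma root_refl_minus [simp]: "root_refl (- a) = root_refl a"
  by (auto simp: root_refl_def fun_eq_iff)

lemma root_refl_cartan: "root_refl a x = x - cartan x a *\<^sub>R a"
  by (simp add: root_refl_def cartan_def)

lemma cartan_diff: "cartan (x - y) a = cartan x a - cartan y a"
  and cartan_scale: "cartan (c *\<^sub>R x) a = c * cartan x a"
  by (simp_all add: cartan_def inner_diff_left algebra_simps diff_divide_distrib)

lemma cartan_sum: "cartan (\<Sum>i\<in>I. f i) a = (\<Sum>i\<in>I. cartan (f i) a)"
  by (simp add: cartan_def inner_sum_left sum_distrib_left sum_divide_distrib)

lemma cartan_self: "a \<noteq> 0 \<Longrightarrow> cartan a a = 2"
  by (simp add: cartan_def)

lemma conj_root_refl:
  assumes "linear w" "\<And>x y. w x \<bullet> w y = x \<bullet> y"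
  shows "w (root_refl a x) = root_refl (w a) (w x)"
  using assms by (simp add: root_refl_def linear_diff linear_scale)

locale based_roots =
  fixes R \<Delta> :: "'a::euclidean_space set"
  assumes rs: "root_system R" and bs: "is_base R \<Delta>"
begin

abbreviation "P \<equiv> pos_roots R \<Delta>"
abbreviation "cf a v \<equiv> representation \<Delta> v a"
abbreviation rle (infix "\<sqsubseteq>" 50) where "x \<sqsubseteq> y \<equiv> root_le \<Delta> x y"

lemma finR: "finite R" and zeroR: "0 \<notin> R"
  and reflR: "a \<in> R \<Longrightarrow> b \<in> R \<Longrightarrow> root_refl a b \<in> R"
  and cartanR: "a \<in> R \<Longrightarrow> b \<in> R \<Longrightarrow> cartan b a \<in> \<int>"
  and propR: "a \<in> R \<Longrightarrow> c *\<^sub>R a \<in> R \<Longrightarrow> c = 1 \<or> c = -1"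
  using rs unfolding root_system_def by blast+

lemma baseR: "\<Delta> \<subseteq> R" and indep: "independent \<Delta>"
  and base_cases: "a \<in> R \<Longrightarrow> nonneg_comb \<Delta> a \<or> nonneg_comb \<Delta> (- a)"
  using bs unfolding is_base_def by blast+

lemma finD: "finite \<Delta>"
  using finR baseR finite_subset by blast

lemma root_nz: "a \<in> R \<Longrightarrow> a \<noteq> 0" using zeroR by metis
lemma base_nz: "a \<in> \<Delta> \<Longrightarrow> a \<noteq> 0" using zeroR baseR by blast

lemma uminusR: "a \<in> R \<Longrightarrow> - a \<in> R"
  using reflR[of a a] root_refl_self root_nz by metis

lemma uminusR_iff: "- a \<in> R \<longleftrightarrow> a \<in> R"
  using uminusR by force

section \<open>Coefficients with respect to the base, and positivity\<close>

lemma cf_add: "x \<in> span \<Delta> \<Longrightarrow> y \<in> span \<Delta> \<Longrightarrow> cf a (x + y) = cf a x + cf a y"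
  and cf_diff: "x \<in> span \<Delta> \<Longrightarrow> y \<in> span \<Delta> \<Longrightarrow> cf a (x - y) = cf a x - cf a y"
  and cf_minus: "x \<in> span \<Delta> \<Longrightarrow> cf a (- x) = - cf a x"
  and cf_scale: "x \<in> span \<Delta> \<Longrightarrow> cf a (c *\<^sub>R x) = c * cf a x"
  and cf_base: "b \<in> \<Delta> \<Longrightarrow> cf a b = (if a = b then 1 else 0)"
  using indep
  by (auto simp: representation_add representation_diff representation_neg representation_scale
      representation_basis)

lemma cf_sum: "(\<And>i. i \<in> I \<Longrightarrow> f i \<in> span \<Delta>) \<Longrightarrow> cf a (\<Sum>i\<in>I. f i) = (\<Sum>i\<in>I. cf a (f i))"
  using indep by (simp add: representation_sum)

lemma cf_expand: "x \<in> span \<Delta> \<Longrightarrow> x = (\<Sum>a\<in>\<Delta>. cf a x *\<^sub>R a)"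
  using sum_representation_eq[OF indep _ finD subset_refl] by simp

lemma cf_eqI: "x \<in> span \<Delta> \<Longrightarrow> y \<in> span \<Delta> \<Longrightarrow> (\<And>a. a \<in> \<Delta> \<Longrightarrow> cf a x = cf a y) \<Longrightarrow> x = y"
  by (subst cf_expand, assumption, subst (2) cf_expand, assumption) (rule sum.cong, auto)

lemma base_span: "a \<in> \<Delta> \<Longrightarrow> a \<in> span \<Delta>" by (rule span_base)

lemma cf_comb: "a \<in> \<Delta> \<Longrightarrow> cf a (\<Sum>b\<in>\<Delta>. g b *\<^sub>R b) = g a"
  by (subst cf_sum)
    (auto simp: base_span span_scale cf_scale cf_base finD if_distrib[of "\<lambda>t. _ * t"] cong: if_cong)

lemma nonneg_comb_iff: "nonneg_comb \<Delta> v \<longleftrightarrow> v \<in> span \<Delta> \<and> (\<forall>a\<in>\<Delta>. cf a v \<in> \<nat>)"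
proof
  assume "nonneg_comb \<Delta> v"
  then obtain c :: "'a \<Rightarrow> nat" where v: "v = (\<Sum>\<delta>\<in>\<Delta>. of_nat (c \<delta>) *\<^sub>R \<delta>)"
    unfolding nonneg_comb_def by blast
  then show "v \<in> span \<Delta> \<and> (\<forall>a\<in>\<Delta>. cf a v \<in> \<nat>)"
    by (simp add: cf_comb span_sum span_scale base_span)
next
  assume A: "v \<in> span \<Delta> \<and> (\<forall>a\<in>\<Delta>. cf a v \<in> \<nat>)"
  then obtain c :: "'a \<Rightarrow> nat" where c: "\<And>a. a \<in> \<Delta> \<Longrightarrow> cf a v = of_nat (c a)"
    unfolding Nats_def by (auto simp: image_iff) metis
  have "v = (\<Sum>\<delta>\<in>\<Delta>. of_nat (c \<delta>) *\<^sub>R \<delta>)"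
    using A cf_expand[of v] c by (metis (mono_tags, lifting) sum.cong)
  then show "nonneg_comb \<Delta> v" unfolding nonneg_comb_def by blast
qed

lemma root_span: "b \<in> R \<Longrightarrow> b \<in> span \<Delta>"
  using base_cases[of b] span_neg[of "- b" \<Delta>] by (auto simp: nonneg_comb_iff)

lemma root_cf_int: "b \<in> R \<Longrightarrow> a \<in> \<Delta> \<Longrightarrow> cf a b \<in> \<int>"
  using base_cases[of b] root_span[of b] Nats_subset_Ints
  by (auto simp: nonneg_comb_iff cf_minus)

lemma pos_R: "b \<in> P \<Longrightarrow> b \<in> R" by (simp add: pos_roots_def)
lemma pos_span: "b \<in> P \<Longrightarrow> b \<in> span \<Delta>" by (simp add: pos_R root_span)
lemma pos_cf: "b \<in> P \<Longrightarrow> a \<in> \<Delta> \<Longrightarrow> cf a b \<ge> 0"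
  by (auto simp: pos_roots_def nonneg_comb_iff Nats_altdef2)
lemma finP: "finite P" using finR finite_subset[of P R] pos_R by blast

lemma posI: "b \<in> R \<Longrightarrow> (\<And>a. a \<in> \<Delta> \<Longrightarrow> cf a b \<ge> 0) \<Longrightarrow> b \<in> P"
  by (auto simp: pos_roots_def nonneg_comb_iff root_span root_cf_int Nats_altdef2)

lemma base_pos: "a \<in> \<Delta> \<Longrightarrow> a \<in> P"
  using baseR by (intro posI) (auto simp: cf_base)

lemma root_cases: "b \<in> R \<Longrightarrow> b \<in> P \<or> - b \<in> P"
  using base_cases[of b] uminusR by (auto simp: pos_roots_def)

lemma pos_not_neg: "b \<in> P \<Longrightarrow> - b \<notin> P"
proof
  assume b: "b \<in> P" "- b \<in> P"
  have "b = 0"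
    by (rule cf_eqI)
      (use b pos_cf[OF b(1)] pos_cf[OF b(2)] pos_span[OF b(1)] in \<open>auto simp: cf_minus span_zero representation_zero intro: antisym\<close>)
  then show False using b pos_R zeroR by blast
qed

lemma not_pos_iff: "b \<in> R \<Longrightarrow> b \<notin> P \<longleftrightarrow> - b \<in> P"
  using root_cases pos_not_neg by blast

lemma pos_ex_cf: "b \<in> P \<Longrightarrow> \<exists>a\<in>\<Delta>. cf a b > 0"
proof (rule ccontr)
  assume b: "b \<in> P" "\<not> (\<exists>a\<in>\<Delta>. cf a b > 0)"
  have "b = 0"
    by (rule cf_eqI) (use b pos_cf[OF b(1)] pos_span[OF b(1)] in \<open>force simp: span_zero representation_zero\<close>)+
  then show False using b pos_R zeroR by blast
qed

lemma pos_if_cf: "b \<in> R \<Longrightarrow> a \<in> \<Delta> \<Longrightarrow> cf a b > 0 \<Longrightarrow> b \<in> P"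
  using root_cases[of b] pos_cf[of "- b" a] root_span[of b] by (force simp: cf_minus)

lemma rle_iff: "x \<in> R \<Longrightarrow> y \<in> R \<Longrightarrow> x \<sqsubseteq> y \<longleftrightarrow> (\<forall>a\<in>\<Delta>. cf a x \<le> cf a y)"
  by (auto simp: root_le_def nonneg_comb_iff root_span span_diff cf_diff root_cf_int Nats_altdef2)

lemma rle_refl: "x \<sqsubseteq> x"
  by (simp add: root_le_def nonneg_comb_iff span_zero representation_zero)

lemma rle_trans: "x \<sqsubseteq> y \<Longrightarrow> y \<sqsubseteq> z \<Longrightarrow> x \<sqsubseteq> z"
proof -
  assume "x \<sqsubseteq> y" "y \<sqsubseteq> z"
  then have "nonneg_comb \<Delta> ((z - y) + (y - x))"
    unfolding root_le_def nonneg_comb_iff by (metis span_add cf_add Nats_add)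
  then show ?thesis by (simp add: root_le_def)
qed

text \<open>All coefficients of \<open>b\<close> away from \<open>a\<close> are squeezed to zero, so
  \<open>b\<close> is a multiple of \<open>a\<close>, and reducedness with positivity leaves only
  the factor 1.\<close>

lemma pos_le_base:
  assumes "b \<in> P" "a \<in> \<Delta>" "b \<sqsubseteq> a"
  shows "b = a"
proof -
  have R: "b \<in> R" "a \<in> R" using assms pos_R baseR by auto
  have le: "\<And>c. c \<in> \<Delta> \<Longrightarrow> cf c b \<le> cf c a" using assms R rle_iff by blast
  have z: "c \<in> \<Delta> \<Longrightarrow> c \<noteq> a \<Longrightarrow> cf c b = 0" for c
    using le[of c] pos_cf[OF assms(1), of c] assms(2) by (simp add: cf_base)
  have "b = (\<Sum>c\<in>\<Delta>. cf c b *\<^sub>R c)" using cf_expand R root_span by blast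
  also have "\<dots> = (\<Sum>c\<in>\<Delta>. if c = a then cf a b *\<^sub>R a else 0)"
    by (rule sum.cong) (auto simp: z)
  also have "\<dots> = cf a b *\<^sub>R a" using assms(2) finD by simp
  finally have e: "b = cf a b *\<^sub>R a" .
  with R propR have "cf a b = 1 \<or> cf a b = -1" by metis
  with pos_cf[OF assms(1,2)] e show ?thesis by auto
qed

section \<open>Cartan integers, sums and differences of roots\<close>

text \<open>Strict Cauchy-Schwarz: equality would make \<open>b\<close> a multiple of
  \<open>a\<close>, and reducedness allows only \<open>a\<close> and \<open>- a\<close>.\<close>

lemma cartan_prod_lt4:
  assumes "a \<in> R" "b \<in> R" "a \<noteq> b" "a \<noteq> - b"
  shows "cartan a b * cartan b a < 4"
proof -
  have nz: "a \<noteq> 0" "b \<noteq> 0" using assms root_nz by auto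
  have "\<bar>a \<bullet> b\<bar> \<noteq> norm a * norm b"
  proof
    assume "\<bar>a \<bullet> b\<bar> = norm a * norm b"
    then have "norm a *\<^sub>R b = norm b *\<^sub>R a \<or> norm a *\<^sub>R b = - norm b *\<^sub>R a"
      by (metis norm_cauchy_schwarz_abs_eq)
    then have "norm a *\<^sub>R b = norm b *\<^sub>R a \<or> norm a *\<^sub>R b = (- norm b) *\<^sub>R a" by simp
    moreover have "norm a *\<^sub>R b = t *\<^sub>R a \<Longrightarrow> b = (t / norm a) *\<^sub>R a" for t
      using nz by (metis divideR_right divide_inverse_commute norm_eq_zero scaleR_scaleR)
    ultimately obtain c where "b = c *\<^sub>R a" by blast
    then show False using propR[OF assms(1), of c] assms by auto
  qed
  with Cauchy_Schwarz_ineq2[of a b] have "\<bar>a \<bullet> b\<bar> < norm a * norm b" by simp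
  then have "\<bar>a \<bullet> b\<bar> * \<bar>a \<bullet> b\<bar> < (norm a * norm b) * (norm a * norm b)"
    by (intro mult_strict_mono') auto
  then have "(a \<bullet> b) * (a \<bullet> b) < (a \<bullet> a) * (b \<bullet> b)"
    by (simp add: abs_mult[symmetric] power2_norm_eq_inner[symmetric] power2_eq_square algebra_simps)
  then show ?thesis
    using nz by (simp add: cartan_def inner_commute[of b a] field_simps)
qed

lemma cartan_sign: "b \<noteq> 0 \<Longrightarrow> cartan a b > 0 \<longleftrightarrow> a \<bullet> b > 0"
  "b \<noteq> 0 \<Longrightarrow> cartan a b < 0 \<longleftrightarrow> a \<bullet> b < 0" "b \<noteq> 0 \<Longrightarrow> cartan a b = 0 \<longleftrightarrow> a \<bullet> b = 0"
  by (auto simp: cartan_def divide_simps zero_less_mult_iff)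

text \<open>Both Cartan numbers are positive integers with product below 4, so one of them is 1, and
  the corresponding reflection produces \<open>a - b\<close> up to sign.\<close>

lemma root_diff:
  assumes "a \<in> R" "b \<in> R" "a \<noteq> b" "a \<bullet> b > 0"
  shows "a - b \<in> R"
proof -
  have nz: "a \<noteq> 0" "b \<noteq> 0" using assms root_nz by auto
  have ne: "a \<noteq> - b" using assms(4) inner_ge_zero[of b] by (auto simp del: inner_ge_zero)
  obtain m n where mn: "cartan a b = of_int m" "cartan b a = of_int n"
    using assms cartanR by (metis Ints_cases)
  have "cartan a b > 0" "cartan b a > 0" using assms nz by (simp_all add: cartan_sign inner_commute)
  then have p: "m > 0" "n > 0" using mn by auto
  have "cartan a b * cartan b a < 4" using cartan_prod_lt4 assms ne by blast
  then have "m * n < 4" unfolding mn by (metis of_int_less_numeral_iff of_int_mult)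
  have "m = 1 \<or> n = 1"
  proof (rule ccontr)
    assume "\<not> (m = 1 \<or> n = 1)"
    then have "2 * 2 \<le> m * n" using p by (intro mult_mono) auto
    with \<open>m * n < 4\<close> show False by simp
  qed
  then show ?thesis
  proof
    assume "m = 1"
    then have "root_refl b a = a - b" using mn by (simp add: root_refl_cartan)
    then show ?thesis using reflR assms by metis
  next
    assume "n = 1"
    then have "root_refl a b = - (a - b)" using mn by (simp add: root_refl_cartan)
    then show ?thesis using reflR assms uminusR_iff by metis
  qed
qed

lemma root_sum: "a \<in> R \<Longrightarrow> b \<in> R \<Longrightarrow> a \<noteq> - b \<Longrightarrow> a \<bullet> b < 0 \<Longrightarrow> a + b \<in> R"
  using root_diff[of a "- b"] uminusR by simp

lemma base_diff_notR: "a \<in> \<Delta> \<Longrightarrow> b \<in> \<Delta> \<Longrightarrow> a \<noteq> b \<Longrightarrow> a - b \<notin> R"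
proof
  assume A: "a \<in> \<Delta>" "b \<in> \<Delta>" "a \<noteq> b" "a - b \<in> R"
  have "cf a (a - b) = 1" "cf b (a - b) = -1"
    using A by (simp_all add: cf_diff base_span cf_base)
  then show False using pos_if_cf[of "a - b" a] pos_cf[of "a - b" b] A by simp
qed

lemma base_inner: "a \<in> \<Delta> \<Longrightarrow> b \<in> \<Delta> \<Longrightarrow> a \<noteq> b \<Longrightarrow> a \<bullet> b \<le> 0"
  using base_diff_notR root_diff baseR by (meson linorder_not_le subset_iff)


lemma cf_refl: "a \<in> \<Delta> \<Longrightarrow> x \<in> span \<Delta> \<Longrightarrow> b \<noteq> a \<Longrightarrow> cf b (root_refl a x) = cf b x"
  by (simp add: root_refl_def cf_diff cf_scale span_scale base_span cf_base)

lemma pos_other: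
  assumes "b \<in> P" "a \<in> \<Delta>" "b \<noteq> a"
  shows "\<exists>c\<in>\<Delta>. c \<noteq> a \<and> cf c b > 0"
proof (rule ccontr)
  assume n: "\<not> ?thesis"
  have "b \<sqsubseteq> a \<or> cf a b > 1"
    using n assms baseR pos_R by (subst rle_iff) (auto simp: cf_base not_less)
  moreover have "b = cf a b *\<^sub>R a"
  proof (rule cf_eqI)
    fix c assume c: "c \<in> \<Delta>"
    have "c \<noteq> a \<Longrightarrow> cf c b = 0" using n c pos_cf[OF assms(1) c] by force
    then show "cf c b = cf c (cf a b *\<^sub>R a)"
      using assms by (auto simp: cf_scale base_span cf_base)
  qed (use assms pos_span in \<open>auto simp: span_scale base_span\<close>)
  then have "cf a b = 1 \<or> cf a b = -1" using propR[of a "cf a b"] assms baseR pos_R by (metis subset_iff)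
  ultimately show False using pos_le_base[OF assms(1,2)] assms(3) by auto
qed

text \<open>A positive root other than \<open>a\<close> involves a second simple root
  \<open>c\<close>; the reflection does not touch that coefficient, and one positive coefficient
  already decides the sign of a root.\<close>

lemma refl_pos:
  assumes "b \<in> P" "a \<in> \<Delta>" "b \<noteq> a"
  shows "root_refl a b \<in> P"
proof -
  obtain c where "c \<in> \<Delta>" "c \<noteq> a" "cf c b > 0" using pos_other assms by blast
  then show ?thesis
    using pos_if_cf[of "root_refl a b" c] reflR assms pos_R baseR
    by (simp add: cf_refl pos_span subset_iff)
qed

lemma refl_base_neg: "b \<in> P \<Longrightarrow> a \<in> \<Delta> \<Longrightarrow> - root_refl a b \<in> P \<longleftrightarrow> b = a"
  using refl_pos pos_not_neg base_pos root_refl_self base_nz by (metis minus_minus)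

definition ht :: "'a \<Rightarrow> real" where "ht x = (\<Sum>a\<in>\<Delta>. cf a x)"

lemma ht_add: "x \<in> span \<Delta> \<Longrightarrow> y \<in> span \<Delta> \<Longrightarrow> ht (x + y) = ht x + ht y"
  and ht_diff: "x \<in> span \<Delta> \<Longrightarrow> y \<in> span \<Delta> \<Longrightarrow> ht (x - y) = ht x - ht y"
  and ht_scale: "x \<in> span \<Delta> \<Longrightarrow> ht (c *\<^sub>R x) = c * ht x"
  by (simp_all add: ht_def cf_add cf_diff cf_scale sum.distrib sum_subtractf sum_distrib_left)

lemma ht_base: "a \<in> \<Delta> \<Longrightarrow> ht a = 1"
  using finD by (simp add: ht_def cf_base)


lemma pos_ht: "b \<in> P \<Longrightarrow> ht b > 0"
  using pos_ex_cf pos_cf finD unfolding ht_def by (metis sum_pos2)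

text \<open>If neither sum is a root, \<open>root_sum\<close> and \<open>root_diff\<close> fix the
  signs of four inner products, and together these give
  \<open>(a + b) \<bullet> (a + b) \<le> 0\<close>.\<close>

lemma root_triple:
  assumes R: "a \<in> R" "b \<in> R" "c \<in> R" "a + b \<in> R" "a + b + c \<in> R"
    and nz: "a + c \<noteq> 0" "b + c \<noteq> 0"
  shows "a + c \<in> R \<or> b + c \<in> R"
proof (rule ccontr)
  assume n: "\<not> ?thesis"
  have ac: "a \<bullet> c \<ge> 0" using root_sum[of a c] n R nz(1) by (metis add_eq_0_iff2 linorder_not_le)
  have bc: "b \<bullet> c \<ge> 0" using root_sum[of b c] n R nz(2) by (metis add_eq_0_iff2 linorder_not_le)
  let ?s = "a + b + c"
  have e1: "?s - a = b + c" and e2: "?s - b = a + c" by simp_all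
  have "?s \<noteq> a" "?s \<noteq> b" using e1 e2 nz by auto
  then have sa: "?s \<bullet> a \<le> 0" and sb: "?s \<bullet> b \<le> 0"
    using root_diff[of ?s a] root_diff[of ?s b] n R e1 e2 by (metis linorder_not_le)+
  have "(a + b) \<bullet> (a + b) = ?s \<bullet> a + ?s \<bullet> b - a \<bullet> c - b \<bullet> c"
    by (simp add: inner_add_left inner_add_right inner_commute)
  then have "(a + b) \<bullet> (a + b) \<le> 0" using ac bc sa sb by linarith
  then have "a + b = 0" by (metis inner_eq_zero_iff inner_ge_zero order_antisym)
  then show False using R zeroR by metis
qed

end

subsection \<open>The Weyl group and its longest element\<close>

lemma word_Nil: "word_prod [] = id"
  and word_Cons: "word_prod (a # ws) = root_refl a \<circ> word_prod ws"
  by (simp_all add: word_prod_def)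

lemma word_append: "word_prod (us @ ws) = word_prod us \<circ> word_prod ws"
  by (induction us) (simp_all add: word_Nil word_Cons comp_assoc)

lemma Nats_sum: "(\<And>i. i \<in> I \<Longrightarrow> f i \<in> \<nat>) \<Longrightarrow> sum f I \<in> (\<nat> :: 'a::semiring_1 set)"
  by (induction I rule: infinite_finite_induct) auto

context based_roots begin

lemma weyl_linear: "w \<in> weyl R \<Longrightarrow> linear w"
proof (induction rule: weyl.induct)
  case weyl_id then show ?case by (metis eq_id_iff linear_id)
next
  case (weyl_step a w) then show ?case by (metis linear_compose root_refl_linear)
qed

lemma weyl_inner: "w \<in> weyl R \<Longrightarrow> w x \<bullet> w y = x \<bullet> y"
  by (induction rule: weyl.induct) (auto simp: root_refl_inner root_nz)

lemma weyl_R: "w \<in> weyl R \<Longrightarrow> b \<in> R \<Longrightarrow> w b \<in> R"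
  by (induction rule: weyl.induct) (auto simp: reflR)

lemma weyl_comp: "v \<in> weyl R \<Longrightarrow> w \<in> weyl R \<Longrightarrow> v \<circ> w \<in> weyl R"
  by (induction rule: weyl.induct) (auto simp: comp_assoc intro: weyl.intros)

lemma weyl_refl: "a \<in> R \<Longrightarrow> root_refl a \<in> weyl R"
  using weyl_step[OF _ weyl_id] by simp

lemma weyl_inverse_ex: "w \<in> weyl R \<Longrightarrow> \<exists>v\<in>weyl R. v \<circ> w = id \<and> w \<circ> v = id"
proof (induction rule: weyl.induct)
  case weyl_id then show ?case by (intro bexI[of _ id]) (simp_all add: weyl.weyl_id)
next
  case (weyl_step a w)
  then obtain v where v: "v \<in> weyl R" "v \<circ> w = id" "w \<circ> v = id" by blast
  have s: "root_refl a (root_refl a x) = x" for x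
    using root_refl_invol root_nz weyl_step by blast
  show ?case
    by (rule bexI[of _ "v \<circ> root_refl a"])
      (use v s weyl_step in \<open>auto simp: fun_eq_iff intro: weyl_comp weyl_refl\<close>)
qed

lemma weyl_bij: "w \<in> weyl R \<Longrightarrow> bij w"
  using weyl_inverse_ex o_bij by blast

lemma weyl_inv: "w \<in> weyl R \<Longrightarrow> inv w \<in> weyl R"
  using weyl_inverse_ex by (metis inv_unique_comp)

lemma weyl_inv_f: "w \<in> weyl R \<Longrightarrow> inv w (w x) = x"
  and weyl_f_inv: "w \<in> weyl R \<Longrightarrow> w (inv w x) = x"
  using weyl_bij by (simp_all add: bij_is_inj bij_is_surj surj_f_inv_f)

lemma weyl_minus: "w \<in> weyl R \<Longrightarrow> w (- x) = - w x"
  using weyl_linear by (simp add: linear_neg)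

lemma weyl_conj_refl:
  "w \<in> weyl R \<Longrightarrow> w \<circ> root_refl b = root_refl (w b) \<circ> w"
  by (auto simp: fun_eq_iff conj_root_refl weyl_linear weyl_inner)


section \<open>Words in simple reflections and the exchange property\<close>

lemma word_weyl: "set ws \<subseteq> \<Delta> \<Longrightarrow> word_prod ws \<in> weyl R"
  using baseR by (induction ws) (auto simp: word_Nil word_Cons intro: weyl.intros)

text \<open>As \<open>b \<bullet> b\<close> is positive, some simple \<open>a\<close> has positive
  product with \<open>b\<close>; the Cartan number is then at least 1, and it is the amount by which
  the height drops.\<close>

lemma pos_induct_refl:
  assumes "b \<in> P"
  shows "b \<in> \<Delta> \<or> (\<exists>a\<in>\<Delta>. root_refl a b \<in> P \<and> ht (root_refl a b) \<le> ht b - 1)"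
proof (rule disjCI)
  assume n: "\<not> (\<exists>a\<in>\<Delta>. root_refl a b \<in> P \<and> ht (root_refl a b) \<le> ht b - 1)"
  show "b \<in> \<Delta>"
  proof (rule ccontr)
    assume nb: "b \<notin> \<Delta>"
    have R: "b \<in> R" using assms pos_R by blast
    have "a \<bullet> b \<le> 0" if a: "a \<in> \<Delta>" for a
    proof (rule ccontr)
      assume "\<not> a \<bullet> b \<le> 0"
      then have c: "cartan b a > 0" using a base_nz by (simp add: cartan_sign inner_commute)
      have "cartan b a \<in> \<int>" using a baseR R cartanR by blast
      with c have "cartan b a \<ge> 1" by (auto elim!: Ints_cases)
      moreover have "ht (root_refl a b) = ht b - cartan b a"
        using a R by (simp add: root_refl_cartan ht_diff ht_scale ht_base root_span span_scale base_span)
      moreover have "root_refl a b \<in> P" using refl_pos[OF assms a] nb a by metis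
      ultimately show False using n a by force
    qed
    moreover have "b \<bullet> b = (\<Sum>a\<in>\<Delta>. cf a b * (a \<bullet> b))"
      by (subst cf_expand[OF root_span[OF R]], subst inner_sum_left) simp
    ultimately have "b \<bullet> b \<le> 0"
      using assms pos_cf by (simp add: sum_nonpos mult_nonneg_nonpos)
    then show False using R root_nz by (metis inner_eq_zero_iff inner_ge_zero order_antisym)
  qed
qed

lemma pos_simple_word: "b \<in> P \<Longrightarrow> \<exists>ws a. set ws \<subseteq> \<Delta> \<and> a \<in> \<Delta> \<and> b = word_prod ws a"
proof (induction "nat \<lfloor>ht b\<rfloor>" arbitrary: b rule: less_induct)
  case less
  consider "b \<in> \<Delta>" | a where "a \<in> \<Delta>" "root_refl a b \<in> P" "ht (root_refl a b) \<le> ht b - 1"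
    using pos_induct_refl less.prems by blast
  then show ?case
  proof cases
    case 1
    then show ?thesis by (intro exI[of _ "[]"] exI[of _ b]) (simp add: word_Nil)
  next
    case 2
    have "nat \<lfloor>ht (root_refl a b)\<rfloor> < nat \<lfloor>ht b\<rfloor>"
      using 2 pos_ht[of "root_refl a b"] by linarith
    then obtain ws c where "set ws \<subseteq> \<Delta>" "c \<in> \<Delta>" "root_refl a b = word_prod ws c"
      using less.hyps 2 by blast
    then show ?thesis using 2
      by (intro exI[of _ "a # ws"] exI[of _ c]) (simp add: word_Cons, metis root_refl_invol base_nz)
  qed
qed

lemma word_rev: "set ws \<subseteq> \<Delta> \<Longrightarrow> word_prod (rev ws) \<circ> word_prod ws = id"
proof (induction ws)
  case (Cons a ws)
  have "word_prod (rev (a # ws)) \<circ> word_prod (a # ws)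
      = word_prod (rev ws) \<circ> (root_refl a \<circ> root_refl a) \<circ> word_prod ws"
    by (simp add: word_append word_Nil word_Cons comp_assoc)
  also have "\<dots> = word_prod (rev ws) \<circ> word_prod ws"
    using Cons.prems by (simp add: root_refl_comp_self base_nz)
  also have "\<dots> = id" by (rule Cons.IH) (use Cons.prems in simp)
  finally show ?case .
qed (simp add: word_Nil)

lemma refl_word: "b \<in> R \<Longrightarrow> \<exists>ws. set ws \<subseteq> \<Delta> \<and> word_prod ws = root_refl b"
proof -
  have pos: "\<exists>ws. set ws \<subseteq> \<Delta> \<and> word_prod ws = root_refl b" if b: "b \<in> P" for b
  proof -
    obtain ws a where w: "set ws \<subseteq> \<Delta>" "a \<in> \<Delta>" "b = word_prod ws a" using pos_simple_word b by blast
    have "root_refl b \<circ> word_prod ws = word_prod ws \<circ> root_refl a"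
      using weyl_conj_refl[OF word_weyl[OF w(1)]] w(3) by simp
    then have "word_prod (ws @ [a] @ rev ws) = root_refl b \<circ> (word_prod ws \<circ> word_prod (rev ws))"
      by (simp add: word_append word_Nil word_Cons comp_assoc[symmetric])
    also have "\<dots> = root_refl b" using word_rev[of "rev ws"] w by simp
    finally show ?thesis using w by (intro exI[of _ "ws @ [a] @ rev ws"]) auto
  qed
  assume "b \<in> R"
  then show ?thesis using root_cases[of b] pos[of b] pos[of "- b"] by auto
qed

lemma weyl_word: "w \<in> weyl R \<Longrightarrow> \<exists>ws. set ws \<subseteq> \<Delta> \<and> word_prod ws = w"
proof (induction rule: weyl.induct)
  case weyl_id then show ?case by (intro exI[of _ "[]"]) (simp add: word_Nil)
next
  case (weyl_step a w)
  then obtain us ws where "set us \<subseteq> \<Delta>" "word_prod us = root_refl a" "set ws \<subseteq> \<Delta>" "word_prod ws = w"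
    using refl_word by blast
  then show ?case by (intro exI[of _ "us @ ws"]) (auto simp: word_append)
qed

text \<open>The claim is made for every positive root \<open>b\<close>, not only simple ones,
  because peeling off the first letter \<open>a\<close> replaces \<open>b\<close> by
  \<open>root_refl a b\<close>. The induction stops when \<open>b\<close> equals that letter, which
  is then the one deleted.\<close>

lemma exchange:
  "set ws \<subseteq> \<Delta> \<Longrightarrow> b \<in> P \<Longrightarrow> - inv (word_prod ws) b \<in> P \<Longrightarrow>
    \<exists>ws'. set ws' \<subseteq> \<Delta> \<and> length ws = Suc (length ws') \<and> root_refl b \<circ> word_prod ws = word_prod ws'"
proof (induction ws arbitrary: b)
  case Nil
  then show ?case using pos_not_neg by (auto simp: word_Nil)
next
  case (Cons a ws)
  let ?w = "word_prod ws"
  have w: "?w \<in> weyl R" "a \<in> \<Delta>" "a \<noteq> 0" using Cons.prems word_weyl base_nz by auto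
  show ?case
  proof (cases "b = a")
    case True
    have "root_refl a \<circ> (root_refl a \<circ> ?w) = ?w"
      unfolding comp_assoc[symmetric] root_refl_comp_self[OF w(3)] by (rule id_comp)
    then have "root_refl b \<circ> word_prod (a # ws) = ?w" unfolding word_Cons True .
    then show ?thesis using Cons.prems(1) by (metis insert_subset length_Cons list.simps(15))
  next
    case False
    let ?c = "root_refl a b"
    have c: "?c \<in> P" using refl_pos Cons.prems w False by blast
    have "inv (root_refl a \<circ> ?w) = inv ?w \<circ> root_refl a"
      using weyl_bij[OF w(1)] weyl_bij[OF weyl_refl[of a]] w(2,3) baseR
      by (subst o_inv_distrib) (auto simp: inv_unique_comp[OF root_refl_comp_self root_refl_comp_self])
    then have e: "inv (word_prod (a # ws)) = inv ?w \<circ> root_refl a" unfolding word_Cons .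
    have h: "- inv ?w ?c \<in> P" using Cons.prems(3) unfolding e by simp
    have sub: "set ws \<subseteq> \<Delta>" using Cons.prems(1) by simp
    obtain ws' where ws': "set ws' \<subseteq> \<Delta>" "length ws = Suc (length ws')"
        "root_refl ?c \<circ> ?w = word_prod ws'"
      using Cons.IH[OF sub c h] by blast
    have "root_refl a \<circ> root_refl ?c = root_refl b \<circ> root_refl a"
      using weyl_conj_refl[OF weyl_refl, of a ?c] w baseR by (auto simp: root_refl_invol)
    then have "root_refl b \<circ> word_prod (a # ws) = root_refl a \<circ> (root_refl ?c \<circ> ?w)"
      by (simp add: word_Cons comp_assoc[symmetric])
    then have "root_refl b \<circ> word_prod (a # ws) = word_prod (a # ws')"
      unfolding ws'(3) word_Cons .
    moreover have "set (a # ws') \<subseteq> \<Delta>" "length (a # ws) = Suc (length (a # ws'))" using ws' w by auto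
    ultimately show ?thesis by blast
  qed
qed

section \<open>Inversion sets and length\<close>

text \<open>The inversions of \<open>inv w\<close>. Edges of the graph multiply on the left, and
  with this convention such a step changes the set by a reflection and one root.\<close>

definition Ninv :: "('a \<Rightarrow> 'a) \<Rightarrow> 'a set" where "Ninv w = {b \<in> P. - inv w b \<in> P}"

lemma finNinv: "finite (Ninv w)" by (simp add: Ninv_def finP)

lemma inv_refl_comp:
  assumes "w \<in> weyl R" "a \<in> R"
  shows "inv (root_refl a \<circ> w) = inv w \<circ> root_refl a"
  using weyl_bij[OF assms(1)] weyl_bij[OF weyl_refl[OF assms(2)]] root_nz[OF assms(2)]
  by (subst o_inv_distrib) (auto simp: inv_unique_comp[OF root_refl_comp_self root_refl_comp_self])

text \<open>The simple reflection permutes \<open>P - {a}\<close>, so old inversions are carried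
  over by \<open>root_refl a\<close>, and \<open>a\<close> itself is the only new one.\<close>

lemma Ninv_refl:
  assumes w: "w \<in> weyl R" and a: "a \<in> \<Delta>" and up: "inv w a \<in> P"
  shows "Ninv (root_refl a \<circ> w) = insert a (root_refl a ` Ninv w)"
    "card (Ninv (root_refl a \<circ> w)) = Suc (card (Ninv w))"
proof -
  have aR: "a \<in> R" "a \<noteq> 0" "a \<in> P" using a baseR base_nz base_pos by auto
  note s = root_refl_invol[OF aR(2)]
  note ic = inv_refl_comp[OF w aR(1)]
  have na: "a \<notin> Ninv w" using up pos_not_neg by (auto simp: Ninv_def)
  show e: "Ninv (root_refl a \<circ> w) = insert a (root_refl a ` Ninv w)"
  proof (intro set_eqI iffI)
    fix b assume "b \<in> Ninv (root_refl a \<circ> w)"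
    then have b: "b \<in> P" "- inv w (root_refl a b) \<in> P" by (auto simp: Ninv_def ic)
    show "b \<in> insert a (root_refl a ` Ninv w)"
    proof (cases "b = a")
      case False
      then have "root_refl a b \<in> Ninv w" using b refl_pos a by (auto simp: Ninv_def)
      then show ?thesis using s by (metis image_eqI insertCI)
    qed simp
  next
    fix b assume "b \<in> insert a (root_refl a ` Ninv w)"
    then show "b \<in> Ninv (root_refl a \<circ> w)"
    proof
      assume "b = a"
      then show ?thesis using up aR weyl_minus[OF weyl_inv[OF w]]
        by (auto simp: Ninv_def ic root_refl_self)
    next
      assume "b \<in> root_refl a ` Ninv w"
      then obtain c where c: "c \<in> Ninv w" "b = root_refl a c" by blast
      moreover have "c \<noteq> a" using c na by blast
      ultimately show ?thesis using refl_pos a by (auto simp: Ninv_def ic s)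
    qed
  qed
  have "a \<notin> root_refl a ` Ninv w"
  proof
    assume "a \<in> root_refl a ` Ninv w"
    then obtain c where c: "c \<in> P" "a = root_refl a c" by (auto simp: Ninv_def)
    then have "c = root_refl a a" using s by metis
    then have "c = - a" using root_refl_self aR by simp
    then show False using c aR pos_not_neg by blast
  qed
  moreover have "inj_on (root_refl a) (Ninv w)" using s by (metis inj_onI)
  ultimately show "card (Ninv (root_refl a \<circ> w)) = Suc (card (Ninv w))"
    unfolding e by (simp add: finNinv card_image)
qed

lemma Ninv_refl_down:
  assumes w: "w \<in> weyl R" and a: "a \<in> \<Delta>" and dn: "- inv w a \<in> P"
  shows "card (Ninv w) = Suc (card (Ninv (root_refl a \<circ> w)))"
proof -
  have aR: "a \<in> R" "a \<noteq> 0" using a baseR base_nz by auto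
  have "inv (root_refl a \<circ> w) a = - inv w a"
    using inv_refl_comp[OF w aR(1)] root_refl_self[OF aR(2)] weyl_minus[OF weyl_inv[OF w]] by simp
  then have "card (Ninv (root_refl a \<circ> (root_refl a \<circ> w))) = Suc (card (Ninv (root_refl a \<circ> w)))"
    using Ninv_refl(2)[of "root_refl a \<circ> w" a] w a dn aR by (simp add: weyl_step)
  then show ?thesis by (simp add: comp_assoc[symmetric] root_refl_comp_self aR)
qed

lemma Ninv_id: "Ninv id = {}"
  using pos_not_neg by (auto simp: Ninv_def)

lemma Ninv_word_le: "set ws \<subseteq> \<Delta> \<Longrightarrow> card (Ninv (word_prod ws)) \<le> length ws"
proof (induction ws)
  case Nil
  then show ?case unfolding word_Nil Ninv_id by simp
next
  case (Cons a ws)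
  let ?w = "word_prod ws"
  have w: "?w \<in> weyl R" "a \<in> \<Delta>" using Cons.prems word_weyl by auto
  then have "inv ?w a \<in> R" using weyl_R weyl_inv baseR by blast
  then have "inv ?w a \<in> P \<or> - inv ?w a \<in> P" by (rule root_cases)
  then have "card (Ninv (root_refl a \<circ> ?w)) \<le> Suc (card (Ninv ?w))"
    using Ninv_refl(2)[OF w] Ninv_refl_down[OF w] by linarith
  then have "card (Ninv (word_prod (a # ws))) \<le> Suc (card (Ninv ?w))" unfolding word_Cons .
  then show ?case using Cons by fastforce
qed

text \<open>If the new letter lowers the number of inversions, \<open>exchange\<close> shortens the
  word that is already reduced; otherwise the letter is prepended.\<close>

lemma word_reduced: "set ws \<subseteq> \<Delta> \<Longrightarrow>
   \<exists>ws'. set ws' \<subseteq> \<Delta> \<and> word_prod ws' = word_prod ws \<and> length ws' = card (Ninv (word_prod ws))"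
proof (induction ws)
  case Nil
  show ?case by (metis Ninv_id card.empty list.size(3) word_Nil Nil)
next
  case (Cons a ws)
  then obtain us where us: "set us \<subseteq> \<Delta>" "word_prod us = word_prod ws"
    "length us = card (Ninv (word_prod ws))" by auto
  let ?w = "word_prod ws"
  have w: "?w \<in> weyl R" "a \<in> \<Delta>" using Cons.prems word_weyl by auto
  then have "inv ?w a \<in> R" using weyl_R weyl_inv baseR by blast
  then have "inv ?w a \<in> P \<or> - inv ?w a \<in> P" by (rule root_cases)
  then show ?case
  proof
    assume "inv ?w a \<in> P"
    then show ?thesis using Ninv_refl(2)[OF w] us w
      by (intro exI[of _ "a # us"]) (simp add: word_Cons comp_def)
  next
    assume d: "- inv ?w a \<in> P"
    then obtain ws' where "set ws' \<subseteq> \<Delta>" "length us = Suc (length ws')" "root_refl a \<circ> ?w = word_prod ws'"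
      using exchange[OF us(1), of a] us w base_pos by auto
    then show ?thesis using Ninv_refl_down[OF w d] us
      by (intro exI[of _ ws']) (simp add: word_Cons comp_def)
  qed
qed

lemma word_len_eq: "w \<in> weyl R \<Longrightarrow> word_len \<Delta> w = card (Ninv w)"
proof -
  assume "w \<in> weyl R"
  then obtain ws where ws: "set ws \<subseteq> \<Delta>" "word_prod ws = w" using weyl_word by blast
  show ?thesis unfolding word_len_def
  proof (rule Least_equality)
    show "\<exists>us. set us \<subseteq> \<Delta> \<and> length us = card (Ninv w) \<and> word_prod us = w"
      using word_reduced[OF ws(1)] unfolding ws(2) by blast
    fix n assume "\<exists>us. set us \<subseteq> \<Delta> \<and> length us = n \<and> word_prod us = w"
    then obtain us where us: "set us \<subseteq> \<Delta>" "length us = n" "word_prod us = w" by blast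
    show "card (Ninv w) \<le> n" using Ninv_word_le[OF us(1)] unfolding us(2,3) .
  qed
qed

lemma weyl_fix_pos:
  assumes "w \<in> weyl R" "\<And>b. b \<in> P \<Longrightarrow> w b \<in> P"
  shows "w = id"
proof -
  have "Ninv (inv w) = {}" using assms pos_not_neg weyl_bij[OF assms(1)] by (auto simp: Ninv_def inv_inv_eq)
  moreover obtain ws where "set ws \<subseteq> \<Delta>" "word_prod ws = inv w" "length ws = card (Ninv (inv w))"
    using weyl_word[OF weyl_inv[OF assms(1)]] word_reduced by metis
  ultimately have "inv w = id" by (simp add: word_Nil)
  then show ?thesis using weyl_f_inv[OF assms(1)] by (auto simp: fun_eq_iff)
qed

text \<open>The roots need not span the space, while elements of \<open>weyl R\<close> are functions
  on all of it; that the action on \<open>R\<close> determines them comes from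
  \<open>weyl_fix_pos\<close>.\<close>

lemma weyl_eqI:
  assumes "v \<in> weyl R" "w \<in> weyl R" "\<And>b. b \<in> R \<Longrightarrow> v b = w b"
  shows "v = w"
proof -
  have "inv v \<circ> w = id"
    by (rule weyl_fix_pos) (use assms pos_R in \<open>auto intro!: weyl_comp weyl_inv simp: assms(3)[symmetric] weyl_inv_f\<close>)
  then have "inv v (w x) = x" for x by (metis comp_apply id_apply)
  then show ?thesis using assms(1) weyl_f_inv by (metis ext)
qed

lemma finite_weyl: "finite (weyl R)"
proof -
  let ?r = "\<lambda>w. restrict w R"
  have "inj_on ?r (weyl R)"
    by (rule inj_onI) (metis weyl_eqI restrict_apply')
  moreover have "?r ` weyl R \<subseteq> R \<rightarrow>\<^sub>E R" using weyl_R by auto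
  ultimately show ?thesis using finite_PiE[OF finR, of "\<lambda>_. R"] finR
    by (meson finite_imageD finite_subset)
qed

section \<open>The longest element\<close>

abbreviation "w0 \<equiv> longest R \<Delta>"

lemma Ninv_full_iff: "w \<in> weyl R \<Longrightarrow> card (Ninv w) = card P \<longleftrightarrow> (\<forall>a\<in>P. - inv w a \<in> P)"
proof -
  have "card (Ninv w) = card P \<longleftrightarrow> Ninv w = P"
    using card_subset_eq[OF finP, of "Ninv w"] by (auto simp: Ninv_def)
  then show ?thesis by (auto simp: Ninv_def)
qed

text \<open>Only the simple roots in the support of \<open>v\<close> are tested. This form is
  essential in \<open>rational_ascent\<close>, where nothing is known about the images of the
  others.\<close>

lemma nonneg_comb_map:
  assumes f: "linear f" and v: "nonneg_comb \<Delta> v"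
    and a: "\<And>a. a \<in> \<Delta> \<Longrightarrow> cf a v \<noteq> 0 \<Longrightarrow> nonneg_comb \<Delta> (f a)"
  shows "nonneg_comb \<Delta> (f v)"
proof -
  have v': "v \<in> span \<Delta>" "\<And>a. a \<in> \<Delta> \<Longrightarrow> cf a v \<in> \<nat>" using v nonneg_comb_iff by auto
  let ?g = "\<lambda>a. cf a v *\<^sub>R f a"
  have g: "?g a \<in> span \<Delta>" "\<And>c. c \<in> \<Delta> \<Longrightarrow> cf c (?g a) \<in> \<nat>" if "a \<in> \<Delta>" for a
  proof -
    have "?g a \<in> span \<Delta> \<and> (\<forall>c\<in>\<Delta>. cf c (?g a) \<in> \<nat>)"
      by (cases "cf a v = 0")
        (use a[OF that] v'(2)[OF that] in \<open>auto simp: nonneg_comb_iff span_scale cf_scale span_zero representation_zero\<close>)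
    then show "?g a \<in> span \<Delta>" "\<And>c. c \<in> \<Delta> \<Longrightarrow> cf c (?g a) \<in> \<nat>" by auto
  qed
  have "f v = (\<Sum>a\<in>\<Delta>. ?g a)"
    by (subst cf_expand[OF v'(1)]) (simp add: linear_sum[OF f] linear_scale[OF f])
  moreover have "nonneg_comb \<Delta> (\<Sum>a\<in>\<Delta>. ?g a)"
    unfolding nonneg_comb_iff
  proof (intro conjI ballI)
    show "(\<Sum>a\<in>\<Delta>. ?g a) \<in> span \<Delta>" by (rule span_sum) (rule g)
    fix c assume c: "c \<in> \<Delta>"
    have "cf c (\<Sum>a\<in>\<Delta>. ?g a) = (\<Sum>a\<in>\<Delta>. cf c (?g a))" by (rule cf_sum) (rule g)
    also have "\<dots> \<in> \<nat>" by (rule Nats_sum) (use g c in auto)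
    finally show "cf c (\<Sum>a\<in>\<Delta>. ?g a) \<in> \<nat>" .
  qed
  ultimately show ?thesis by simp
qed

lemma pos_comb: "b \<in> P \<Longrightarrow> nonneg_comb \<Delta> b" by (simp add: pos_roots_def)

lemma weyl_neg_pos:
  assumes w: "w \<in> weyl R" and s: "\<And>a. a \<in> \<Delta> \<Longrightarrow> - w a \<in> P" and b: "b \<in> P"
  shows "- w b \<in> P"
proof -
  have "nonneg_comb \<Delta> (- w b)"
    by (rule nonneg_comb_map[of "\<lambda>x. - w x"])
      (use w b s pos_comb in \<open>auto intro: linear_compose_neg weyl_linear\<close>)
  moreover have "- w b \<in> R" by (rule uminusR[OF weyl_R[OF w pos_R[OF b]]])
  ultimately show ?thesis by (simp add: pos_roots_def)
qed

text \<open>An element with the most inversions has the right inverse: if \<open>inv w a\<close>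
  were positive for a simple \<open>a\<close>, then \<open>root_refl a \<circ> w\<close> would have
  one more inversion.\<close>

lemma longest_ex: "\<exists>w\<in>weyl R. \<forall>a\<in>P. - w a \<in> P"
proof -
  have ne: "weyl R \<noteq> {}" using weyl_id by blast
  let ?S = "(\<lambda>w. card (Ninv w)) ` weyl R"
  have "Max ?S \<in> ?S" using ne finite_weyl by (intro Max_in) auto
  then obtain w where w: "w \<in> weyl R" "card (Ninv w) = Max ?S" by (metis (no_types, lifting) imageE)
  then have mx: "\<And>v. v \<in> weyl R \<Longrightarrow> card (Ninv v) \<le> card (Ninv w)" using finite_weyl by simp
  have s: "- inv w a \<in> P" if a: "a \<in> \<Delta>" for a
  proof (rule ccontr)
    assume "\<not> ?thesis"
    moreover have "inv w a \<in> R" using weyl_R[OF weyl_inv[OF w(1)]] a baseR by blast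
    ultimately have "inv w a \<in> P" using root_cases by blast
    then have "card (Ninv (root_refl a \<circ> w)) = Suc (card (Ninv w))"
      by (rule Ninv_refl(2)[OF w(1) a])
    moreover have "root_refl a \<circ> w \<in> weyl R" using weyl_step w(1) a baseR by blast
    ultimately show False using mx by fastforce
  qed
  have "- inv w b \<in> P" if "b \<in> P" for b
    by (rule weyl_neg_pos[OF weyl_inv[OF w(1)] s that])
  then show ?thesis using w(1) weyl_inv by blast
qed

lemma opposite_unique:
  assumes "v \<in> weyl R" "w \<in> weyl R" "\<And>a. a \<in> P \<Longrightarrow> - v a \<in> P" "\<And>a. a \<in> P \<Longrightarrow> - w a \<in> P"
  shows "v \<circ> w = id"
proof (rule weyl_fix_pos)
  fix b assume "b \<in> P"
  then have "- v (- w b) \<in> P" using assms by blast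
  then show "(v \<circ> w) b \<in> P" using weyl_minus assms by simp
qed (simp add: assms weyl_comp)

lemma longest_unique: "\<exists>!w. w \<in> weyl R \<and> (\<forall>a\<in>P. - w a \<in> P)"
proof -
  have inv: "inv v = w" if "v \<in> weyl R" "w \<in> weyl R" "\<forall>a\<in>P. - v a \<in> P" "\<forall>a\<in>P. - w a \<in> P" for v w
    using opposite_unique[of v w] opposite_unique[of w v] that inv_unique_comp by blast
  obtain w where w: "w \<in> weyl R" "\<forall>a\<in>P. - w a \<in> P" using longest_ex by blast
  show ?thesis by (rule ex1I[of _ w]) (use w inv in metis)+
qed

text \<open>\<open>longest\<close> is defined by word length through \<open>THE\<close>. Length
  counts inversions, there are at most \<open>card P\<close> of them, and equality singles out the
  unique element that maps \<open>P\<close> to its negative, so the description is proper.\<close>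

lemma longest_props: "w0 \<in> weyl R" "\<And>a. a \<in> P \<Longrightarrow> - w0 a \<in> P" "w0 (w0 x) = x" "inv w0 = w0"
proof -
  obtain w where w: "w \<in> weyl R" "\<And>a. a \<in> P \<Longrightarrow> - w a \<in> P" using longest_ex by blast
  have ww: "w \<circ> w = id" using opposite_unique w by blast
  then have iw: "inv w = w" using inv_unique_comp by blast
  then have cw: "card (Ninv w) = card P" using Ninv_full_iff w by metis
  have le: "card (Ninv v) \<le> card P" for v by (rule card_mono) (auto simp: finP Ninv_def)
  have "w0 = w" unfolding longest_def
  proof (rule the_equality)
    show "w \<in> weyl R \<and> (\<forall>v\<in>weyl R. word_len \<Delta> v \<le> word_len \<Delta> w)"
      using w cw le by (simp add: word_len_eq)
    fix v assume v: "v \<in> weyl R \<and> (\<forall>u\<in>weyl R. word_len \<Delta> u \<le> word_len \<Delta> v)"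
    then have "card (Ninv v) = card P" using w(1) cw le[of v] by (metis le_antisym word_len_eq)
    then have "\<forall>a\<in>P. - inv v a \<in> P" using Ninv_full_iff v by blast
    then have "inv v = w" using longest_unique w v weyl_inv by blast
    then show "v = w" using iw weyl_bij v by (metis inv_inv_eq)
  qed
  then show "w0 \<in> weyl R" "\<And>a. a \<in> P \<Longrightarrow> - w0 a \<in> P" "w0 (w0 x) = x" "inv w0 = w0"
    using w iw pointfree_idE[OF ww] by simp_all
qed

lemma eq_longestI: "w \<in> weyl R \<Longrightarrow> (\<And>a. a \<in> P \<Longrightarrow> - w a \<in> P) \<Longrightarrow> w = w0"
  using longest_unique longest_props by blast

subsection \<open>Rational elements and their graph\<close>

text \<open>Otherwise \<open>root_triple\<close> for \<open>y + t - a\<close>, \<open>a\<close>,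
  \<open>- t\<close> would make \<open>y - a\<close> or \<open>a - t\<close> a root, and a
  difference of distinct simple roots is never one.\<close>

lemma root_shift:
  assumes "y \<in> R" "y + t \<in> R" "y - a \<notin> R" "y \<noteq> a" "t \<in> \<Delta>" "a \<in> \<Delta>" "t \<noteq> a"
  shows "y + t - a \<notin> R"
proof
  assume A: "y + t - a \<in> R"
  have "a - t \<notin> R" using base_diff_notR assms by metis
  moreover have "y + t - a + - t = y - a" "a + - t = a - t" by simp_all
  moreover have "(y + t - a) + a \<in> R" "(y + t - a) + a + - t \<in> R" using assms by simp_all
  moreover have "a \<in> R" "- t \<in> R" using assms baseR uminusR by blast+
  ultimately show False
    using root_triple[of "y + t - a" a "- t"] A assms by force
qed

text \<open>With \<open>N = b - x\<close>, either \<open>b \<bullet> N > 0\<close> or \<open>x \<bullet> N < 0\<close>, so one can always move from \<open>b\<close> down or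
  from \<open>x\<close> up by a simple root other than \<open>a\<close> and stay inside the root system.\<close>
lemma not_lowerable_mono:
  assumes "x \<in> P" "b \<in> P" "x \<sqsubseteq> b" "cf a x = cf a b" "x - a \<notin> R" "x \<noteq> a" "a \<in> \<Delta>"
  shows "b - a \<notin> R"
  using assms
proof (induction "nat \<lfloor>ht b - ht x\<rfloor>" arbitrary: x b rule: less_induct)
  case less
  note p = less.prems
  have R: "x \<in> R" "b \<in> R" and sp: "x \<in> span \<Delta>" "b \<in> span \<Delta>"
    using p pos_R pos_span by auto
  show ?case
  proof (cases "x = b")
    case True then show ?thesis using p by simp
  next
    case False
    let ?N = "b - x"
    have N: "?N \<in> span \<Delta>" "nonneg_comb \<Delta> ?N" using p(3) sp by (auto simp: root_le_def span_diff)
    have cN: "cf c ?N = cf c b - cf c x" for c using sp by (simp add: cf_diff)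
    have hN: "ht b - ht x = ht ?N" using sp by (simp add: ht_diff)
    have step: "cf c ?N \<ge> 1" if "c \<in> \<Delta>" "cf c ?N > 0" for c
      using N(2) that by (auto simp: nonneg_comb_iff Nats_def)
    have ge: "cf c ?N \<ge> 0" if "c \<in> \<Delta>" for c
      using N(2) that by (auto simp: nonneg_comb_iff Nats_def)
    have hge: "ht ?N \<ge> 1" if "c \<in> \<Delta>" "cf c ?N > 0" for c
    proof -
      have "cf c ?N \<le> ht ?N" unfolding ht_def by (rule member_le_sum) (use that ge finD in auto)
      with step that show ?thesis by fastforce
    qed
    have ca: "c \<noteq> a" if "cf c ?N > 0" for c using that p(4) cN by auto
    have ex: "\<exists>c\<in>\<Delta>. cf c ?N > 0 \<and> z \<bullet> c > 0" if "z \<bullet> ?N > 0" for z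
    proof (rule ccontr)
      assume n: "\<not> ?thesis"
      have "z \<bullet> ?N = (\<Sum>c\<in>\<Delta>. cf c ?N * (z \<bullet> c))"
        by (subst cf_expand[OF N(1)], subst inner_sum_right) simp
      also have "\<dots> \<le> 0"
      proof (rule sum_nonpos)
        fix c assume "c \<in> \<Delta>"
        then show "cf c ?N * (z \<bullet> c) \<le> 0"
          using n ge[of c] by (cases "cf c ?N = 0") (auto simp: mult_le_0_iff not_less)
      qed
      finally show False using that by simp
    qed
    have "?N \<bullet> ?N > 0" using False by simp
    then have "b \<bullet> ?N > 0 \<or> (- x) \<bullet> ?N > 0" by (auto simp: inner_diff_left)
    then show ?thesis
    proof
      \<comment> \<open>Here the induction hypothesis treats the pair \<open>x\<close>,
        \<open>b - c\<close>, and \<open>root_shift\<close> returns from \<open>b - c\<close> to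
        \<open>b\<close>. In the other case \<open>root_shift\<close> comes first, from
        \<open>x\<close> to \<open>x + c\<close>.\<close>
      assume "b \<bullet> ?N > 0"
      then obtain c where c: "c \<in> \<Delta>" "cf c ?N > 0" "b \<bullet> c > 0" using ex by blast
      have "b \<noteq> c" using pos_le_base[OF p(1) c(1)] p(3) False by auto
      then have y: "b - c \<in> R" using root_diff[of b c] R c baseR by blast
      have cfy: "cf d (b - c) = cf d b - (if d = c then 1 else 0)" for d
        using sp c by (simp add: cf_diff base_span cf_base)
      have le: "cf d x \<le> cf d (b - c)" if "d \<in> \<Delta>" for d
        using step[OF c(1,2)] ge[OF that] cfy cN[of d] by auto
      then have le': "x \<sqsubseteq> b - c" using R y rle_iff by blast
      have yP: "b - c \<in> P" using y le p(1) pos_cf by (meson order_trans posI)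
      have "ht (b - c) - ht x = ht ?N - 1" using sp c by (simp add: ht_diff ht_base base_span)
      then have "nat \<lfloor>ht (b - c) - ht x\<rfloor> < nat \<lfloor>ht b - ht x\<rfloor>"
        using hge[OF c(1,2)] hN by linarith
      then have "b - c - a \<notin> R"
        using less.hyps[OF _ p(1) yP le' _ p(5,6,7)] p(4) cfy[of a] ca[OF c(2)] by simp
      moreover have "b - c \<noteq> a" using pos_le_base[OF p(1) p(7)] le' p(6) by auto
      ultimately show ?thesis
        using root_shift[of "b - c" c a] y R c p(7) ca by simp
    next
      assume "(- x) \<bullet> ?N > 0"
      then obtain c where c: "c \<in> \<Delta>" "cf c ?N > 0" "x \<bullet> c < 0" using ex[of "- x"] by auto
      have "x \<noteq> - c" using p(1) pos_not_neg[of x] base_pos[OF c(1)] by auto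
      then have y: "x + c \<in> R" using root_sum[of x c] R c baseR by blast
      have cfy: "cf d (x + c) = cf d x + (if d = c then 1 else 0)" for d
        using sp c by (simp add: cf_add base_span cf_base)
      have "cf d (x + c) \<le> cf d b" if "d \<in> \<Delta>" for d
        using step[OF c(1,2)] ge[OF that] cfy cN[of d] by auto
      then have le': "x + c \<sqsubseteq> b" using R y rle_iff by blast
      have yP: "x + c \<in> P" using y cfy pos_cf[OF p(1)] by (force intro: posI)
      have "ht b - ht (x + c) = ht ?N - 1" using sp c by (simp add: ht_diff ht_add ht_base base_span)
      then have lt: "nat \<lfloor>ht b - ht (x + c)\<rfloor> < nat \<lfloor>ht b - ht x\<rfloor>"
        using hge[OF c(1,2)] hN by linarith
      have "x + c - a \<notin> R" using root_shift[of x c a] R y p c ca by blast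
      moreover have "x + c \<noteq> a"
        using cfy[of c] cf_base[OF p(7), of c] ca[OF c(2)] pos_cf[OF p(1) c(1)] by auto
      ultimately show ?thesis
        using less.hyps[OF lt yP p(2) le' _ _ _ p(7)] p(4) cfy[of a] ca[OF c(2)] by simp
    qed
  qed
qed

text \<open>Contrapositive of \<open>not_lowerable_mono\<close>: since \<open>b\<close> can be
  lowered by \<open>a\<close>, the two \<open>a\<close>-coefficients differ, and being integers they
  differ by at least 1.\<close>

lemma le_lower:
  assumes "y \<in> P" "b \<in> P" "y \<sqsubseteq> b" "y - a \<notin> R" "y \<noteq> a" "a \<in> \<Delta>" "b - a \<in> R"
  shows "y \<sqsubseteq> b - a" "b - a \<in> P" "b - a \<noteq> a"
proof -
  have R: "y \<in> R" "b \<in> R" using assms pos_R by auto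
  have le: "\<And>c. c \<in> \<Delta> \<Longrightarrow> cf c y \<le> cf c b" using assms R rle_iff by blast
  have "cf a y \<noteq> cf a b" using not_lowerable_mono assms by blast
  with le[OF assms(6)] have lt: "cf a y < cf a b" by simp
  obtain m n where mn: "cf a y = of_int m" "cf a b = of_int n"
    using root_cf_int[OF R(1) assms(6)] root_cf_int[OF R(2) assms(6)] by (auto elim!: Ints_cases)
  with lt have "m \<le> n - 1" by simp
  then have a1: "cf a y \<le> cf a b - 1" unfolding mn by linarith
  have cfy: "cf d (b - a) = cf d b - (if d = a then 1 else 0)" for d
    using R assms(6) by (simp add: cf_diff base_span cf_base root_span)
  have le': "cf d y \<le> cf d (b - a)" if "d \<in> \<Delta>" for d using a1 le[OF that] cfy by auto
  then show y: "y \<sqsubseteq> b - a" using R assms(7) rle_iff by blast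
  show "b - a \<in> P" using assms(1,7) le' pos_cf by (meson order_trans posI)
  show "b - a \<noteq> a" using y pos_le_base[OF assms(1,6)] assms(5) by auto
qed

text \<open>The string from \<open>b\<close> to \<open>root_refl a b\<close> is descended one root
  at a time by \<open>le_lower\<close>; if the Cartan number is not positive, the reflection does
  not go down at all.\<close>

lemma le_refl_of_not_lowerable:
  assumes "y \<in> P" "b \<in> P" "y \<sqsubseteq> b" "y - a \<notin> R" "y \<noteq> a" "a \<in> \<Delta>" "b \<noteq> a"
  shows "y \<sqsubseteq> root_refl a b"
proof -
  have down: "y \<sqsubseteq> root_refl a b" if "cartan b a = of_nat k" "k > 0" "b \<in> P" "y \<sqsubseteq> b" "b \<noteq> a" for k b
    using that
  proof (induction k arbitrary: b rule: less_induct)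
    case (less k)
    note a = \<open>a \<in> \<Delta>\<close> base_nz[OF \<open>a \<in> \<Delta>\<close>]
    have R: "b \<in> R" "a \<in> R" using less.prems pos_R a baseR by auto
    have "cartan b a > 0" using less.prems(1,2) by simp
    then have "b \<bullet> a > 0" using cartan_sign(1)[OF a(2)] by blast
    then have bR: "b - a \<in> R" using root_diff R less.prems by blast
    note l = le_lower[OF assms(1) less.prems(3,4) assms(4,5,6) bR]
    \<comment> \<open>The induction lowers \<open>k\<close> by 2: from \<open>b\<close> to
      \<open>b - a\<close>, by hypothesis to its reflection, which is
      \<open>root_refl a b + a\<close>, and from there one last step down.\<close>
    have c: "cartan (b - a) a = of_nat k - 2" using less.prems(1) a by (simp add: cartan_diff cartan_self)
    have s: "root_refl a (b - a) = root_refl a b + a"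
      using a by (simp add: linear_diff[OF root_refl_linear] root_refl_self)
    let ?z = "root_refl a b + a"
    have fin: ?case if "?z \<in> P" "y \<sqsubseteq> ?z"
      using le_lower(1)[OF assms(1) that assms(4,5,6)] reflR[OF R(2,1)] by simp
    consider "k = 1" | "k = 2" | "k > 2" using less.prems(2) by linarith
    then show ?case
    proof cases
      case 1
      then have "root_refl a b = b - a" using less.prems(1) by (simp add: root_refl_cartan)
      then show ?thesis using l by simp
    next
      case 2
      then have "?z = b - a" using less.prems(1) by (simp add: root_refl_cartan scaleR_2)
      then show ?thesis using fin l by simp
    next
      case 3
      have "cartan (b - a) a = of_nat (k - 2)" using c 3 by (simp add: of_nat_diff)
      then have "y \<sqsubseteq> root_refl a (b - a)" using less.IH[of "k - 2" "b - a"] 3 l by simp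
      moreover have "root_refl a (b - a) \<in> P" using refl_pos l a by blast
      ultimately show ?thesis using fin s by simp
    qed
  qed
  have R: "b \<in> R" "a \<in> R" using assms pos_R baseR by auto
  obtain k where k: "cartan b a = of_int k" using cartanR R by (metis Ints_cases)
  show ?thesis
  proof (cases "k > 0")
    case True
    then have "cartan b a = of_nat (nat k)" using k by simp
    then show ?thesis using down[of b "nat k"] True assms by simp
  next
    case False
    then have "cf c b \<le> cf c (root_refl a b)" if "c \<in> \<Delta>" for c
      using k R assms(6) by (simp add: root_refl_cartan cf_diff cf_scale span_scale base_span cf_base root_span)
    then have "b \<sqsubseteq> root_refl a b" using R reflR rle_iff by blast
    then show ?thesis using assms(3) rle_trans by blast
  qed
qed

lemma lower_to_bottom:
  assumes "x \<in> P" "x \<noteq> a" "a \<in> \<Delta>"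
  shows "\<exists>j::nat. x - of_nat j *\<^sub>R a \<in> P \<and> x - of_nat j *\<^sub>R a - a \<notin> R \<and> x - of_nat j *\<^sub>R a \<noteq> a"
  using assms
proof (induction "nat \<lfloor>ht x\<rfloor>" arbitrary: x rule: less_induct)
  case less
  show ?case
  proof (cases "x - a \<in> R")
    case False
    then show ?thesis using less.prems by (intro exI[of _ 0]) simp
  next
    case True
    have sp: "x \<in> span \<Delta>" "a \<in> span \<Delta>" using less.prems pos_span base_span by auto
    obtain c where c: "c \<in> \<Delta>" "c \<noteq> a" "cf c x > 0" using pos_other less.prems by blast
    then have cf: "cf c (x - a) > 0" using sp less.prems by (simp add: cf_diff cf_base)
    then have P: "x - a \<in> P" using pos_if_cf True c by blast
    have ne: "x - a \<noteq> a" using cf cf_base[OF \<open>a \<in> \<Delta>\<close>, of c] c by auto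
    have "ht (x - a) = ht x - 1" using sp less.prems by (simp add: ht_diff ht_base)
    then have "nat \<lfloor>ht (x - a)\<rfloor> < nat \<lfloor>ht x\<rfloor>" using pos_ht[OF P] by linarith
    then obtain j :: nat where j: "x - a - of_nat j *\<^sub>R a \<in> P \<and> x - a - of_nat j *\<^sub>R a - a \<notin> R \<and> x - a - of_nat j *\<^sub>R a \<noteq> a"
      using less.hyps P ne less.prems by blast
    have "x - a - of_nat j *\<^sub>R a = x - of_nat (Suc j) *\<^sub>R a" by (simp add: algebra_simps)
    then show ?thesis using j by metis
  qed
qed

text \<open>Post-fixed points of the operator whose iteration defines \<open>nu\<close>.\<close>
definition stable :: "('a \<Rightarrow> 'a) \<Rightarrow> 'a set \<Rightarrow> bool" where
  "stable u A \<longleftrightarrow> A \<noteq> {} \<and> A \<subseteq> P \<and> (\<forall>a\<in>A. \<exists>b\<in>P. u b = a \<and> (\<exists>a'\<in>A. b \<sqsubseteq> a'))"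

lemma stableD:
  "stable u A \<Longrightarrow> a \<in> A \<Longrightarrow> a \<in> P \<and> (\<exists>b c. b \<in> P \<and> u b = a \<and> c \<in> A \<and> b \<sqsubseteq> c)"
  unfolding stable_def by blast

lemma nu_decreasing: "nu R \<Delta> u (Suc k) \<subseteq> nu R \<Delta> u k"
proof (induction k)
  case 0 then show ?case by (auto simp: Adj_def)
next
  case (Suc k) then show ?case by (auto simp: Adj_def)
qed

text \<open>A stable set survives every step of the descending sequence. Conversely, a term of least
  cardinality equals its successor, and if nonempty it is itself stable.\<close>

lemma rational_iff: "rational R \<Delta> u \<longleftrightarrow> (\<nexists>A. stable u A)"
proof
  assume "rational R \<Delta> u"
  then obtain k where k: "nu R \<Delta> u k = {}" unfolding rational_def by blast
  show "\<nexists>A. stable u A"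
  proof
    assume "\<exists>A. stable u A"
    then obtain A where A: "stable u A" by blast
    have "A \<subseteq> nu R \<Delta> u m" for m
    proof (induction m)
      case 0
      then show ?case using A by (fastforce simp: stable_def)
    next
      case (Suc m)
      show ?case
      proof
        fix a assume "a \<in> A"
        then obtain b a' where "b \<in> P" "u b = a" "a' \<in> A" "b \<sqsubseteq> a'" "a \<in> P"
          using A unfolding stable_def by blast
        then show "a \<in> nu R \<Delta> u (Suc m)" using Suc by (auto simp: Adj_def)
      qed
    qed
    then show False using k A unfolding stable_def by blast
  qed
next
  assume n: "\<nexists>A. stable u A"
  have fin: "finite (nu R \<Delta> u k)" for k
    by (cases k) (auto intro: finite_subset[OF _ finP])
  obtain k where k: "\<And>m. card (nu R \<Delta> u k) \<le> card (nu R \<Delta> u m)"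
    using exists_least_iff[of "\<lambda>n. \<exists>k. card (nu R \<Delta> u k) = n"] by (metis not_less)
  then have e: "nu R \<Delta> u (Suc k) = nu R \<Delta> u k"
    using card_subset_eq[OF fin nu_decreasing] nu_decreasing card_mono[OF fin] by (metis le_antisym)
  have "nu R \<Delta> u k = {}"
  proof (rule ccontr)
    assume "nu R \<Delta> u k \<noteq> {}"
    moreover have "nu R \<Delta> u k \<subseteq> P" by (cases k) auto
    moreover have "\<exists>b\<in>P. u b = a \<and> (\<exists>a'\<in>nu R \<Delta> u k. b \<sqsubseteq> a')" if "a \<in> nu R \<Delta> u k" for a
    proof -
      have "a \<in> u ` Adj R \<Delta> (nu R \<Delta> u k)" using that e by auto
      then show ?thesis by (auto simp: Adj_def)
    qed
    ultimately have "stable u (nu R \<Delta> u k)" unfolding stable_def by blast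
    with n show False by blast
  qed
  moreover have "nu R \<Delta> u m \<subseteq> nu R \<Delta> u k" if "m \<ge> k" for m
    by (rule lift_Suc_antimono_le[of "nu R \<Delta> u", OF nu_decreasing that])
  ultimately show "rational R \<Delta> u" unfolding rational_def by blast
qed

text \<open>A set stable under \<open>root_refl a \<circ> u\<close> yields one stable under \<open>u\<close>: move each \<open>b\<close> with
  \<open>(root_refl a \<circ> u) b\<close> in the set down to the bottom of its \<open>a\<close>-string. As \<open>- u a \<in> P\<close>,
  this only enlarges \<open>u b\<close>.\<close>
lemma rational_step:
  assumes u: "u \<in> weyl R" and a: "a \<in> \<Delta>" and up: "inv u a \<in> P" and down: "- u a \<in> P"
    and rat: "rational R \<Delta> u"
  shows "rational R \<Delta> (root_refl a \<circ> u)"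
proof (rule ccontr)
  assume "\<not> ?thesis"
  then obtain A' where A': "stable (root_refl a \<circ> u) A'" using rational_iff by blast
  have a0: "a \<noteq> 0" using a base_nz by blast
  note lin = weyl_linear[OF u] root_refl_linear[of a]
  \<comment> \<open>The roots at which \<open>refl_pos\<close> and the strings fail have to be
    excluded: \<open>c = a\<close> would give \<open>b = - inv u a\<close>, and \<open>b = a\<close>
    would, by \<open>down\<close>, give \<open>inv u a = - a\<close>. Both contradict
    \<open>up\<close>.\<close>
  have ne: "c \<in> P \<and> c \<noteq> a \<and> b \<noteq> a" if "c \<in> A'" "b \<in> P" "root_refl a (u b) = c" for b c
  proof (intro conjI notI)
    show c: "c \<in> P" using A' that unfolding stable_def by blast
    have ub: "u b = root_refl a c" using that root_refl_invol[OF a0] by metis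
    { assume "c = a"
      then have "u b = - a" using ub root_refl_self[OF a0] by simp
      then have "b = - inv u a" using weyl_inv_f[OF u, of b] weyl_minus[OF weyl_inv[OF u]] by metis
      then show False using up that(2) pos_not_neg by auto }
    { assume "b = a"
      then have "- root_refl a (- u a) \<in> P" using that c linear_neg[OF lin(2)] by simp
      then have "- u a = a" using refl_base_neg[OF down a] by blast
      then have "u a = - a" by (metis minus_minus)
      then have "inv u a = - a" using weyl_inv_f[OF u, of a] weyl_minus[OF weyl_inv[OF u]]
        by (metis minus_minus)
      then show False using up pos_not_neg base_pos[OF a] by auto }
  qed
  define A where "A = {u y |y. y \<in> P \<and> y - a \<notin> R \<and> y \<noteq> a \<and>
    (\<exists>b\<in>P. \<exists>j::nat. root_refl a (u b) \<in> A' \<and> y = b - of_nat j *\<^sub>R a)}"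
  \<comment> \<open>Subtracting \<open>of_nat j *\<^sub>R a\<close> adds \<open>j\<close> copies of
    the positive root \<open>- u a\<close> to the image. The double reflection is just
    \<open>u b\<close>, written to match \<open>root_refl a c\<close> for \<open>c\<close> in
    \<open>A'\<close>.\<close>
  have big: "root_refl a (root_refl a (u b)) \<sqsubseteq> u y \<and> u y \<in> P"
    if "y \<in> P" "b \<in> P" "root_refl a (u b) \<in> A'" "y = b - of_nat j *\<^sub>R a" for y b and j :: nat
  proof -
    have ubP: "u b \<in> P"
      using ne[OF that(3,2) refl] refl_pos[OF _ a] root_refl_invol[OF a0] by metis
    have uyR: "u y \<in> R" using weyl_R[OF u] that(1) pos_R by blast
    have "u y = u b + of_nat j *\<^sub>R (- u a)" using that(4) lin by (simp add: linear_diff linear_scale)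
    then have "cf c (u y) = cf c (u b) + of_nat j * cf c (- u a)" for c
      using ubP down pos_span by (simp add: cf_add cf_scale span_scale del: scaleR_minus_right)
    then have le: "cf c (u b) \<le> cf c (u y)" if "c \<in> \<Delta>" for c using pos_cf[OF down that] by simp
    then have "u b \<sqsubseteq> u y" using ubP uyR pos_R rle_iff by blast
    moreover have "u y \<in> P" using uyR le pos_cf[OF ubP] by (meson order_trans posI)
    ultimately show ?thesis using root_refl_invol[OF a0] by simp
  qed
  have ex: "\<exists>y. y \<in> P \<and> y - a \<notin> R \<and> y \<noteq> a \<and> u y \<in> A \<and> root_refl a c \<sqsubseteq> u y" if c: "c \<in> A'" for c
  proof -
    obtain b where b: "b \<in> P" "root_refl a (u b) = c" using A' c unfolding stable_def by auto
    then obtain j :: nat where j: "b - of_nat j *\<^sub>R a \<in> P" "b - of_nat j *\<^sub>R a - a \<notin> R"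
        "b - of_nat j *\<^sub>R a \<noteq> a"
      using lower_to_bottom[OF b(1) _ a] ne[OF c] by blast
    then have "u (b - of_nat j *\<^sub>R a) \<in> A" unfolding A_def using b c by blast
    then show ?thesis using j big[OF j(1) b(1)] b c by blast
  qed
  have "stable u A"
    unfolding stable_def
  proof (intro conjI ballI)
    show "A \<noteq> {}" using ex A' unfolding stable_def by blast
    show "A \<subseteq> P" unfolding A_def using big by blast
    fix z assume "z \<in> A"
    then obtain y b and j :: nat where y: "z = u y" "y \<in> P" "y - a \<notin> R" "y \<noteq> a" "b \<in> P"
      "root_refl a (u b) \<in> A'" "y = b - of_nat j *\<^sub>R a" unfolding A_def by blast
    then obtain b' c where c: "c \<in> A'" "b' \<in> P" "root_refl a (u b') = root_refl a (u b)" "b' \<sqsubseteq> c"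
      using A' unfolding stable_def by (metis comp_apply)
    have "b' = b" using c(3) root_refl_invol[OF a0] weyl_inv_f[OF u] by metis
    have "y \<sqsubseteq> b"
      using y pos_R a by (subst rle_iff) (auto simp: cf_diff pos_span span_scale base_span cf_scale cf_base)
    then have "y \<sqsubseteq> c" using c \<open>b' = b\<close> rle_trans by blast
    moreover have cP: "c \<in> P" "c \<noteq> a"
      using c(1) A' ne unfolding stable_def by (metis comp_apply)+
    \<comment> \<open>Here it matters that \<open>y\<close> is the bottom of its string: for such
      \<open>y\<close> the relation \<open>y \<sqsubseteq> c\<close> passes to the reflected root,
      which lies below a member of \<open>A\<close> by \<open>ex\<close>.\<close>
    ultimately have "y \<sqsubseteq> root_refl a c"
      using le_refl_of_not_lowerable y a by blast
    moreover obtain y' where "u y' \<in> A" "root_refl a c \<sqsubseteq> u y'" using ex[OF c(1)] by blast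
    ultimately show "\<exists>b\<in>P. u b = z \<and> (\<exists>a'\<in>A. b \<sqsubseteq> a')" using y rle_trans by blast
  qed
  then show False using rat rational_iff by blast
qed

end

section \<open>Ascending steps from rational elements\<close>

lemma finite_eventual_image:
  "finite U \<Longrightarrow> U \<noteq> {} \<Longrightarrow> f ` U \<subseteq> U \<Longrightarrow> \<exists>A\<subseteq>U. A \<noteq> {} \<and> f ` A = A"
proof (induction U rule: finite_psubset_induct)
  case (psubset U)
  show ?case
  proof (cases "f ` U = U")
    case False
    with psubset.prems(2) have ss: "f ` U \<subset> U" by (rule psubsetI)
    have ne: "f ` U \<noteq> {}" using psubset.prems(1) by simp
    have im: "f ` f ` U \<subseteq> f ` U" by (rule image_mono) (rule psubset.prems(2))
    obtain A where "A \<subseteq> f ` U" "A \<noteq> {}" "f ` A = A"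
      using psubset.IH[OF ss ne im] by (elim exE conjE)
    with psubset.prems(2) show ?thesis by (intro exI[of _ A]) simp
  next
    case True
    then show ?thesis using psubset.prems(1) by (intro exI[of _ U]) simp
  qed
qed

context based_roots begin

lemma rational_ascent:
  assumes u: "u \<in> weyl R" and rat: "rational R \<Delta> u" and ne: "u \<noteq> w0"
  shows "\<exists>a\<in>\<Delta>. inv u a \<in> P \<and> - u a \<in> P"
proof (rule ccontr)
  assume n: "\<not> ?thesis"
  define U where "U = {a \<in> \<Delta>. inv u a \<in> P}"
  have iu: "inv u \<in> weyl R" "linear (inv u)" using weyl_inv[OF u] weyl_linear by auto
  have fin: "finite U" using finD by (simp add: U_def)
  have U: "U \<noteq> {}"
  proof
    assume e: "U = {}"
    have s: "- inv u a \<in> P" if "a \<in> \<Delta>" for a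
    proof -
      have "inv u a \<in> R" using weyl_R[OF iu(1)] that baseR by blast
      then show ?thesis using e that not_pos_iff unfolding U_def by blast
    qed
    have "inv u = w0" by (rule eq_longestI[OF iu(1)]) (rule weyl_neg_pos[OF iu(1) s])
    then show False using ne longest_props(4) weyl_bij[OF u] by (metis inv_inv_eq)
  qed
  have pos: "u a \<in> P" if "a \<in> U" for a
  proof -
    have "u a \<in> R" using weyl_R[OF u] that baseR unfolding U_def by blast
    then show ?thesis using n that not_pos_iff unfolding U_def by blast
  qed
  \<comment> \<open>If no member of \<open>U\<close> occurred in \<open>u a\<close>, then
    \<open>inv u\<close> would make every simple root in its support negative, and hence also
    \<open>inv u (u a) = a\<close>.\<close>
  have "\<exists>d\<in>U. d \<sqsubseteq> u a" if a: "a \<in> U" for a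
  proof (rule ccontr)
    assume m: "\<not> ?thesis"
    have "nonneg_comb \<Delta> (- inv u (u a))"
    proof (rule nonneg_comb_map[of "\<lambda>x. - inv u x", OF linear_compose_neg[OF iu(2)]])
      show "nonneg_comb \<Delta> (u a)" using pos[OF a] pos_comb by blast
      fix c assume c: "c \<in> \<Delta>" "cf c (u a) \<noteq> 0"
      have c1: "cf c (u a) \<ge> 1"
        using pos_comb[OF pos[OF a]] c by (auto simp: nonneg_comb_iff Nats_def)
      have "c \<sqsubseteq> u a"
      proof (subst rle_iff)
        show "c \<in> R" "u a \<in> R" using c baseR pos[OF a] pos_R by auto
        show "\<forall>d\<in>\<Delta>. cf d c \<le> cf d (u a)" using c1 pos_cf[OF pos[OF a]] c(1) by (simp add: cf_base)
      qed
      then have "c \<notin> U" using m by blast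
      moreover have "inv u c \<in> R" using weyl_R[OF iu(1)] c baseR by blast
      ultimately have "- inv u c \<in> P" using c not_pos_iff unfolding U_def by blast
      then show "nonneg_comb \<Delta> (- inv u c)" by (rule pos_comb)
    qed
    then have "nonneg_comb \<Delta> (- a)" using weyl_inv_f[OF u] by simp
    moreover have aP: "a \<in> P" using a base_pos unfolding U_def by blast
    moreover have "- a \<in> R" by (rule uminusR[OF pos_R[OF aP]])
    ultimately have "- a \<in> P" unfolding pos_roots_def by blast
    then show False using pos_not_neg[OF aP] by blast
  qed
  then have "\<forall>a\<in>U. \<exists>d. d \<in> U \<and> d \<sqsubseteq> u a" by blast
  then obtain f where "\<forall>a\<in>U. f a \<in> U \<and> f a \<sqsubseteq> u a" by (rule bchoice[THEN exE])
  then have f: "\<And>a. a \<in> U \<Longrightarrow> f a \<in> U" "\<And>a. a \<in> U \<Longrightarrow> f a \<sqsubseteq> u a" by auto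
  \<comment> \<open>In a stable set every \<open>u b\<close> needs \<open>b\<close> below some
    member, so \<open>b\<close> has to be a value of \<open>f\<close>. Hence the passage to a subset
    that \<open>f\<close> maps onto itself.\<close>
  have "f ` U \<subseteq> U" using f(1) by (rule image_subsetI)
  from finite_eventual_image[OF fin U this]
  obtain A where A: "A \<subseteq> U" "A \<noteq> {}" "f ` A = A" by (elim exE conjE)
  have "stable u (u ` A)"
    unfolding stable_def
  proof (intro conjI ballI)
    show "u ` A \<noteq> {}" "u ` A \<subseteq> P" using A pos by auto
    fix x assume "x \<in> u ` A"
    then obtain b where b: "b \<in> A" "x = u b" by blast
    then have "b \<in> f ` A" unfolding A(3) by simp
    then obtain c where c: "c \<in> A" "b = f c" by (rule imageE)
    have "b \<sqsubseteq> u c" unfolding c(2) by (rule f(2)[OF subsetD[OF A(1) c(1)]])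
    moreover have "u c \<in> u ` A" using c(1) by simp
    moreover have "b \<in> P" using b A base_pos unfolding U_def by blast
    ultimately show "\<exists>b\<in>P. u b = x \<and> (\<exists>a'\<in>u ` A. b \<sqsubseteq> a')" using b by blast
  qed
  then show False using rat rational_iff by blast
qed

section \<open>Paths in the rationality graph\<close>

abbreviation "E \<equiv> rat_edge R \<Delta>"
abbreviation "ep a \<equiv> diag_aut R \<Delta> a"

lemma rational_longest: "rational R \<Delta> w0"
  unfolding rational_iff
proof
  assume "\<exists>A. stable w0 A"
  then obtain A a where "stable w0 A" "a \<in> A" unfolding stable_def by auto
  then obtain b where b: "b \<in> P" "w0 b \<in> P" unfolding stable_def by fastforce
  show False using pos_not_neg[OF b(2)] longest_props(2)[OF b(1)] by (rule notE)
qed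

text \<open>The number of inversions rises by one in each step and is bounded by
  \<open>card P\<close>. The second conjunct records the last vertex before \<open>w0\<close>, which
  is what \<open>card_vertices\<close> needs.\<close>

lemma rational_path:
  assumes "u \<in> weyl R" "rational R \<Delta> u"
  shows "E\<^sup>*\<^sup>* u w0 \<and> (u = w0 \<or> (\<exists>a\<in>\<Delta>. rational R \<Delta> (root_refl a \<circ> w0)))"
  using assms
proof (induction "card P - card (Ninv u)" arbitrary: u rule: less_induct)
  case less
  show ?case
  proof (cases "u = w0")
    case True then show ?thesis by simp
  next
    case False
    obtain a where a: "a \<in> \<Delta>" "inv u a \<in> P" "- u a \<in> P"
      using rational_ascent[OF less.prems False] by blast
    let ?v = "root_refl a \<circ> u"
    have v: "?v \<in> weyl R" "rational R \<Delta> ?v"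
      using weyl_step[OF _ less.prems(1)] a(1) baseR rational_step[OF less.prems(1) a less.prems(2)] by auto
    have "card (Ninv ?v) = Suc (card (Ninv u))" using Ninv_refl(2)[OF less.prems(1) a(1,2)] .
    moreover have "card (Ninv ?v) \<le> card P" by (rule card_mono) (auto simp: finP Ninv_def)
    ultimately have lt: "card P - card (Ninv ?v) < card P - card (Ninv u)" by linarith
    have uv: "u = root_refl a \<circ> ?v"
      unfolding comp_assoc[symmetric] root_refl_comp_self[OF base_nz[OF a(1)]] by simp
    have "E u ?v" unfolding rat_edge_def rat_vertices_def using less.prems v a(1) uv by blast
    moreover have IH: "E\<^sup>*\<^sup>* ?v w0 \<and> (?v = w0 \<or> (\<exists>a\<in>\<Delta>. rational R \<Delta> (root_refl a \<circ> w0)))"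
      using less.hyps[OF lt v] .
    ultimately have "E\<^sup>*\<^sup>* u w0" by (meson converse_rtranclp_into_rtranclp)
    moreover have "\<exists>a\<in>\<Delta>. rational R \<Delta> (root_refl a \<circ> w0)"
      using IH uv a(1) less.prems(2) by metis
    ultimately show ?thesis by blast
  qed
qed

lemma rat_edge_sym: "E u v \<Longrightarrow> E v u"
proof -
  assume "E u v"
  then obtain a where a: "u \<in> rat_vertices R \<Delta>" "v \<in> rat_vertices R \<Delta>" "a \<in> \<Delta>" "u = root_refl a \<circ> v"
    unfolding rat_edge_def by blast
  have "v = root_refl a \<circ> u"
    unfolding a(4) comp_assoc[symmetric] root_refl_comp_self[OF base_nz[OF a(3)]] by simp
  then show ?thesis unfolding rat_edge_def using a by blast
qed

lemma graph_connected: "rat_graph_connected R \<Delta>"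
  unfolding rat_graph_connected_def
proof (intro conjI ballI)
  show "rat_vertices R \<Delta> \<noteq> {}"
    using rational_longest longest_props(1) unfolding rat_vertices_def by blast
  have to: "E\<^sup>*\<^sup>* u w0" if "u \<in> rat_vertices R \<Delta>" for u
    using rational_path that unfolding rat_vertices_def by blast
  have "symp E\<^sup>*\<^sup>*" by (rule symp_rtranclp) (use rat_edge_sym in \<open>simp add: sympI\<close>)
  then show "E\<^sup>*\<^sup>* u v" if "u \<in> rat_vertices R \<Delta>" "v \<in> rat_vertices R \<Delta>" for u v
    using to[OF that(1)] sympD[of "E\<^sup>*\<^sup>*", OF _ to[OF that(2)]] by (simp add: rtranclp_trans)
qed

section \<open>The diagram automorphism as a linear map\<close>

lemma ep_eq: "ep a = - w0 a" by (simp add: diag_aut_def)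

lemma ep_linear: "linear (diag_aut R \<Delta>)"
  unfolding diag_aut_def using linear_compose_neg weyl_linear[OF longest_props(1)] by blast

lemma ep_ep: "ep (ep a) = a"
  using weyl_minus[OF longest_props(1)] longest_props(3) by (simp add: ep_eq)

lemma ep_inner: "ep a \<bullet> ep b = a \<bullet> b"
  using weyl_inner[OF longest_props(1)] by (simp add: ep_eq)

lemma ep_pos: "a \<in> P \<Longrightarrow> ep a \<in> P" using longest_props(2) by (simp add: ep_eq)

lemma ep_mono: "x \<sqsubseteq> y \<Longrightarrow> ep x \<sqsubseteq> ep y"
  unfolding root_le_def linear_diff[OF ep_linear, symmetric]
  by (rule nonneg_comb_map[OF ep_linear]) (simp_all add: pos_comb ep_pos base_pos)

text \<open>Simple roots are minimal in \<open>P\<close> and \<open>ep\<close> preserves the order: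
  a simple \<open>d\<close> below \<open>ep a\<close> has \<open>ep d\<close> below
  \<open>a\<close>, hence equal to it.\<close>

lemma ep_base: "a \<in> \<Delta> \<Longrightarrow> ep a \<in> \<Delta>"
proof -
  assume a: "a \<in> \<Delta>"
  then have p: "ep a \<in> P" by (rule ep_pos[OF base_pos])
  obtain d where d: "d \<in> \<Delta>" "cf d (ep a) > 0" using pos_ex_cf[OF p] by blast
  then have d1: "cf d (ep a) \<ge> 1" using pos_comb[OF p] by (auto simp: nonneg_comb_iff Nats_def)
  have "d \<sqsubseteq> ep a"
  proof (subst rle_iff)
    show "d \<in> R" "ep a \<in> R" using d baseR p pos_R by auto
    show "\<forall>c\<in>\<Delta>. cf c d \<le> cf c (ep a)" using d1 pos_cf[OF p] d(1) by (simp add: cf_base)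
  qed
  then have "ep d \<sqsubseteq> a" using ep_mono ep_ep by metis
  then have "ep d = a" by (rule pos_le_base[OF ep_pos[OF base_pos[OF d(1)]] a])
  then show ?thesis using ep_ep d by metis
qed

lemma longest_minus_iff: "(\<forall>b\<in>R. w0 b = - b) \<longleftrightarrow> (\<forall>a\<in>\<Delta>. ep a = a)"
proof
  assume "\<forall>b\<in>R. w0 b = - b"
  then show "\<forall>a\<in>\<Delta>. ep a = a" using baseR by (auto simp: ep_eq)
next
  assume e: "\<forall>a\<in>\<Delta>. ep a = a"
  have "ep b = b" if b: "b \<in> R" for b
  proof -
    have "ep b = (\<Sum>a\<in>\<Delta>. cf a b *\<^sub>R ep a)"
      by (subst cf_expand[OF root_span[OF b]]) (simp add: linear_sum[OF ep_linear] linear_scale[OF ep_linear])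
    also have "\<dots> = (\<Sum>a\<in>\<Delta>. cf a b *\<^sub>R a)" using e by (intro sum.cong) auto
    also have "\<dots> = b" by (rule cf_expand[OF root_span[OF b], symmetric])
    finally show ?thesis .
  qed
  then show "\<forall>b\<in>R. w0 b = - b" by (metis ep_eq minus_minus)
qed

text \<open>The only positive root that stays positive is \<open>ep a\<close>, which goes to
  \<open>a\<close>. So a stable set can only be \<open>{a}\<close>, and it is stable iff
  \<open>ep a \<sqsubseteq> a\<close>, that is, iff \<open>ep a = a\<close>.\<close>

lemma rational_near_longest:
  assumes a: "a \<in> \<Delta>"
  shows "rational R \<Delta> (root_refl a \<circ> w0) \<longleftrightarrow> ep a \<noteq> a"
proof
  assume r: "rational R \<Delta> (root_refl a \<circ> w0)"
  show "ep a \<noteq> a"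
  proof
    assume "ep a = a"
    then have "root_refl a (w0 a) = a"
      using root_refl_self[OF base_nz[OF a]] linear_neg[OF root_refl_linear, of a a]
      by (metis ep_eq minus_minus)
    then have "stable (root_refl a \<circ> w0) {a}" unfolding stable_def using base_pos[OF a] rle_refl by auto
    then show False using r rational_iff by blast
  qed
next
  assume e: "ep a \<noteq> a"
  show "rational R \<Delta> (root_refl a \<circ> w0)"
  proof (rule ccontr)
    assume "\<not> ?thesis"
    then obtain A where A: "stable (root_refl a \<circ> w0) A" using rational_iff by blast
    have *: "ep b = a \<and> c = a" if "b \<in> P" "c \<in> P" "root_refl a (w0 b) = c" for b c
    proof -
      have "- root_refl a (ep b) = c"
        using linear_neg[OF root_refl_linear, of a "w0 b"] that(3) unfolding ep_eq by simp
      then have "- root_refl a (ep b) \<in> P" using that(2) by simp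
      then have "ep b = a" using refl_base_neg[OF ep_pos[OF that(1)] a] by blast
      moreover from this have "w0 b = - a" by (metis ep_eq minus_minus)
      then have "root_refl a (w0 b) = a"
        using root_refl_self[OF base_nz[OF a]] linear_neg[OF root_refl_linear, of a a] by simp
      ultimately show ?thesis using that by simp
    qed
    obtain c where c: "c \<in> A" using A unfolding stable_def by blast
    from stableD[OF A c] obtain b c'
      where b: "b \<in> P" "c \<in> P" "root_refl a (w0 b) = c" "c' \<in> A" "b \<sqsubseteq> c'" by auto
    from stableD[OF A b(4)] obtain b' where "b' \<in> P" "root_refl a (w0 b') = c'" "c' \<in> P" by auto
    then have "c' = a" using *[of b' c'] by blast
    then have "b = a" using pos_le_base[OF b(1) a] b(5) by simp
    then show False using *[OF b(1,2,3)] e by simp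
  qed
qed

lemma card_vertices: "card (rat_vertices R \<Delta>) > 1 \<longleftrightarrow> \<not> (\<forall>b\<in>R. w0 b = - b)"
proof -
  have fin: "finite (rat_vertices R \<Delta>)" using finite_weyl by (simp add: rat_vertices_def)
  have w: "w0 \<in> rat_vertices R \<Delta>" using rational_longest longest_props(1) by (simp add: rat_vertices_def)
  show ?thesis unfolding longest_minus_iff
  proof
    assume "card (rat_vertices R \<Delta>) > 1"
    then have "\<not> rat_vertices R \<Delta> \<subseteq> {w0}" using card_mono[of "{w0}" "rat_vertices R \<Delta>"] by auto
    then obtain u where "u \<in> weyl R" "rational R \<Delta> u" "u \<noteq> w0" unfolding rat_vertices_def by blast
    then obtain a where "a \<in> \<Delta>" "rational R \<Delta> (root_refl a \<circ> w0)" using rational_path by blast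
    then show "\<not> (\<forall>a\<in>\<Delta>. ep a = a)" using rational_near_longest by blast
  next
    assume "\<not> (\<forall>a\<in>\<Delta>. ep a = a)"
    then obtain a where a: "a \<in> \<Delta>" "ep a \<noteq> a" by blast
    let ?v = "root_refl a \<circ> w0"
    have v: "?v \<in> rat_vertices R \<Delta>"
      using a rational_near_longest[OF a(1)] weyl_step[OF _ longest_props(1), of a] baseR
      unfolding rat_vertices_def by blast
    have "?v \<noteq> w0"
    proof
      assume "?v = w0"
      then have "root_refl a (w0 (w0 a)) = w0 (w0 a)" by (metis comp_apply)
      then have "- a = a" using longest_props(3) root_refl_self[OF base_nz[OF a(1)]] by simp
      then show False using pos_not_neg[OF base_pos[OF a(1)]] base_pos[OF a(1)] by simp
    qed
    then have "card {?v, w0} = 2" by simp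
    moreover have "card {?v, w0} \<le> card (rat_vertices R \<Delta>)"
      by (rule card_mono[OF fin]) (use v w in blast)
    ultimately show "card (rat_vertices R \<Delta>) > 1" by linarith
  qed
qed

section \<open>Conjugation by the longest element\<close>

abbreviation "cj u \<equiv> w0 \<circ> u \<circ> w0"

lemma cj_cj: "cj (cj u) = u"
  using longest_props(3) by (auto simp: fun_eq_iff)

lemma cj_weyl: "u \<in> weyl R \<Longrightarrow> cj u \<in> weyl R"
  using longest_props(1) weyl_comp by blast

text \<open>The linear map \<open>- w0\<close> preserves \<open>P\<close> and the order and
  intertwines \<open>u\<close> with \<open>cj u\<close>, so it transports stable sets. Conjugation
  is an involution, hence one direction suffices.\<close>

lemma rational_cj:
  assumes u: "u \<in> weyl R"
  shows "rational R \<Delta> (cj u) \<longleftrightarrow> rational R \<Delta> u"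
proof -
  have *: "\<exists>B. stable (cj u) B" if A: "stable u A" and u: "u \<in> weyl R" for u A
  proof (intro exI)
    show "stable (cj u) (diag_aut R \<Delta> ` A)"
      unfolding stable_def
    proof (intro conjI ballI)
      show "diag_aut R \<Delta> ` A \<noteq> {}" "diag_aut R \<Delta> ` A \<subseteq> P"
        using A ep_pos unfolding stable_def by auto
      fix x assume "x \<in> diag_aut R \<Delta> ` A"
      then obtain a where a: "a \<in> A" "x = ep a" by blast
      then obtain b a' where b: "b \<in> P" "u b = a" "a' \<in> A" "b \<sqsubseteq> a'" using A unfolding stable_def by blast
      have "cj u (ep b) = x"
        using b a longest_props(3) weyl_minus[OF longest_props(1)] weyl_minus[OF u] by (simp add: ep_eq)
      then show "\<exists>b\<in>P. cj u b = x \<and> (\<exists>a'\<in>diag_aut R \<Delta> ` A. b \<sqsubseteq> a')"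
        using b ep_pos ep_mono by blast
    qed
  qed
  show ?thesis using *[OF _ u] *[OF _ cj_weyl[OF u]] unfolding cj_cj rational_iff by blast
qed

lemma cj_refl: "cj (root_refl a) = root_refl (ep a)"
proof -
  have "w0 \<circ> root_refl a \<circ> w0 = root_refl (w0 a) \<circ> (w0 \<circ> w0)"
    unfolding weyl_conj_refl[OF longest_props(1)] comp_assoc ..
  also have "w0 \<circ> w0 = id" using longest_props(3) by (simp add: fun_eq_iff)
  finally have "cj (root_refl a) = root_refl (w0 a)" unfolding comp_id .
  then show ?thesis unfolding ep_eq root_refl_minus .
qed

lemma cj_comp: "cj (u \<circ> v) = cj u \<circ> cj v"
  using longest_props(3) by (simp add: fun_eq_iff)

lemma eps_ext_cj: "is_eps_ext R \<Delta> (\<lambda>u. cj u)"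
  unfolding is_eps_ext_def
proof (intro conjI ballI)
  show "bij_betw (\<lambda>u. cj u) (weyl R) (weyl R)"
    by (rule bij_betw_byWitness[where f' = "\<lambda>u. cj u"]) (use cj_cj cj_weyl in auto)
qed (rule cj_comp cj_refl)+

text \<open>The simple reflections generate \<open>weyl R\<close>, so claims about an arbitrary
  extension reduce to claims about \<open>cj\<close>.\<close>

lemma eps_ext_unique:
  assumes phi: "is_eps_ext R \<Delta> \<phi>" and u: "u \<in> weyl R"
  shows "\<phi> u = cj u"
proof -
  have hom: "\<And>u v. u \<in> weyl R \<Longrightarrow> v \<in> weyl R \<Longrightarrow> \<phi> (u \<circ> v) = \<phi> u \<circ> \<phi> v"
    and gen: "\<And>a. a \<in> \<Delta> \<Longrightarrow> \<phi> (root_refl a) = root_refl (ep a)"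
    and img: "\<And>u. u \<in> weyl R \<Longrightarrow> \<phi> u \<in> weyl R"
    using phi unfolding is_eps_ext_def by (auto dest: bij_betwE)
  have "\<phi> id = \<phi> id \<circ> \<phi> id" using hom[OF weyl_id weyl_id] by (metis id_comp)
  then have "\<phi> id x = \<phi> id (\<phi> id x)" for x by (metis comp_apply)
  then have "\<phi> id x = x" for x using weyl_inv_f[OF img[OF weyl_id]] by metis
  then have i: "\<phi> id = id" by (simp add: fun_eq_iff)
  have w: "\<phi> (word_prod ws) = cj (word_prod ws)" if "set ws \<subseteq> \<Delta>" for ws
    using that
  proof (induction ws)
    case Nil
    show ?case unfolding word_Nil i using longest_props(3) by (simp add: fun_eq_iff)
  next
    case (Cons a ws)
    have "\<phi> (word_prod (a # ws)) = \<phi> (root_refl a) \<circ> \<phi> (word_prod ws)"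
      unfolding word_Cons using hom weyl_refl word_weyl Cons.prems baseR
      by (metis insert_subset list.simps(15) subset_iff)
    also have "\<phi> (root_refl a) = cj (root_refl a)" unfolding cj_refl by (rule gen) (use Cons.prems in simp)
    also have "\<phi> (word_prod ws) = cj (word_prod ws)" by (rule Cons.IH) (use Cons.prems in simp)
    finally show ?case unfolding word_Cons cj_comp .
  qed
  obtain ws where ws: "set ws \<subseteq> \<Delta>" "word_prod ws = u" using weyl_word u by blast
  show ?thesis using w[OF ws(1)] unfolding ws(2) .
qed

lemma eps_part:
  "\<exists>\<phi>. is_eps_ext R \<Delta> \<phi>"
  "is_eps_ext R \<Delta> \<phi> \<Longrightarrow> u \<in> weyl R \<Longrightarrow> rational R \<Delta> u \<longleftrightarrow> rational R \<Delta> (\<phi> u)"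
  "is_eps_ext R \<Delta> \<phi> \<Longrightarrow> u \<in> weyl R \<Longrightarrow> \<phi> (\<phi> u) = u"
  "is_eps_ext R \<Delta> \<phi> \<Longrightarrow> \<phi> w0 = w0"
proof -
  show "\<exists>\<phi>. is_eps_ext R \<Delta> \<phi>" using eps_ext_cj by blast
  assume p: "is_eps_ext R \<Delta> \<phi>"
  show "\<phi> w0 = w0"
    using eps_ext_unique[OF p longest_props(1)] longest_props(3) by (simp add: fun_eq_iff)
  assume u: "u \<in> weyl R"
  show "rational R \<Delta> u \<longleftrightarrow> rational R \<Delta> (\<phi> u)"
    unfolding eps_ext_unique[OF p u] rational_cj[OF u] ..
  show "\<phi> (\<phi> u) = u"
    unfolding eps_ext_unique[OF p u] eps_ext_unique[OF p cj_weyl[OF u]] cj_cj ..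
qed

subsection \<open>Weights modulo the root lattice\<close>

definition lattice :: "'a \<Rightarrow> bool" where
  "lattice v \<longleftrightarrow> v \<in> span \<Delta> \<and> (\<forall>a\<in>\<Delta>. cf a v \<in> \<int>)"

lemma lattice_cartan:
  assumes "lattice v" "a \<in> \<Delta>"
  shows "cartan v a \<in> \<int>"
proof -
  have "cartan v a = (\<Sum>c\<in>\<Delta>. cf c v * cartan c a)"
    using assms unfolding lattice_def by (subst cf_expand[of v]) (auto simp: cartan_sum cartan_scale)
  also have "\<dots> \<in> \<int>"
    using assms baseR unfolding lattice_def by (intro Ints_sum Ints_mult cartanR) auto
  finally show ?thesis .
qed

lemma lattice_diff_base:
  "lattice v \<Longrightarrow> k \<in> \<int> \<Longrightarrow> a \<in> \<Delta> \<Longrightarrow> lattice (v - k *\<^sub>R a)"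
  by (auto simp: lattice_def span_diff span_scale base_span cf_diff cf_scale cf_base)

text \<open>Each simple reflection subtracts an integral multiple of a simple root, because the
  correction accumulated so far is a lattice vector and has integral Cartan numbers itself.\<close>

lemma weyl_lattice:
  assumes x: "\<And>a. a \<in> \<Delta> \<Longrightarrow> cartan x a \<in> \<int>" and w: "w \<in> weyl R"
  shows "lattice (w x - x)"
proof -
  have "lattice (word_prod ws x - x)" if "set ws \<subseteq> \<Delta>" for ws
    using that
  proof (induction ws)
    case Nil
    show ?case by (simp add: word_Nil lattice_def span_zero representation_zero)
  next
    case (Cons a ws)
    let ?y = "word_prod ws x - x"
    have a: "a \<in> \<Delta>" and y: "lattice ?y" using Cons by auto
    have "cartan (word_prod ws x) a = cartan ?y a + cartan x a" by (simp add: cartan_diff)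
    then have i: "cartan (word_prod ws x) a \<in> \<int>" using lattice_cartan[OF y a] x[OF a] by simp
    have e: "word_prod (a # ws) x - x = ?y - cartan (word_prod ws x) a *\<^sub>R a"
      by (simp add: word_Cons root_refl_cartan)
    show ?case unfolding e by (rule lattice_diff_base[OF y i a])
  qed
  then show ?thesis using weyl_word[OF w] by blast
qed

text \<open>Since \<open>ep\<close> is \<open>- w0\<close>, it acts as -1 on weights modulo roots;
  the type computations rest on this obstruction.\<close>

lemma lattice_ep_add:
  assumes "\<And>a. a \<in> \<Delta> \<Longrightarrow> cartan x a \<in> \<int>"
  shows "lattice (x + ep x)"
proof -
  have l: "lattice (w0 x - x)" by (rule weyl_lattice[OF assms longest_props(1)])
  have "x + ep x = - (w0 x - x)" by (simp add: ep_eq)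
  with l show ?thesis
    unfolding lattice_def by (metis (no_types, lifting) Ints_minus cf_minus span_neg)
qed

lemma ep_span: "x \<in> span \<Delta> \<Longrightarrow> ep x \<in> span \<Delta>"
  and cf_ep: "x \<in> span \<Delta> \<Longrightarrow> a \<in> \<Delta> \<Longrightarrow> cf a (ep x) = cf (ep a) x"
proof -
  assume x: "x \<in> span \<Delta>"
  have e: "ep x = (\<Sum>c\<in>\<Delta>. cf c x *\<^sub>R ep c)"
    by (subst cf_expand[OF x]) (simp add: linear_sum[OF ep_linear] linear_scale[OF ep_linear])
  show "ep x \<in> span \<Delta>" unfolding e by (intro span_sum span_scale base_span ep_base)
  assume a: "a \<in> \<Delta>"
  have "cf a (ep x) = (\<Sum>c\<in>\<Delta>. cf c x * cf a (ep c))"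
    unfolding e by (simp add: cf_sum cf_scale span_scale base_span ep_base)
  also have "\<dots> = (\<Sum>c\<in>\<Delta>. if c = ep a then cf (ep a) x else 0)"
    by (rule sum.cong) (auto simp: cf_base ep_base ep_ep)
  also have "\<dots> = cf (ep a) x" using ep_base[OF a] finD by simp
  finally show "cf a (ep x) = cf (ep a) x" .
qed

text \<open>The hypothesis on \<open>c\<close> says that \<open>\<Sum>i. c i *\<^sub>R f i\<close> is a weight.\<close>
lemma weight_coords:
  fixes c :: "nat \<Rightarrow> real"
  assumes f: "bij_betw f {1..r} \<Delta>"
    and cart: "\<And>i j. i \<in> {1..r} \<Longrightarrow> j \<in> {1..r} \<Longrightarrow>
       cartan (f i) (f j) = (if i = j then 2 else if adj i j then -1 else 0)"
    and int: "\<And>j. j \<in> {1..r} \<Longrightarrow> 2 * c j - sum c {i \<in> {1..r}. i \<noteq> j \<and> adj i j} \<in> \<int>"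
    and ij: "i \<in> {1..r}" "j \<in> {1..r}" "ep (f i) = f j"
  shows "c i + c j \<in> \<int>"
proof -
  define x where "x = (\<Sum>k\<in>{1..r}. c k *\<^sub>R f k)"
  have inD: "f k \<in> \<Delta>" if "k \<in> {1..r}" for k using f that bij_betwE by blast
  have xs: "x \<in> span \<Delta>" unfolding x_def by (rule span_sum, rule span_scale, rule base_span, rule inD)
  have cx: "cf (f k) x = c k" if k: "k \<in> {1..r}" for k
  proof -
    have "cf (f k) x = (\<Sum>l\<in>{1..r}. cf (f k) (c l *\<^sub>R f l))"
      unfolding x_def by (rule cf_sum, rule span_scale, rule base_span, rule inD)
    also have "\<dots> = (\<Sum>l\<in>{1..r}. c l * cf (f k) (f l))"
      by (rule sum.cong[OF refl], rule cf_scale, rule base_span, rule inD)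
    also have "\<dots> = (\<Sum>l\<in>{1..r}. if l = k then c k else 0)"
    proof (rule sum.cong[OF refl])
      fix l assume l: "l \<in> {1..r}"
      have "f k = f l \<longleftrightarrow> k = l" by (rule inj_on_eq_iff[OF bij_betw_imp_inj_on[OF f] k l])
      then show "c l * cf (f k) (f l) = (if l = k then c k else 0)" using cf_base[OF inD[OF l]] by auto
    qed
    finally show ?thesis using k by simp
  qed
  have "cartan x a \<in> \<int>" if "a \<in> \<Delta>" for a
  proof -
    obtain l where l: "l \<in> {1..r}" "a = f l" using f \<open>a \<in> \<Delta>\<close> by (auto simp: bij_betw_def)
    have "cartan x a = (\<Sum>k\<in>{1..r}. c k * cartan (f k) (f l))"
      unfolding x_def l(2) by (simp add: cartan_sum cartan_scale)
    also have "\<dots> = (\<Sum>k\<in>{1..r}. (if k = l then 2 * c k else 0) - (if k \<noteq> l \<and> adj k l then c k else 0))"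
      using l by (intro sum.cong refl) (auto simp: cart)
    also have "\<dots> = 2 * c l - sum c {k \<in> {1..r}. k \<noteq> l \<and> adj k l}"
      using l by (subst sum.inter_filter) (simp_all add: sum_subtractf)
    finally show ?thesis using int[OF l(1)] by simp
  qed
  then have "lattice (x + ep x)" by (rule lattice_ep_add)
  \<comment> \<open>The coefficient of \<open>ep x\<close> at \<open>f i\<close> is that of
    \<open>x\<close> at \<open>ep (f i) = f j\<close>.\<close>
  moreover have "cf (f i) (x + ep x) = c i + c j"
    using xs ij by (simp add: cf_add ep_span cf_ep inD cx)
  ultimately show ?thesis using inD ij unfolding lattice_def by metis
qed

section \<open>Types in which the automorphism is nontrivial\<close>

lemma type_A_moved:
  assumes t: "has_type \<Delta> r adjA" and r: "r \<ge> 2"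
  shows "\<exists>a\<in>\<Delta>. ep a \<noteq> a"
proof (rule ccontr)
  assume n: "\<not> ?thesis"
  obtain f where f: "bij_betw f {1..r} \<Delta>"
    and cart: "\<And>i j. i \<in> {1..r} \<Longrightarrow> j \<in> {1..r} \<Longrightarrow>
       cartan (f i) (f j) = (if i = j then 2 else if adjA i j then -1 else 0)"
    using t unfolding has_type_def by blast
  \<comment> \<open>The fundamental weight of the last node, in simple roots. If \<open>ep\<close>
    fixed the first node, twice its first coordinate, \<open>2 / (r + 1)\<close>, would be an
    integer.\<close>
  define c where "c i = real i / (real r + 1)" for i :: nat
  have "2 * c j - sum c {i \<in> {1..r}. i \<noteq> j \<and> adjA i j} \<in> \<int>" if j: "j \<in> {1..r}" for j
  proof -
    consider "j = 1" | "1 < j" "j < r" | "j = r" "1 < j" using j r by fastforce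
    then show ?thesis
    proof cases
      case 1
      then have "{i \<in> {1..r}. i \<noteq> j \<and> adjA i j} = {2}" using r by (auto simp: adjA_def)
      then show ?thesis using 1 by (simp add: c_def)
    next
      case 2
      then have "{i \<in> {1..r}. i \<noteq> j \<and> adjA i j} = {j - 1, j + 1}" by (auto simp: adjA_def)
      moreover have "2 * c j - (c (j - 1) + c (j + 1)) = 0"
        using 2 by (simp add: c_def of_nat_diff add_divide_distrib diff_divide_distrib)
      ultimately show ?thesis by simp
    next
      case 3
      then have "{i \<in> {1..r}. i \<noteq> j \<and> adjA i j} = {r - 1}" by (auto simp: adjA_def)
      moreover have "2 * c j - c (r - 1) = (2 * real r - (real r - 1)) / (real r + 1)"
        unfolding diff_divide_distrib using 3 by (simp add: c_def of_nat_diff diff_divide_distrib)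
      moreover have "(2 * real r - (real r - 1)) / (real r + 1) = 1"
        using r by (subst divide_eq_1_iff) linarith
      ultimately show ?thesis by simp
    qed
  qed
  moreover have "ep (f 1) = f 1" using n f r bij_betwE by fastforce
  ultimately have "c 1 + c 1 \<in> \<int>" using weight_coords[OF f cart, of c 1 1] r by simp
  moreover have "c 1 + c 1 > 0" "c 1 + c 1 < 1" using r by (auto simp: c_def field_simps)
  ultimately show False by (auto elim!: Ints_cases)
qed

text \<open>The coordinates are those of a half-spin weight, the fundamental weight of node
  \<open>r\<close>. The condition serves twice: a fixed node \<open>r\<close> needs
  \<open>r / 2\<close> integral, and a swap of the two fork tips needs \<open>(r - 1) / 2\<close>
  integral.\<close>

lemma type_D_weight:
  assumes f: "bij_betw f {1..r} \<Delta>" and r: "r \<ge> 4"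
    and cart: "\<And>i j. i \<in> {1..r} \<Longrightarrow> j \<in> {1..r} \<Longrightarrow>
       cartan (f i) (f j) = (if i = j then 2 else if adjD r i j then -1 else 0)"
    and j: "j \<in> {1..r}" "ep (f r) = f j"
  shows "real r / 4 + (if j = r then real r / 4 else if j = r - 1 then (real r - 2) / 4 else real j / 2) \<in> \<int>"
proof -
  define c where c_def: "c i = (if i = r then real r / 4 else if i = r - 1 then (real r - 2) / 4 else real i / 2)"
    for i :: nat
  have cv: "c r = real r / 4" "c (r - 1) = (real r - 2) / 4" "c (r - 2) = (real r - 2) / 2"
      "c (r - 3) = (real r - 3) / 2"
    using r by (auto simp: c_def of_nat_diff)
  have "2 * c j - sum c {i \<in> {1..r}. i \<noteq> j \<and> adjD r i j} \<in> \<int>" if j: "j \<in> {1..r}" for j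
  proof -
    consider "j = 1" | "1 < j" "j < r - 2" | "j = r - 2" | "j = r - 1" | "j = r" using j r by fastforce
    then show ?thesis
    proof cases
      case 1
      then have "{i \<in> {1..r}. i \<noteq> j \<and> adjD r i j} = {2}"
        using r by (auto simp: adjD_def doubleton_eq_iff)
      moreover have "2 * c j - c 2 = 0" using 1 r by (auto simp: c_def)
      ultimately show ?thesis by simp
    next
      case 2
      then have "{i \<in> {1..r}. i \<noteq> j \<and> adjD r i j} = {j - 1, j + 1}"
        by (auto simp: adjD_def doubleton_eq_iff)
      moreover have "2 * c j - (c (j - 1) + c (j + 1)) = 0"
      proof -
        have "c j = real j / 2" "c (j - 1) = real (j - 1) / 2" "c (j + 1) = real (j + 1) / 2"
          using 2 unfolding c_def by auto
        then show ?thesis using 2 by (simp add: of_nat_diff)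
      qed
      ultimately show ?thesis using 2 by simp
    next
      case 3
      then have "{i \<in> {1..r}. i \<noteq> j \<and> adjD r i j} = {r - 3, r - 1, r}"
        using r by (auto simp: adjD_def doubleton_eq_iff)
      moreover have "sum c {r - 3, r - 1, r} = c (r - 3) + c (r - 1) + c r"
      proof -
        have "r - 3 \<noteq> r - 1" "r - 3 \<noteq> r" "r - 1 \<noteq> r" using r by auto
        then show ?thesis by simp
      qed
      moreover have "2 * c j - (c (r - 3) + c (r - 1) + c r) = 0"
        unfolding 3 cv by (simp add: field_simps)
      ultimately show ?thesis by simp
    next
      case 4
      then have "{i \<in> {1..r}. i \<noteq> j \<and> adjD r i j} = {r - 2}"
        using r by (auto simp: adjD_def doubleton_eq_iff)
      moreover have "2 * c j - c (r - 2) = 0" unfolding 4 cv by (simp add: field_simps)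
      ultimately show ?thesis by simp
    next
      case 5
      then have "{i \<in> {1..r}. i \<noteq> j \<and> adjD r i j} = {r - 2}"
        using r by (auto simp: adjD_def doubleton_eq_iff)
      moreover have "2 * c j - c (r - 2) = 1" unfolding 5 cv by (simp add: field_simps)
      ultimately show ?thesis by simp
    qed
  qed
  then have "c r + c j \<in> \<int>" using weight_coords[OF f cart, of c r j] r j by simp
  then show ?thesis by (simp add: c_def)
qed

lemma type_D_odd_moved:
  assumes t: "has_type \<Delta> r (adjD r)" and r: "r \<ge> 4" "odd r"
  shows "\<exists>a\<in>\<Delta>. ep a \<noteq> a"
proof (rule ccontr)
  assume n: "\<not> ?thesis"
  obtain f where f: "bij_betw f {1..r} \<Delta>"
    and cart: "\<And>i j. i \<in> {1..r} \<Longrightarrow> j \<in> {1..r} \<Longrightarrow>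
       cartan (f i) (f j) = (if i = j then 2 else if adjD r i j then -1 else 0)"
    using t unfolding has_type_def by blast
  have "ep (f r) = f r" using n f r bij_betwE by fastforce
  then have "real r / 4 + real r / 4 \<in> \<int>" using type_D_weight[OF f r(1) cart, of r] r by simp
  then obtain k where "real r / 4 + real r / 4 = of_int k" by (rule Ints_cases)
  then have "real_of_int (int r) = real_of_int (2 * k)" by simp
  then have "int r = 2 * k" by linarith
  with r(2) show False by presburger
qed

lemma type_E6_moved:
  assumes t: "has_type \<Delta> 6 adjE6"
  shows "\<exists>a\<in>\<Delta>. ep a \<noteq> a"
proof (rule ccontr)
  assume n: "\<not> ?thesis"
  obtain f where f: "bij_betw f {1..6} \<Delta>"
    and cart: "\<And>i j. i \<in> {1..6} \<Longrightarrow> j \<in> {1..6} \<Longrightarrow>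
       cartan (f i) (f j) = (if i = j then 2 else if adjE6 i j then -1 else 0)"
    using t unfolding has_type_def by blast
  \<comment> \<open>The fundamental weight of node 1 in Bourbaki numbering, one third of (4, 3, 5,
    6, 4, 2); a fixed node 1 would make 8/3 an integer.\<close>
  define c :: "nat \<Rightarrow> real" where
    "c i = (if i = 1 then 4/3 else if i = 2 then 1 else if i = 3 then 5/3
       else if i = 4 then 2 else if i = 5 then 4/3 else 2/3)" for i
  have set6: "{1..6} = {1::nat,2,3,4,5,6}" by auto
  have nb: "{i \<in> {1..6}. i \<noteq> 1 \<and> adjE6 i 1} = {3}" "{i \<in> {1..6}. i \<noteq> 2 \<and> adjE6 i 2} = {4}"
    "{i \<in> {1..6}. i \<noteq> 3 \<and> adjE6 i 3} = {1,4}" "{i \<in> {1..6}. i \<noteq> 4 \<and> adjE6 i 4} = {2,3,5}"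
    "{i \<in> {1..6}. i \<noteq> 5 \<and> adjE6 i 5} = {4,6}" "{i \<in> {1..6}. i \<noteq> 6 \<and> adjE6 i 6} = {5}"
    unfolding set6 by (auto simp: adjE6_def doubleton_eq_iff)
  have "2 * c j - sum c {i \<in> {1..6}. i \<noteq> j \<and> adjE6 i j} \<in> \<int>" if j: "j \<in> {1..6}" for j
  proof -
    have "2 * c 1 - sum c {3} \<in> \<int>" "2 * c 2 - sum c {4} \<in> \<int>" "2 * c 3 - sum c {1,4} \<in> \<int>"
      "2 * c 4 - sum c {2,3,5} \<in> \<int>" "2 * c 5 - sum c {4,6} \<in> \<int>" "2 * c 6 - sum c {5} \<in> \<int>"
      by (simp_all add: c_def)
    then show ?thesis using j nb unfolding set6 by (elim insertE emptyE) metis+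
  qed
  moreover have "ep (f 1) = f 1" using n f bij_betwE by fastforce
  ultimately have "c 1 + c 1 \<in> \<int>" using weight_coords[OF f cart, of c 1 1] by simp
  then obtain k where "8 / 3 = real_of_int k" by (auto simp: c_def elim: Ints_cases)
  then have "real_of_int 8 = real_of_int (3 * k)" by simp
  then have "8 = 3 * k" by linarith
  then show False by presburger
qed

subsection \<open>Exclusion of subdiagrams\<close>

definition adj :: "'a \<Rightarrow> 'a \<Rightarrow> bool" where
  "adj a b \<longleftrightarrow> a \<in> \<Delta> \<and> b \<in> \<Delta> \<and> a \<noteq> b \<and> a \<bullet> b \<noteq> 0"

text \<open>For distinct simple roots, the number of lines joining the two nodes: four times the
  squared cosine of the angle (\<open>bond_en\<close>).\<close>

definition bond :: "'a \<Rightarrow> 'a \<Rightarrow> real" where "bond a b = cartan a b * cartan b a"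

definition en :: "'a \<Rightarrow> 'a" where "en a = (1 / norm a) *\<^sub>R a"

lemma adj_sym: "adj a b \<longleftrightarrow> adj b a" by (auto simp: adj_def inner_commute)
lemma bond_sym: "bond a b = bond b a" by (simp add: bond_def mult.commute)

lemma en_self: "a \<in> \<Delta> \<Longrightarrow> en a \<bullet> en a = 1"
  using base_nz by (simp add: en_def dot_square_norm power2_eq_square)

lemma en_nonpos: "a \<in> \<Delta> \<Longrightarrow> b \<in> \<Delta> \<Longrightarrow> a \<noteq> b \<Longrightarrow> en a \<bullet> en b \<le> 0"
  using base_inner[of a b] by (simp add: en_def divide_nonpos_nonneg)

lemma bond_en: "bond a b = 4 * (en a \<bullet> en b)\<^sup>2"
  by (simp add: en_def bond_def cartan_def inner_commute[of b a] dot_square_norm power2_eq_square)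

lemma bond_int: "a \<in> \<Delta> \<Longrightarrow> b \<in> \<Delta> \<Longrightarrow> bond a b \<in> \<int>"
  unfolding bond_def using baseR by (intro Ints_mult cartanR) auto

lemma bond_lt4: "a \<in> \<Delta> \<Longrightarrow> b \<in> \<Delta> \<Longrightarrow> a \<noteq> b \<Longrightarrow> bond a b < 4"
proof -
  assume A: "a \<in> \<Delta>" "b \<in> \<Delta>" "a \<noteq> b"
  then have "a \<noteq> - b" using base_pos pos_not_neg[of b] by metis
  then show ?thesis unfolding bond_def using cartan_prod_lt4[of a b] A baseR by blast
qed

lemma adj_bond: "adj a b \<Longrightarrow> bond a b \<ge> 1"
proof -
  assume a: "adj a b"
  then have "en a \<bullet> en b \<noteq> 0" using base_nz by (auto simp: adj_def en_def)
  then have "bond a b > 0" unfolding bond_en by simp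
  moreover have "bond a b \<in> \<int>" using a bond_int by (auto simp: adj_def)
  ultimately show ?thesis by (auto elim!: Ints_cases)
qed

lemma bond_eq1: "adj a b \<Longrightarrow> bond a b < 2 \<Longrightarrow> bond a b = 1"
  using adj_bond[of a b] bond_int[of a b] by (auto simp: adj_def elim!: Ints_cases)

lemma adj_en: "adj a b \<Longrightarrow> en a \<bullet> en b \<le> - 1 / 2"
proof -
  assume a: "adj a b"
  have "4 * (en a \<bullet> en b)\<^sup>2 \<ge> 1" using adj_bond[OF a] unfolding bond_en .
  then have "(1/2)\<^sup>2 \<le> (- (en a \<bullet> en b))\<^sup>2" by (simp add: power2_eq_square)
  moreover have "- (en a \<bullet> en b) \<ge> 0" using en_nonpos a unfolding adj_def by fastforce
  ultimately have "1/2 \<le> - (en a \<bullet> en b)" by (rule power2_le_imp_le)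
  then show ?thesis by simp
qed

lemma bond1_cartan:
  assumes "adj a b" "bond a b = 1"
  shows "cartan a b = -1"
proof -
  have ab: "a \<in> \<Delta>" "b \<in> \<Delta>" "a \<bullet> b < 0" "a \<noteq> 0" "b \<noteq> 0"
    using assms(1) base_inner[of a b] base_nz unfolding adj_def by fastforce+
  obtain m n where mn: "cartan a b = of_int m" "cartan b a = of_int n"
    using cartanR ab baseR by (metis Ints_cases subsetD)
  have "m < 0" using cartan_sign(2)[of b a] ab mn by simp
  moreover have "m * n = 1" using assms(2) unfolding bond_def mn by (metis of_int_1 of_int_eq_iff of_int_mult)
  ultimately have "m = -1" using zmult_eq_1_iff by force
  then show ?thesis using mn by simp
qed

lemma not_adj_cartan: "a \<in> \<Delta> \<Longrightarrow> b \<in> \<Delta> \<Longrightarrow> a \<noteq> b \<Longrightarrow> \<not> adj a b \<Longrightarrow> cartan a b = 0"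
  by (simp add: adj_def cartan_def)

lemma en_span: "a \<in> \<Delta> \<Longrightarrow> en a \<in> span \<Delta>" by (simp add: en_def base_span span_scale)

lemma cf_en: "a \<in> \<Delta> \<Longrightarrow> cf b (en a) = (if b = a then 1 / norm a else 0)"
  by (simp add: en_def cf_scale base_span cf_base)

lemma en_sum_nz:
  assumes S: "finite S" "S \<subseteq> \<Delta>" and b: "b \<in> S" "d b \<noteq> 0"
  shows "(\<Sum>s\<in>S. d s *\<^sub>R en s) \<noteq> 0"
proof
  assume z: "(\<Sum>s\<in>S. d s *\<^sub>R en s) = 0"
  have "cf b (\<Sum>s\<in>S. d s *\<^sub>R en s) = (\<Sum>s\<in>S. cf b (d s *\<^sub>R en s))"
    by (rule cf_sum) (use S in \<open>auto intro!: span_scale en_span\<close>)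
  also have "\<dots> = (\<Sum>s\<in>S. if s = b then d b / norm b else 0)"
    using S by (intro sum.cong refl) (auto simp: cf_scale en_span cf_en)
  also have "\<dots> = d b / norm b" using S b by simp
  finally show False using z b S base_nz by (auto simp: representation_zero)
qed

text \<open>Distinct simple roots have nonpositive products, so with nonnegative coefficients the
  cross terms can only shorten the sum.\<close>

lemma sum_en_norm_le:
  assumes "finite S" "S \<subseteq> \<Delta>" "\<And>s. s \<in> S \<Longrightarrow> d s \<ge> 0"
  shows "(\<Sum>s\<in>S. d s *\<^sub>R en s) \<bullet> (\<Sum>s\<in>S. d s *\<^sub>R en s) \<le> (\<Sum>s\<in>S. (d s)\<^sup>2)"
  using assms
proof (induction S rule: finite_induct)
  case (insert x F)
  let ?v = "\<Sum>s\<in>F. d s *\<^sub>R en s"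
  have "?v \<bullet> en x = (\<Sum>s\<in>F. d s * (en s \<bullet> en x))" unfolding inner_sum_left by simp
  also have "\<dots> \<le> 0"
    using insert by (intro sum_nonpos mult_nonneg_nonpos en_nonpos) auto
  finally have c: "d x * (?v \<bullet> en x) \<le> 0" using insert.prems by (intro mult_nonneg_nonpos) auto
  have "(d x *\<^sub>R en x + ?v) \<bullet> (d x *\<^sub>R en x + ?v)
      = (d x)\<^sup>2 * (en x \<bullet> en x) + 2 * (d x * (?v \<bullet> en x)) + ?v \<bullet> ?v"
    by (simp only: inner_add_left inner_add_right inner_scaleR_left inner_scaleR_right
      inner_commute[of "en x" ?v] power2_eq_square) algebra
  also have "\<dots> \<le> (d x)\<^sup>2 + (\<Sum>s\<in>F. (d s)\<^sup>2)"
    using c insert en_self[of x] by simp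
  finally show ?case using insert.hyps by simp
qed simp

section \<open>Contraction of connected subdiagrams\<close>

text \<open>Connected sets of nodes, built by adding one neighbour at a time; this is the induction
  behind the norm bound \<open>conn_norm\<close>.\<close>

inductive conn :: "'a set \<Rightarrow> bool" where
  single: "a \<in> \<Delta> \<Longrightarrow> conn {a}"
| grow: "conn C \<Longrightarrow> s \<notin> C \<Longrightarrow> c \<in> C \<Longrightarrow> adj s c \<Longrightarrow> conn (insert s C)"

abbreviation "\<sigma> C \<equiv> (\<Sum>a\<in>C. en a)"

lemma conn_sub: "conn C \<Longrightarrow> C \<subseteq> \<Delta>" and conn_ne: "conn C \<Longrightarrow> C \<noteq> {}"
  by (induction rule: conn.induct) (auto simp: adj_def)

lemma conn_fin: "conn C \<Longrightarrow> finite C"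
  using conn_sub finD finite_subset by blast

lemma sigma_le:
  assumes C: "finite C" "C \<subseteq> \<Delta>" and s: "s \<in> \<Delta>" "s \<notin> C" and B: "B \<subseteq> C"
  shows "\<sigma> C \<bullet> en s \<le> (\<Sum>c\<in>B. en c \<bullet> en s)"
proof -
  have fB: "finite B" using C B finite_subset by blast
  have "\<sigma> C \<bullet> en s = (\<Sum>c\<in>C. en c \<bullet> en s)" by (rule inner_sum_left)
  also have "\<dots> = (\<Sum>c\<in>C - B. en c \<bullet> en s) + (\<Sum>c\<in>B. en c \<bullet> en s)"
    by (rule sum.subset_diff[OF B C(1)])
  also have "(\<Sum>c\<in>C - B. en c \<bullet> en s) \<le> 0"
    using C s by (intro sum_nonpos en_nonpos) auto
  finally show ?thesis by simp
qed

text \<open>Adding a neighbour \<open>s\<close> contributes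
  \<open>1 + 2 * (\<sigma> C \<bullet> en s)\<close>, and one adjacent node already brings the
  product down to -1/2.\<close>

lemma conn_norm: "conn C \<Longrightarrow> \<sigma> C \<bullet> \<sigma> C \<le> 1"
proof (induction rule: conn.induct)
  case (single a) then show ?case using en_self by simp
next
  case (grow C s c)
  have s: "s \<in> \<Delta>" using grow adj_def by blast
  have "\<sigma> C \<bullet> en s \<le> (\<Sum>c\<in>{c}. en c \<bullet> en s)"
    using sigma_le[OF conn_fin[OF grow.hyps(1)] conn_sub[OF grow.hyps(1)] s grow.hyps(2), of "{c}"]
      grow.hyps(3) by simp
  also have "\<dots> \<le> - 1 / 2" using adj_en[of c s] grow.hyps(4) adj_sym by simp
  finally have h: "\<sigma> C \<bullet> en s \<le> - 1 / 2" .
  have "\<sigma> (insert s C) = en s + \<sigma> C" using conn_fin grow by simp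
  then have "\<sigma> (insert s C) \<bullet> \<sigma> (insert s C) = en s \<bullet> en s + 2 * (\<sigma> C \<bullet> en s) + \<sigma> C \<bullet> \<sigma> C"
    by (simp only: inner_add_left inner_add_right inner_commute[of "en s" "\<sigma> C"])
  then show ?case using h grow.IH en_self[OF s] by linarith
qed

text \<open>All exclusions of Dynkin diagrams below are instances of this bound:
  contracting a connected subdiagram yields a vector of length at most one, and the vector
  \<open>\<sigma> C - (\<Sum>s\<in>S. (\<sigma> C \<bullet> en s) *\<^sub>R en s)\<close> is nonzero.\<close>
lemma conn_outside:
  assumes C: "conn C" and S: "finite S" "S \<subseteq> \<Delta>" "S \<inter> C = {}"
  shows "(\<Sum>s\<in>S. (\<sigma> C \<bullet> en s)\<^sup>2) < 1"
proof -
  let ?t = "\<lambda>s. \<sigma> C \<bullet> en s"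
  define T where "T = (\<Sum>s\<in>S. (?t s)\<^sup>2)"
  define w where "w = (\<Sum>s\<in>S. (- ?t s) *\<^sub>R en s)"
  note CC = conn_fin[OF C] conn_sub[OF C]
  have neg: "?t s \<le> 0" if "s \<in> S" for s
    using sigma_le[OF CC, of s "{}"] that S by auto
  \<comment> \<open>The members of \<open>S\<close> need not be orthogonal: nonpositive products
    suffice for \<open>w \<bullet> w \<le> T\<close>. With
    \<open>\<sigma> C \<bullet> w = - T\<close> the squared norm of \<open>\<sigma> C + w\<close> is
    at most \<open>1 - T\<close>.\<close>
  have ww: "w \<bullet> w \<le> T" unfolding w_def T_def
    using sum_en_norm_le[OF S(1,2), of "\<lambda>s. - ?t s"] neg by simp
  have cw: "\<sigma> C \<bullet> w = - T"
    unfolding w_def T_def inner_sum_right by (simp add: sum_negf power2_eq_square)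
  obtain b where b: "b \<in> C" using conn_ne[OF C] by blast
  define d where "d s = (if s \<in> C then 1 else - ?t s)" for s
  have "\<sigma> C + w = (\<Sum>s\<in>C \<union> S. d s *\<^sub>R en s)"
    unfolding w_def sum.union_disjoint[OF CC(1) S(1)] 
    using S(3) CC S(1) by (subst sum.union_disjoint) (auto simp: d_def intro!: arg_cong2[where f="(+)"] sum.cong)
  also have "\<dots> \<noteq> 0"
    by (rule en_sum_nz[where b = b]) (use CC S b in \<open>auto simp: d_def\<close>)
  finally have "(\<sigma> C + w) \<bullet> (\<sigma> C + w) > 0" by simp
  moreover have "(\<sigma> C + w) \<bullet> (\<sigma> C + w) = \<sigma> C \<bullet> \<sigma> C + 2 * (\<sigma> C \<bullet> w) + w \<bullet> w"
    by (simp only: inner_add_left inner_add_right inner_commute[of w "\<sigma> C"])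
  ultimately have "0 < 1 + 2 * (- T) + T" using conn_norm[OF C] ww cw by linarith
  then show ?thesis unfolding T_def by simp
qed

text \<open>Contracting \<open>C\<close> to one node extends the bound of three lines at a node: by
  \<open>sigma_le\<close> the contracted vector has at least as negative a product with
  \<open>en s\<close> as the chosen node \<open>c s\<close>.\<close>

lemma conn_bonds:
  assumes C: "conn C" and S: "finite S" "S \<subseteq> \<Delta>" "S \<inter> C = {}" and c: "\<And>s. s \<in> S \<Longrightarrow> c s \<in> C"
  shows "(\<Sum>s\<in>S. bond s (c s)) < 4"
proof -
  note CC = conn_fin[OF C] conn_sub[OF C]
  have "bond s (c s) \<le> 4 * (\<sigma> C \<bullet> en s)\<^sup>2" if s: "s \<in> S" for s
  proof -
    have sD: "s \<in> \<Delta>" "s \<notin> C" "c s \<in> \<Delta>" "c s \<noteq> s" using s S c[OF s] CC by auto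
    have "\<sigma> C \<bullet> en s \<le> (\<Sum>x\<in>{c s}. en x \<bullet> en s)"
      using sigma_le[OF CC sD(1,2)] c[OF s] by blast
    then have "- (en (c s) \<bullet> en s) \<le> - (\<sigma> C \<bullet> en s)" by simp
    moreover have "- (en (c s) \<bullet> en s) \<ge> 0" using en_nonpos[OF sD(3,1,4)] by linarith
    ultimately have "(- (en (c s) \<bullet> en s))\<^sup>2 \<le> (- (\<sigma> C \<bullet> en s))\<^sup>2" by (rule power_mono)
    then have "(en (c s) \<bullet> en s)\<^sup>2 \<le> (\<sigma> C \<bullet> en s)\<^sup>2" by (simp only: power2_minus)
    then show ?thesis unfolding bond_en inner_commute[of "en s" "en (c s)"] by simp
  qed
  then have "(\<Sum>s\<in>S. bond s (c s)) \<le> (\<Sum>s\<in>S. 4 * (\<sigma> C \<bullet> en s)\<^sup>2)" by (rule sum_mono)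
  also have "\<dots> < 4" using conn_outside[OF C S] unfolding sum_distrib_left[symmetric] by simp
  finally show ?thesis .
qed

lemma conn_card:
  assumes C: "conn C" and S: "finite S" "S \<inter> C = {}" and c: "\<And>s. s \<in> S \<Longrightarrow> \<exists>c\<in>C. adj s c"
  shows "card S < 4"
proof -
  have "\<forall>s\<in>S. \<exists>x. x \<in> C \<and> adj s x" using c by blast
  then obtain f where f: "\<forall>s\<in>S. f s \<in> C \<and> adj s (f s)" by (rule bchoice[THEN exE])
  have "S \<subseteq> \<Delta>" using c unfolding adj_def by blast
  then have "(\<Sum>s\<in>S. bond s (f s)) < 4" using conn_bonds[OF C S(1) _ S(2)] f by blast
  moreover have "(\<Sum>s\<in>S. 1) \<le> (\<Sum>s\<in>S. bond s (f s))" by (rule sum_mono) (use f adj_bond in blast)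
  ultimately have "real (card S) < 4" by simp
  then show ?thesis by simp
qed

text \<open>Two neighbours in \<open>C\<close> would push the product with \<open>\<sigma> C\<close>
  to -1 or below, which \<open>conn_outside\<close> forbids. This is how cycles are
  excluded.\<close>

lemma conn_one_neighbour:
  assumes C: "conn C" and s: "s \<notin> C" and c: "c \<in> C" "c' \<in> C" "adj s c" "adj s c'"
  shows "c = c'"
proof (rule ccontr)
  assume ne: "c \<noteq> c'"
  have sD: "s \<in> \<Delta>" using c adj_def by blast
  have "\<sigma> C \<bullet> en s \<le> (\<Sum>x\<in>{c, c'}. en x \<bullet> en s)"
    using sigma_le[OF conn_fin[OF C] conn_sub[OF C] sD s, of "{c, c'}"] c by blast
  also have "\<dots> \<le> - 1"
    using ne adj_en[of c s] adj_en[of c' s] c adj_sym by simp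
  finally have "1 \<le> - (\<sigma> C \<bullet> en s)" by simp
  then have "1\<^sup>2 \<le> (- (\<sigma> C \<bullet> en s))\<^sup>2" by (rule power_mono) simp
  moreover have "(\<Sum>s\<in>{s}. (\<sigma> C \<bullet> en s)\<^sup>2) < 1"
    by (rule conn_outside[OF C]) (use sD s in auto)
  ultimately show False by simp
qed

text \<open>Against a simply laced tree, where edges have product -1/2 and other pairs 0, the actual
  products are at most as large, so the form of the tree bounds the squared norm of a nonzero
  vector. Null vectors of affine trees thus cannot occur.\<close>

lemma tree_form_pos:
  fixes c :: "nat \<Rightarrow> real"
  assumes n: "n \<ge> 1" and F: "inj_on F {1..n}" "F ` {1..n} \<subseteq> \<Delta>"
    and par: "\<And>j. j \<in> {2..n} \<Longrightarrow> p j \<in> {1..<j} \<and> adj (F j) (F (p j))"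
    and c: "\<And>j. j \<in> {1..n} \<Longrightarrow> c j \<ge> 0" and c1: "c 1 > 0"
  shows "(\<Sum>j\<in>{1..n}. (c j)\<^sup>2) > (\<Sum>j\<in>{2..n}. c j * c (p j))"
proof -
  let ?x = "\<lambda>m. \<Sum>j\<in>{1..m}. c j *\<^sub>R en (F j)"
  have bound: "?x m \<bullet> ?x m \<le> (\<Sum>j\<in>{1..m}. (c j)\<^sup>2) - (\<Sum>j\<in>{2..m}. c j * c (p j))"
    if "1 \<le> m" "m \<le> n" for m
    using that
  proof (induction m rule: nat_induct_at_least)
    case base
    have "F 1 \<in> \<Delta>" using F n by auto
    then show ?case using en_self[of "F 1"] by (simp add: power2_eq_square)
  next
    case (Suc m)
    let ?s = "F (Suc m)"
    have sD: "?s \<in> \<Delta>" using F Suc by auto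
    have pj: "p (Suc m) \<in> {1..m}" "adj ?s (F (p (Suc m)))" using par[of "Suc m"] Suc by auto
    have le: "en (F j) \<bullet> en ?s \<le> 0" if "j \<in> {1..m}" for j
    proof (rule en_nonpos[OF _ sD])
      show "F j \<in> \<Delta>" using F that Suc by auto
      show "F j \<noteq> ?s" using inj_onD[OF F(1), of j "Suc m"] that Suc by auto
    qed
    have "?x m \<bullet> en ?s = (\<Sum>j\<in>{1..m}. c j * (en (F j) \<bullet> en ?s))" by (simp add: inner_sum_left)
    also have "\<dots> = c (p (Suc m)) * (en (F (p (Suc m))) \<bullet> en ?s)
        + (\<Sum>j\<in>{1..m} - {p (Suc m)}. c j * (en (F j) \<bullet> en ?s))"
      by (rule sum.remove) (use pj in auto)
    also have "\<dots> \<le> c (p (Suc m)) * (- 1 / 2) + 0"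
    proof (rule add_mono)
      show "c (p (Suc m)) * (en (F (p (Suc m))) \<bullet> en ?s) \<le> c (p (Suc m)) * (- 1 / 2)"
      proof (rule mult_left_mono)
        show "en (F (p (Suc m))) \<bullet> en ?s \<le> - 1 / 2" by (rule adj_en) (use pj adj_sym in blast)
        show "0 \<le> c (p (Suc m))" using c pj Suc by auto
      qed
      show "(\<Sum>j\<in>{1..m} - {p (Suc m)}. c j * (en (F j) \<bullet> en ?s)) \<le> 0"
        by (rule sum_nonpos, rule mult_nonneg_nonpos) (use c le Suc in auto)
    qed
    finally have h: "?x m \<bullet> en ?s \<le> - c (p (Suc m)) / 2" by simp
    have cs: "c (Suc m) \<ge> 0" using c Suc by auto
    have h': "c (Suc m) * (?x m \<bullet> en ?s) \<le> c (Suc m) * (- c (p (Suc m)) / 2)"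
      by (rule mult_left_mono[OF h cs])
    have "?x (Suc m) = ?x m + c (Suc m) *\<^sub>R en ?s" by simp
    then have "?x (Suc m) \<bullet> ?x (Suc m)
        = ?x m \<bullet> ?x m + 2 * (c (Suc m) * (?x m \<bullet> en ?s)) + (c (Suc m))\<^sup>2 * (en ?s \<bullet> en ?s)"
      by (simp only: inner_add_left inner_add_right inner_scaleR_left
        inner_scaleR_right inner_commute[of "en ?s" "?x m"] power2_eq_square) (simp add: algebra_simps)
    also have "\<dots> \<le> (\<Sum>j\<in>{1..m}. (c j)\<^sup>2) - (\<Sum>j\<in>{2..m}. c j * c (p j))
        - c (Suc m) * c (p (Suc m)) + (c (Suc m))\<^sup>2"
      using Suc h' en_self[OF sD] by simp
    finally show ?case using Suc.hyps by simp
  qed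
  have "?x n = (\<Sum>s\<in>F ` {1..n}. (c (the_inv_into {1..n} F s)) *\<^sub>R en s)"
    unfolding sum.reindex[OF F(1)] comp_def by (rule sum.cong[OF refl]) (simp only: the_inv_into_f_f[OF F(1)])
  also have "\<dots> \<noteq> 0"
    by (rule en_sum_nz[where b = "F 1"]) (use F n c1 the_inv_into_f_f[OF F(1), of 1] in auto)
  finally have "?x n \<bullet> ?x n > 0" by simp
  then show ?thesis using bound[of n] n by linarith
qed

subsection \<open>Dynkin diagrams with an involution\<close>

lemma refl_span_orth:
  assumes D: "D \<subseteq> \<Delta>" and a: "a \<in> \<Delta>" and o: "\<And>a b. a \<in> D \<Longrightarrow> b \<in> \<Delta> - D \<Longrightarrow> a \<bullet> b = 0"
    and x: "x \<in> span D"
  shows "root_refl a x \<in> span D"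
proof (cases "a \<in> D")
  case True
  then show ?thesis using x by (simp add: root_refl_def span_diff span_scale span_base)
next
  case False
  have "a \<bullet> x = 0"
    using orthogonal_to_span[OF x, of a] o[of _ a] a False
    by (auto simp: orthogonal_def inner_commute)
  then show ?thesis using x by (simp add: root_refl_def inner_commute)
qed

text \<open>Every positive root comes from a simple one by simple reflections. If no edge left
  \<open>D\<close>, these would preserve both \<open>span D\<close> and
  \<open>span (\<Delta> - D)\<close>, and \<open>R\<close> would split orthogonally.\<close>

lemma base_connected:
  assumes ind: "indecomposable R" and D: "D \<subseteq> \<Delta>" "D \<noteq> {}" "D \<noteq> \<Delta>"
  shows "\<exists>a\<in>D. \<exists>b\<in>\<Delta> - D. adj a b"
proof (rule ccontr)
  assume n: "\<not> ?thesis"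
  have o: "a \<bullet> b = 0" if "a \<in> D" "b \<in> \<Delta> - D" for a b
    using n that D unfolding adj_def by fastforce
  have o': "a \<bullet> b = 0" if "a \<in> \<Delta> - D" "b \<in> \<Delta> - (\<Delta> - D)" for a b
    using o[of b a] that by (auto simp: inner_commute)
  have word: "word_prod ws a \<in> span E" if "set ws \<subseteq> \<Delta>" "a \<in> E" "E \<subseteq> \<Delta>"
    "\<And>a b. a \<in> E \<Longrightarrow> b \<in> \<Delta> - E \<Longrightarrow> a \<bullet> b = 0" for ws a E
    using that(1)
  proof (induction ws)
    case Nil
    show ?case unfolding word_Nil using span_base[OF that(2)] by simp
  next
    case (Cons c ws)
    then have "root_refl c (word_prod ws a) \<in> span E"
      using refl_span_orth[OF that(3) _ that(4), of c] by simp
    then show ?case unfolding word_Cons by simp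
  qed
  let ?R1 = "R \<inter> span D" and ?R2 = "R \<inter> span (\<Delta> - D)"
  have pos: "b \<in> ?R1 \<union> ?R2" if b: "b \<in> P" for b
  proof -
    obtain ws a where w: "set ws \<subseteq> \<Delta>" "a \<in> \<Delta>" "b = word_prod ws a" using pos_simple_word[OF b] by blast
    have "word_prod ws a \<in> span D \<or> word_prod ws a \<in> span (\<Delta> - D)"
    proof (cases "a \<in> D")
      case True then show ?thesis using word[OF w(1) True D(1) o] by blast
    next
      case False
      then have "a \<in> \<Delta> - D" using w by blast
      then show ?thesis using word[OF w(1) _ Diff_subset o'] by blast
    qed
    then show ?thesis using w(3) pos_R[OF b] by blast
  qed
  have "b \<in> ?R1 \<union> ?R2" if b: "b \<in> R" for b
    using root_cases[OF b] pos[of b] pos[of "- b"] span_neg[of "- b"] b by auto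
  then have U: "?R1 \<union> ?R2 = R" by blast
  have "D \<subseteq> ?R1" "\<Delta> - D \<subseteq> ?R2" using D(1) baseR span_superset by blast+
  then have ne: "?R1 \<noteq> {}" "?R2 \<noteq> {}" using D by blast+
  have orth: "a \<bullet> b = 0" if a: "a \<in> ?R1" and b: "b \<in> ?R2" for a b
  proof -
    have "c \<bullet> b = 0" if c: "c \<in> D" for c
      using orthogonal_to_span[of b "\<Delta> - D" c] b o[OF c] by (auto simp: orthogonal_def)
    then show ?thesis
      using orthogonal_to_span[of a D b] a by (auto simp: orthogonal_def inner_commute)
  qed
  have "\<exists>R1 R2. R1 \<noteq> {} \<and> R2 \<noteq> {} \<and> R1 \<union> R2 = R \<and> (\<forall>a\<in>R1. \<forall>b\<in>R2. a \<bullet> b = 0)"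
    by (rule exI[of _ ?R1], rule exI[of _ ?R2], intro conjI ballI ne U orth)
  with ind show False unfolding indecomposable_def by (elim conjE notE)
qed

lemma adj_ep: "adj a b \<Longrightarrow> adj (ep a) (ep b)"
  unfolding adj_def using ep_base ep_ep ep_inner by metis

lemma bond_ep: "bond (ep a) (ep b) = bond a b"
  by (simp add: bond_def cartan_def ep_inner)

lemma ep_in_image: "ep a \<in> diag_aut R \<Delta> ` C \<longleftrightarrow> a \<in> C"
  using ep_ep by (metis image_iff)

lemma conn_ep: "conn C \<Longrightarrow> conn (diag_aut R \<Delta> ` C)"
proof (induction rule: conn.induct)
  case (single a) then show ?case using conn.single ep_base by simp
next
  case (grow C s c)
  have "conn (insert (ep s) (diag_aut R \<Delta> ` C))"
    by (rule conn.grow[OF grow.IH, of _ "ep c"]) (use grow adj_ep ep_in_image in auto)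
  then show ?case by simp
qed

lemma conn_chain:
  fixes f :: "nat \<Rightarrow> 'a"
  assumes "i \<le> j" "inj_on f {i..j}" "f ` {i..j} \<subseteq> \<Delta>" "\<And>k. k \<in> {i..<j} \<Longrightarrow> adj (f k) (f (Suc k))"
  shows "conn (f ` {i..j})"
  using assms
proof (induction j rule: nat_induct_at_least)
  case base then show ?case using conn.single by simp
next
  case (Suc j)
  have e: "{i..Suc j} = insert (Suc j) {i..j}" using Suc.hyps by auto
  have "conn (f ` {i..j})" using Suc.prems by (intro Suc.IH) (auto simp: e)
  moreover have "f (Suc j) \<notin> f ` {i..j}" using Suc.prems(1) unfolding e by (subst (asm) inj_on_insert) auto
  ultimately have "conn (insert (f (Suc j)) (f ` {i..j}))"
    by (rule conn.grow[of _ _ "f j"]) (use Suc adj_sym in auto)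
  then show ?case unfolding e by simp
qed

section \<open>Cartan matrices of simply laced trees\<close>

text \<open>The parent edges make each initial segment connected, so by
  \<open>conn_one_neighbour\<close> a node has no other neighbour before it; the parent function
  fixes the whole Cartan matrix.\<close>

lemma tree_cartan:
  fixes F :: "nat \<Rightarrow> 'a"
  assumes F: "inj_on F {1..r}" "F ` {1..r} \<subseteq> \<Delta>"
    and par: "\<And>j. j \<in> {2..r} \<Longrightarrow> p j \<in> {1..<j} \<and> adj (F j) (F (p j)) \<and> bond (F j) (F (p j)) = 1"
    and ij: "i \<in> {1..r}" "j \<in> {1..r}"
  shows "cartan (F i) (F j) = (if i = j then 2 else if (i < j \<and> p j = i) \<or> (j < i \<and> p i = j) then -1 else 0)"
proof -
  have c: "conn (F ` {1..k})" if "1 \<le> k" "k \<le> r" for k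
    using that
  proof (induction k rule: nat_induct_at_least)
    case base
    then have "F 1 \<in> \<Delta>" using F by auto
    then show ?case using conn.single by simp
  next
    case (Suc k)
    have pk: "p (Suc k) \<in> {1..<Suc k}" "adj (F (Suc k)) (F (p (Suc k)))" using par[of "Suc k"] Suc by auto
    have nin: "F (Suc k) \<notin> F ` {1..k}" using inj_onD[OF F(1), of "Suc k"] Suc by fastforce
    have C: "conn (F ` {1..k})" using Suc by simp
    have "conn (insert (F (Suc k)) (F ` {1..k}))"
      by (rule conn.grow[OF C nin _ pk(2)]) (use pk(1) in auto)
    then show ?case by (simp add: atLeastAtMostSuc_conv)
  qed
  have lt: "cartan (F i) (F j) = (if p j = i then -1 else 0) \<and> cartan (F j) (F i) = (if p j = i then -1 else 0)"
    if "i < j" "i \<in> {1..r}" "j \<in> {1..r}" for i j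
  proof (cases "p j = i")
    case True
    then have "adj (F j) (F i)" "bond (F j) (F i) = 1" using par[of j] that by auto
    then show ?thesis using True bond1_cartan[of "F j" "F i"] bond1_cartan[of "F i" "F j"] adj_sym bond_sym
      by metis
  next
    case False
    have ne: "F i \<noteq> F j" using inj_onD[OF F(1), of i j] that by auto
    have "\<not> adj (F j) (F i)"
    proof
      assume a: "adj (F j) (F i)"
      have C: "conn (F ` {1..j - 1})" using c[of "j - 1"] that by auto
      have nin: "F j \<notin> F ` {1..j - 1}" using inj_onD[OF F(1), of j] that by fastforce
      have pj: "p j \<in> {1..<j}" "adj (F j) (F (p j))" using par[of j] that by auto
      have "F i = F (p j)"
        by (rule conn_one_neighbour[OF C nin _ _ a pj(2)]) (use that pj in auto)
      then show False using inj_onD[OF F(1), of i "p j"] that pj False by auto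
    qed
    then show ?thesis using False ne not_adj_cartan[of "F i" "F j"] not_adj_cartan[of "F j" "F i"]
      adj_sym F that by (auto simp: subset_iff)
  qed
  consider "i = j" | "i < j" | "j < i" by linarith
  then show ?thesis
  proof cases
    case 1
    have "F i \<in> \<Delta>" using F(2) ij(1) by blast
    then show ?thesis using 1 cartan_self[OF base_nz] by simp
  next
    case 2 then show ?thesis using lt[OF 2 ij] by auto
  next
    case 3 then show ?thesis using lt[OF 3 ij(2,1)] by auto
  qed
qed

lemma tree_type:
  fixes F :: "nat \<Rightarrow> 'a"
  assumes F: "inj_on F {1..r}" "F ` {1..r} = \<Delta>"
    and par: "\<And>j. j \<in> {2..r} \<Longrightarrow> p j \<in> {1..<j} \<and> adj (F j) (F (p j)) \<and> bond (F j) (F (p j)) = 1"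
    and pat: "\<And>i j. i \<in> {1..r} \<Longrightarrow> j \<in> {1..r} \<Longrightarrow> i \<noteq> j \<Longrightarrow>
       pat i j \<longleftrightarrow> (i < j \<and> p j = i) \<or> (j < i \<and> p i = j)"
  shows "has_type \<Delta> r pat"
  unfolding has_type_def
proof (intro exI[of _ F] conjI ballI)
  show "bij_betw F {1..r} \<Delta>" using F by (simp add: bij_betw_def)
  fix i j assume ij: "i \<in> {1..r}" "j \<in> {1..r}"
  show "cartan (F i) (F j) = (if i = j then 2 else if pat i j then - 1 else 0)"
    using tree_cartan[OF F(1) equalityD1[OF F(2)] par ij] pat[OF ij] by auto
qed

section \<open>Paths reversed by the automorphism\<close>

definition symch :: "nat \<Rightarrow> (nat \<Rightarrow> 'a) \<Rightarrow> bool" where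
  "symch m f \<longleftrightarrow> 2 \<le> m \<and> inj_on f {1..m} \<and> f ` {1..m} \<subseteq> \<Delta> \<and>
     (\<forall>k\<in>{1..<m}. adj (f k) (f (Suc k)) \<and> bond (f k) (f (Suc k)) = 1) \<and>
     (\<forall>k\<in>{1..m}. ep (f k) = f (m + 1 - k))"

text \<open>A largest connected \<open>C\<close> disjoint from its image covers
  \<open>\<Delta>\<close> together with that image, and some edge joins \<open>x\<close> in
  \<open>C\<close> to some \<open>ep c\<close>. If \<open>c\<close> differs from \<open>x\<close>,
  the mirrored edge from \<open>c\<close> to \<open>ep x\<close> closes a cycle, which the
  contracted norms rule out.\<close>

lemma flipped_edge:
  assumes ind: "indecomposable R" and nf: "\<And>a. a \<in> \<Delta> \<Longrightarrow> ep a \<noteq> a" and ne: "\<Delta> \<noteq> {}"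
  shows "\<exists>a. adj a (ep a)"
proof -
  let ?e = "diag_aut R \<Delta>"
  let ?Q = "\<lambda>C. conn C \<and> C \<inter> ?e ` C = {}"
  obtain a where a: "a \<in> \<Delta>" using ne by blast
  have "?Q {a}" using conn.single[OF a] nf[OF a] by auto
  moreover have "\<forall>C. ?Q C \<longrightarrow> card C < Suc (card \<Delta>)"
    using conn_sub card_mono[OF finD] by (simp add: le_imp_less_Suc)
  ultimately obtain C where C: "?Q C" "\<And>C'. ?Q C' \<Longrightarrow> card C' \<le> card C"
    using ex_has_greatest_nat[of ?Q "{a}" card "Suc (card \<Delta>)"] by blast
  note CC = conn_fin[of C] conn_sub[of C] conn_ne[of C]
  have noext: False if b: "b \<in> \<Delta>" "b \<notin> C" "b \<notin> ?e ` C" and c: "c \<in> C" "adj b c" for b c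
  proof -
    have "conn (insert b C)" using conn.grow C b c by blast
    moreover have "ep b \<notin> C" using b(3) ep_ep by (metis imageI)
    then have "insert b C \<inter> ?e ` insert b C = {}"
      using C(1) b nf[OF b(1)] by auto
    ultimately have "card (insert b C) \<le> card C" using C(2) by blast
    then show False using CC C b by simp
  qed
  have full: "C \<union> ?e ` C = \<Delta>"
  proof (rule ccontr)
    assume n: "C \<union> ?e ` C \<noteq> \<Delta>"
    have "C \<union> ?e ` C \<subseteq> \<Delta>" using CC C ep_base by blast
    then obtain x b where x: "x \<in> C \<union> ?e ` C" "b \<in> \<Delta> - (C \<union> ?e ` C)" "adj x b"
      using base_connected[OF ind, of "C \<union> ?e ` C"] n CC C by blast
    from x(1) show False
    proof
      assume "x \<in> C"
      then show False using noext[of b x] x adj_sym by blast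
    next
      assume "x \<in> ?e ` C"
      then obtain y where y: "y \<in> C" "x = ep y" by blast
      have "adj (ep b) y" using adj_ep[OF x(3)] y ep_ep adj_sym by metis
      moreover have "ep b \<in> \<Delta>" using ep_base x by blast
      moreover have "ep b \<notin> C" "ep b \<notin> ?e ` C" using x ep_in_image ep_ep by (metis DiffD2 UnCI imageI)+
      ultimately show False using noext y by blast
    qed
  qed
  have "C \<noteq> \<Delta>" using C(1) CC ep_base by fastforce
  then obtain x b where x: "x \<in> C" "b \<in> \<Delta> - C" "adj x b"
    using base_connected[OF ind, of C] CC C by blast
  then obtain c where c: "c \<in> C" "b = ep c" using full by blast
  show ?thesis
  proof (cases "c = x")
    case True then show ?thesis using x c by blast
  next
    case False
    let ?D = "?e ` C"
    have D: "conn ?D" using conn_ep C by blast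
    note DD = conn_fin[OF D] conn_sub[OF D]
    have le: "\<sigma> ?D \<bullet> en z \<le> 0" if "z \<in> C" for z
      using sigma_le[OF DD, of z "{}"] that C CC by auto
    have le2: "\<sigma> ?D \<bullet> en z \<le> - 1 / 2" if "z \<in> C" "d \<in> ?D" "adj d z" for z d
    proof -
      have "\<sigma> ?D \<bullet> en z \<le> (\<Sum>d\<in>{d}. en d \<bullet> en z)"
        using sigma_le[OF DD, of z "{d}"] that C CC by blast
      then show ?thesis using adj_en[OF that(3)] by simp
    qed
    have ax: "adj (ep c) x" using x c adj_sym by blast
    then have ac: "adj (ep x) c" using adj_ep[of "ep c" x] ep_ep adj_sym by metis
    \<comment> \<open>Each of the two crossing edges contributes at most -1/2, so the contracted
      vectors, of norm at most 1, have product at most -1 and would have to sum to zero.\<close>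
    have "\<sigma> ?D \<bullet> \<sigma> C = (\<Sum>z\<in>C. \<sigma> ?D \<bullet> en z)" by (rule inner_sum_right)
    also have "\<dots> = (\<Sum>z\<in>C - {x, c}. \<sigma> ?D \<bullet> en z) + (\<Sum>z\<in>{x, c}. \<sigma> ?D \<bullet> en z)"
      by (rule sum.subset_diff) (use x c CC C in auto)
    also have "(\<Sum>z\<in>C - {x, c}. \<sigma> ?D \<bullet> en z) \<le> 0" by (rule sum_nonpos) (use le in auto)
    also have "(\<Sum>z\<in>{x, c}. \<sigma> ?D \<bullet> en z) = \<sigma> ?D \<bullet> en x + \<sigma> ?D \<bullet> en c" using False by simp
    finally have "\<sigma> ?D \<bullet> \<sigma> C \<le> -1" using le2[OF x(1) _ ax] le2[OF c(1) _ ac] x c by simp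
    moreover have "(\<sigma> C + \<sigma> ?D) \<bullet> (\<sigma> C + \<sigma> ?D) = \<sigma> C \<bullet> \<sigma> C + 2 * (\<sigma> ?D \<bullet> \<sigma> C) + \<sigma> ?D \<bullet> \<sigma> ?D"
      by (simp only: inner_add_left inner_add_right inner_commute[of "\<sigma> C" "\<sigma> ?D"])
    ultimately have "(\<sigma> C + \<sigma> ?D) \<bullet> (\<sigma> C + \<sigma> ?D) \<le> 0"
      using conn_norm[OF D] conn_norm C(1) by fastforce
    then have "\<sigma> C + \<sigma> ?D = 0" by (metis inner_eq_zero_iff inner_ge_zero order_antisym)
    moreover have "\<sigma> C + \<sigma> ?D = (\<Sum>s\<in>C \<union> ?D. 1 *\<^sub>R en s)"
      using sum.union_disjoint[of C ?D en] C CC DD by simp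
    moreover have "(\<Sum>s\<in>C \<union> ?D. 1 *\<^sub>R en s) \<noteq> 0"
      by (rule en_sum_nz[where b = x]) (use full x finD in auto)
    ultimately show ?thesis by simp
  qed
qed

text \<open>Seeds of length 2 or 3. Without fixed simple roots a flipped edge serves; it is single
  because its ends have equal length and hence equal Cartan numbers. Otherwise a fixed node with a
  moved neighbour serves; the two mirrored bonds are equal with sum below 4, hence single.\<close>

lemma symch_start:
  assumes ind: "indecomposable R" and mv: "\<exists>a\<in>\<Delta>. ep a \<noteq> a"
  shows "\<exists>m f. symch m f"
proof (cases "\<exists>a\<in>\<Delta>. ep a = a")
  case False
  then obtain a where a: "adj a (ep a)" using flipped_edge[OF ind] mv by blast
  then have D: "a \<in> \<Delta>" "ep a \<in> \<Delta>" "a \<noteq> ep a" by (auto simp: adj_def)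
  obtain k where k: "cartan a (ep a) = of_int k" using cartanR D baseR by (metis Ints_cases subsetD)
  have k': "cartan (ep a) a = of_int k"
    using k ep_inner[of a "ep a"] ep_inner[of a a] ep_ep by (simp add: cartan_def inner_commute)
  have "bond a (ep a) < 4" using bond_lt4 D by blast
  then have "k * k < 4" unfolding bond_def k k' by (metis of_int_less_numeral_iff of_int_mult)
  moreover have "k \<noteq> 0" using adj_bond[OF a] unfolding bond_def k k' by auto
  moreover have "\<not> \<bar>k\<bar> \<ge> 2"
  proof
    assume "\<bar>k\<bar> \<ge> 2"
    then have "2 * 2 \<le> \<bar>k\<bar> * \<bar>k\<bar>" by (intro mult_mono) auto
    with \<open>k * k < 4\<close> show False by (simp add: abs_mult_self_eq)
  qed
  ultimately have "k = 1 \<or> k = -1" by linarith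
  then have b: "bond a (ep a) = 1" unfolding bond_def k k' by auto
  define f where "f k = (if k = 1 then a else ep a)" for k :: nat
  have "{1..2} = {1, 2::nat}" "{1..<2} = {1::nat}" by auto
  then have "symch 2 f" unfolding symch_def using a b D ep_ep
    by (simp add: f_def)
  then show ?thesis by blast
next
  case True
  let ?D = "{a \<in> \<Delta>. ep a = a}"
  obtain a b where ab: "a \<in> ?D" "b \<in> \<Delta> - ?D" "adj a b"
    using base_connected[OF ind, of ?D] True mv by blast
  then have D: "a \<in> \<Delta>" "ep a = a" "b \<in> \<Delta>" "ep b \<noteq> b" by auto
  have ab': "adj b a" "adj (ep b) a" using ab adj_sym adj_ep[of b a] D by metis+
  have ne: "b \<noteq> a" "ep b \<noteq> a" using D ep_ep by metis+
  have "(\<Sum>s\<in>{b, ep b}. bond s a) < 4"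
    by (rule conn_bonds[OF conn.single[OF D(1)], of _ "\<lambda>_. a"]) (use D ne ep_base in auto)
  moreover have "bond (ep b) a = bond b a" using bond_ep[of b a] D by simp
  ultimately have "bond b a < 2" using D(4) by simp
  then have b1: "bond b a = 1" using bond_eq1 ab' by blast
  define f where "f k = (if k = 1 then b else if k = 2 then a else ep b)" for k :: nat
  have "{1..3} = {1, 2, 3::nat}" "{1..<3} = {1, 2::nat}" by auto
  moreover have "adj a (ep b)" "bond a (ep b) = 1"
    using ab' adj_sym bond_sym b1 bond_ep[of b a] D by metis+
  ultimately have "symch 3 f" unfolding symch_def using ab' b1 D ne ep_ep[of b] ep_base
    by (simp add: f_def)
  then show ?thesis by blast
qed

lemma symchD:
  assumes "symch m f"
  shows "2 \<le> m" "inj_on f {1..m}" "f ` {1..m} \<subseteq> \<Delta>"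
    "\<And>k. 1 \<le> k \<Longrightarrow> k < m \<Longrightarrow> adj (f k) (f (Suc k))"
    "\<And>k. 1 \<le> k \<Longrightarrow> k < m \<Longrightarrow> bond (f k) (f (Suc k)) = 1"
    "\<And>k. 1 \<le> k \<Longrightarrow> k \<le> m \<Longrightarrow> ep (f k) = f (m + 1 - k)"
    "\<And>k. 1 \<le> k \<Longrightarrow> k \<le> m \<Longrightarrow> f k \<in> \<Delta>"
    "\<And>k l. 1 \<le> k \<Longrightarrow> k \<le> m \<Longrightarrow> 1 \<le> l \<Longrightarrow> l \<le> m \<Longrightarrow> f k = f l \<longleftrightarrow> k = l"
    "\<And>i j. 1 \<le> i \<Longrightarrow> i \<le> j \<Longrightarrow> j \<le> m \<Longrightarrow> conn (f ` {i..j})"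
proof -
  show s: "2 \<le> m" "inj_on f {1..m}" "f ` {1..m} \<subseteq> \<Delta>"
    "\<And>k. 1 \<le> k \<Longrightarrow> k < m \<Longrightarrow> adj (f k) (f (Suc k))"
    "\<And>k. 1 \<le> k \<Longrightarrow> k < m \<Longrightarrow> bond (f k) (f (Suc k)) = 1"
    "\<And>k. 1 \<le> k \<Longrightarrow> k \<le> m \<Longrightarrow> ep (f k) = f (m + 1 - k)"
    using assms unfolding symch_def by auto
  show "\<And>k. 1 \<le> k \<Longrightarrow> k \<le> m \<Longrightarrow> f k \<in> \<Delta>" using s(3) by auto
  show "\<And>k l. 1 \<le> k \<Longrightarrow> k \<le> m \<Longrightarrow> 1 \<le> l \<Longrightarrow> l \<le> m \<Longrightarrow> f k = f l \<longleftrightarrow> k = l"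
    using s(2) by (auto dest: inj_onD)
  fix i j :: nat assume ij: "1 \<le> i" "i \<le> j" "j \<le> m"
  show "conn (f ` {i..j})"
  proof (rule conn_chain[OF ij(2)])
    show "inj_on f {i..j}" by (rule inj_on_subset[OF s(2)]) (use ij in auto)
    show "f ` {i..j} \<subseteq> \<Delta>" using s(3) ij by fastforce
    show "\<And>k. k \<in> {i..<j} \<Longrightarrow> adj (f k) (f (Suc k))" using s(4) ij by auto
  qed
qed

lemma symch_maximal:
  assumes "symch m0 f0"
  shows "\<exists>m f. symch m f \<and> (\<forall>m' f'. symch m' f' \<longrightarrow> m' \<le> m)"
proof -
  have "m \<le> card \<Delta>" if s: "symch m f" for m f
    using card_image[OF symchD(2)[OF s]] card_mono[OF finD symchD(3)[OF s]] by simp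
  then have "\<forall>m. (\<exists>f. symch m f) \<longrightarrow> m \<le> card \<Delta>" by blast
  then obtain m where "\<exists>f. symch m f" "\<forall>m'. (\<exists>f. symch m' f) \<longrightarrow> m' \<le> m"
    using Nat.ex_has_greatest_nat[of "\<lambda>m. \<exists>f. symch m f" m0 "card \<Delta>"] assms by auto
  then show ?thesis by blast
qed

lemma card4: "a \<noteq> b \<Longrightarrow> a \<noteq> c \<Longrightarrow> a \<noteq> d \<Longrightarrow> b \<noteq> c \<Longrightarrow> b \<noteq> d \<Longrightarrow> c \<noteq> d \<Longrightarrow> card {a, b, c, d} = 4"
  by simp

text \<open>An outside neighbour moved by \<open>ep\<close> would either prolong the path at both
  ends, or hang on an interior node, and then the contracted interior would have four neighbours. A
  fixed one is adjacent to \<open>f i\<close> and to its mirror node, so these coincide.\<close>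

lemma symch_attach:
  assumes S: "symch m f" and mx: "\<forall>m' f'. symch m' f' \<longrightarrow> m' \<le> m"
    and s: "s \<in> \<Delta>" "s \<notin> f ` {1..m}" and i: "1 \<le> i" "i \<le> m" and a: "adj s (f i)"
  shows "2 * i = m + 1 \<and> ep s = s \<and> bond s (f i) = 1"
proof -
  note D = symchD[OF S]
  let ?C = "f ` {1..m}"
  have C: "conn ?C" using D(9)[of 1 m] D(1) by simp
  have stab: "ep t \<notin> ?C" if "t \<notin> ?C" for t
  proof
    assume "ep t \<in> ?C"
    then obtain k where k: "1 \<le> k" "k \<le> m" "ep t = f k" by auto
    then have "t = f (m + 1 - k)" using D(6)[OF k(1,2)] ep_ep by metis
    moreover have "m + 1 - k \<in> {1..m}" using k by auto
    ultimately show False using that by blast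
  qed
  have ns: "f k \<noteq> t" if "1 \<le> k" "k \<le> m" "t \<notin> ?C" for k t
    using that by auto
  have a': "adj (ep t) (f (m + 1 - k))" if "adj t (f k)" "1 \<le> k" "k \<le> m" for t k
    using adj_ep[OF that(1)] D(6)[OF that(2,3)] by simp
  show ?thesis
  proof (cases "ep s = s")
    case True
    have in': "f (m + 1 - i) \<in> ?C" by (rule imageI) (use i in auto)
    have feq: "f i = f (m + 1 - i)"
      by (rule conn_one_neighbour[OF C s(2) _ in' a]) (use a'[OF a i] True i in auto)
    have "1 \<le> m + 1 - i" "m + 1 - i \<le> m" using i by auto
    then have "i = m + 1 - i" using D(8)[OF i] feq by blast
    then have e: "2 * i = m + 1" using i by arith
    then have i2: "2 \<le> i" "i < m" using i D(1) by auto
    let ?S = "{f (i - 1), f (i + 1), s}"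
    have "(\<Sum>t\<in>?S. bond t (f i)) < 4"
    proof (rule conn_bonds[OF conn.single[OF D(7)[OF i]]])
      show "?S \<subseteq> \<Delta>" using D(7) i2 s by auto
      show "?S \<inter> {f i} = {}" using D(8)[of "i - 1" i] D(8)[of "i + 1" i] i2 s(2) by auto
    qed auto
    moreover have "f (i - 1) \<noteq> f (i + 1)" "f (i - 1) \<noteq> s" "f (i + 1) \<noteq> s"
      using D(8)[of "i - 1" "i + 1"] ns[OF _ _ s(2), of "i - 1"] ns[OF _ _ s(2), of "i + 1"] i2 by auto
    moreover have "bond (f (i - 1)) (f i) = 1" using D(5)[of "i - 1"] i2 by simp
    moreover have "bond (f (i + 1)) (f i) = 1" using D(5)[of i] i2 bond_sym by simp
    ultimately have "bond s (f i) < 2" by simp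
    then show ?thesis using bond_eq1[OF a] e True by blast
  next
    case mv: False
    have tip: False if t: "t \<in> \<Delta>" "t \<notin> ?C" "ep t \<noteq> t" "adj t (f 1)" for t
    proof -
      have tm: "adj (ep t) (f m)" using a'[OF t(4)] D(1) by simp
      let ?c = "\<lambda>x. if x = t then f 1 else f m"
      have "(\<Sum>x\<in>{t, ep t}. bond x (?c x)) < 4"
        by (rule conn_bonds[OF C]) (use t stab[OF t(2)] ep_base D(1) in auto)
      moreover have "bond (ep t) (f m) = bond t (f 1)" using bond_ep[of t "f 1"] D(6)[of 1] D(1) by simp
      ultimately have "bond t (f 1) < 2" using t(3) by simp
      then have b1: "bond t (f 1) = 1" using bond_eq1 t by blast
      then have bm: "bond (f m) (ep t) = 1" using \<open>bond (ep t) (f m) = bond t (f 1)\<close> bond_sym by metis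
      define g where "g k = (if k = 1 then t else if k = m + 2 then ep t else f (k - 1))" for k
      have set: "{1..m + 2} = insert 1 (insert (m + 2) (Suc ` {1..m}))"
        unfolding image_Suc_atLeastAtMost by auto
      have gS: "g (Suc k) = f k" if "k \<in> {1..m}" for k using that by (auto simp: g_def)
      have g1: "g 1 = t" "g (m + 2) = ep t" by (auto simp: g_def)
      have img: "g ` Suc ` {1..m} = ?C" unfolding image_image by (rule image_cong[OF refl gS])
      have "symch (m + 2) g"
        unfolding symch_def
      proof (intro conjI ballI)
        have "inj_on (g \<circ> Suc) {1..m} = inj_on f {1..m}"
          by (rule inj_on_cong) (use gS in simp)
        with D(2) have "inj_on g (Suc ` {1..m})" by (intro inj_on_imageI) simp
        then show "inj_on g {1..m + 2}"
          unfolding set inj_on_insert using img g1 t stab[OF t(2)] by auto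
        show "g ` {1..m + 2} \<subseteq> \<Delta>"
          unfolding set image_insert img g1 using t ep_base D(3) by auto
        fix k assume k: "k \<in> {1..<m + 2}"
        consider "k = 1" | "k = m + 1" | "2 \<le> k" "k \<le> m" using k by fastforce
        then have "adj (g k) (g (Suc k)) \<and> bond (g k) (g (Suc k)) = 1"
        proof cases
          case 1
          then show ?thesis using t(4) b1 gS[of 1] g1 D(1) by simp
        next
          case 2
          then show ?thesis using tm adj_sym bm gS[of m] g1 D(1) by auto
        next
          case 3
          then have "g k = f (k - 1)" "g (Suc k) = f (Suc (k - 1))" by (auto simp: g_def)
          then show ?thesis using D(4,5)[of "k - 1"] 3 by simp
        qed
        then show "adj (g k) (g (Suc k))" "bond (g k) (g (Suc k)) = 1" by auto
      next
        fix k assume k: "k \<in> {1..m + 2}"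
        consider "k = 1" | "k = m + 2" | "2 \<le> k" "k \<le> m + 1" using k by fastforce
        then show "ep (g k) = g (m + 2 + 1 - k)"
        proof cases
          case 1 then show ?thesis using g1 by simp
        next
          case 2 then show ?thesis using g1 ep_ep by simp
        next
          case 3
          then have "g k = f (k - 1)" "g (m + 2 + 1 - k) = f (m + 1 - (k - 1))"
            by (auto simp: g_def Suc_diff_le)
          then show ?thesis using D(6)[of "k - 1"] 3 by simp
        qed
      qed (use D(1) in simp)
      then have "m + 2 \<le> m" using mx by blast
      then show False by simp
    qed
    have es: "ep s \<in> \<Delta>" "ep s \<notin> ?C" "ep (ep s) \<noteq> ep s" using s stab ep_base ep_ep mv by metis+
    consider "i = 1" | "i = m" | "1 < i" "i < m" using i by fastforce
    then show ?thesis
    proof cases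
      case 1
      then show ?thesis using tip[OF s mv] a by blast
    next
      case 2
      then show ?thesis using tip[OF es] a'[OF a i] by simp
    next
      case 3
      have C': "conn (f ` {2..m - 1})" using D(9)[of 2 "m - 1"] 3 by simp
      have dist: "f 1 \<noteq> f m" "f 1 \<noteq> s" "f 1 \<noteq> ep s" "f m \<noteq> s" "f m \<noteq> ep s" "s \<noteq> ep s"
        using D(8)[of 1 m] 3 ns[OF _ _ s(2)] ns[OF _ _ es(2)] mv by auto
      have "card {f 1, f m, s, ep s} < 4"
      proof (rule conn_card[OF C'])
        show "{f 1, f m, s, ep s} \<inter> f ` {2..m - 1} = {}"
          using s(2) es(2) D(8) 3 by auto
        fix x assume "x \<in> {f 1, f m, s, ep s}"
        moreover have "adj (f 1) (f 2)" using D(4)[of 1] 3 by (simp add: numeral_2_eq_2)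
        moreover have "adj (f m) (f (m - 1))" using D(4)[of "m - 1"] 3 adj_sym by simp
        ultimately show "\<exists>c\<in>f ` {2..m - 1}. adj x c"
          using a a'[OF a i] 3 by fastforce
      qed simp
      then show ?thesis using card4[OF dist] by simp
    qed
  qed
qed

section \<open>The arm of fixed nodes\<close>

text \<open>\<open>g 0\<close> is the middle node of the reversed path and is shared with it, so
  \<open>q\<close> counts the new nodes.\<close>

definition arm :: "nat \<Rightarrow> (nat \<Rightarrow> 'a) \<Rightarrow> nat \<Rightarrow> (nat \<Rightarrow> 'a) \<Rightarrow> bool" where
  "arm p f q g \<longleftrightarrow> g 0 = f (p + 1) \<and> inj_on g {0..q} \<and> g ` {0..q} \<subseteq> \<Delta> \<and>
     g ` {1..q} \<inter> f ` {1..2 * p + 1} = {} \<and>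
     (\<forall>k<q. adj (g k) (g (Suc k)) \<and> bond (g k) (g (Suc k)) = 1) \<and> (\<forall>k\<le>q. ep (g k) = g k)"

lemma armD:
  assumes "arm p f q g"
  shows "g 0 = f (p + 1)" "inj_on g {0..q}" "g ` {0..q} \<subseteq> \<Delta>" "g ` {1..q} \<inter> f ` {1..2 * p + 1} = {}"
    "\<And>k. k < q \<Longrightarrow> adj (g k) (g (Suc k))" "\<And>k. k < q \<Longrightarrow> bond (g k) (g (Suc k)) = 1"
    "\<And>k. k \<le> q \<Longrightarrow> ep (g k) = g k"
    "\<And>k. k \<le> q \<Longrightarrow> g k \<in> \<Delta>"
    "\<And>k l. k \<le> q \<Longrightarrow> l \<le> q \<Longrightarrow> g k = g l \<longleftrightarrow> k = l"
    "\<And>k l. 1 \<le> k \<Longrightarrow> k \<le> q \<Longrightarrow> 1 \<le> l \<Longrightarrow> l \<le> 2 * p + 1 \<Longrightarrow> g k \<noteq> f l"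
    "\<And>j. j \<le> q \<Longrightarrow> conn (g ` {0..j})"
proof -
  show s: "g 0 = f (p + 1)" "inj_on g {0..q}" "g ` {0..q} \<subseteq> \<Delta>" "g ` {1..q} \<inter> f ` {1..2 * p + 1} = {}"
    "\<And>k. k < q \<Longrightarrow> adj (g k) (g (Suc k))" "\<And>k. k < q \<Longrightarrow> bond (g k) (g (Suc k)) = 1"
    "\<And>k. k \<le> q \<Longrightarrow> ep (g k) = g k"
    using assms unfolding arm_def by auto
  show "\<And>k. k \<le> q \<Longrightarrow> g k \<in> \<Delta>" using s(3) by auto
  show "\<And>k l. k \<le> q \<Longrightarrow> l \<le> q \<Longrightarrow> g k = g l \<longleftrightarrow> k = l"
    using s(2) by (auto dest: inj_onD)
  show "g k \<noteq> f l" if "1 \<le> k" "k \<le> q" "1 \<le> l" "l \<le> 2 * p + 1" for k l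
  proof
    assume e: "g k = f l"
    have "g k \<in> g ` {1..q}" by (rule imageI) (use that in auto)
    moreover have "g k \<in> f ` {1..2 * p + 1}" unfolding e by (rule imageI) (use that in auto)
    ultimately show False using s(4) by blast
  qed
  fix j assume j: "j \<le> q"
  show "conn (g ` {0..j})"
  proof (rule conn_chain)
    show "inj_on g {0..j}" by (rule inj_on_subset[OF s(2)]) (use j in auto)
    show "g ` {0..j} \<subseteq> \<Delta>" using s(3) j by fastforce
    show "\<And>k. k \<in> {0..<j} \<Longrightarrow> adj (g k) (g (Suc k))" using s(5) j by auto
  qed simp
qed

lemma mid_facts:
  assumes S: "symch (2 * p + 1) f"
  shows "p \<ge> 1" "adj (f p) (f (p + 1))" "adj (f (p + 2)) (f (p + 1))" "f p \<noteq> f (p + 2)"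
    "bond (f p) (f (p + 1)) = 1" "bond (f (p + 2)) (f (p + 1)) = 1"
proof -
  note D = symchD[OF S]
  show p: "p \<ge> 1" using D(1) by simp
  show "adj (f p) (f (p + 1))" "bond (f p) (f (p + 1)) = 1" using D(4,5)[of p] p by simp_all
  show "adj (f (p + 2)) (f (p + 1))" "bond (f (p + 2)) (f (p + 1)) = 1"
    using D(4,5)[of "p + 1"] p adj_sym bond_sym by simp_all
  show "f p \<noteq> f (p + 2)" using D(8)[of p "p + 2"] p by simp
qed

text \<open>Every initial segment of the arm already has the outside neighbours \<open>f p\<close>
  and \<open>f (p + 2)\<close>, and \<open>conn_card\<close> leaves room for one more. This forces
  the new node to the tip and makes it fixed by \<open>ep\<close>; the same count with
  multiplicities makes its bond single.\<close>

lemma arm_extend: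
  assumes S: "symch (2 * p + 1) f" and mx: "\<forall>m' f'. symch m' f' \<longrightarrow> m' \<le> 2 * p + 1"
    and A: "arm p f q g" and q: "q \<ge> 1"
    and t: "t \<notin> f ` {1..2 * p + 1}" "t \<notin> g ` {1..q}"
    and c: "c \<in> f ` {1..2 * p + 1} \<union> g ` {1..q}" "adj t c"
  shows "\<exists>g'. arm p f (Suc q) g'"
proof -
  note D = symchD[OF S] and M = mid_facts[OF S] and G = armD[OF A]
  have tD: "t \<in> \<Delta>" using c adj_def by blast
  have tf: "f k \<noteq> t" if "1 \<le> k" "k \<le> 2 * p + 1" for k using t(1) that by auto
  have t0: "t \<notin> g ` {0..q}"
  proof
    assume "t \<in> g ` {0..q}"
    then obtain k where "t = g k" "k \<le> q" by auto
    then show False using t(2) tf[of "p + 1"] G(1) by (cases k) auto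
  qed
  have tg: "g k \<noteq> t" if "k \<le> q" for k using t0 that by auto
  have fg: "f k \<notin> g ` {0..q}" if "k = p \<or> k = p + 2" for k
  proof
    assume "f k \<in> g ` {0..q}"
    then obtain l where l: "f k = g l" "l \<le> q" by auto
    then show False using G(10)[of l k] G(1) D(8)[of k "p + 1"] that M(1) by (cases l) auto
  qed
  have fc: "f p \<notin> g ` {0..j}" "f (p + 2) \<notin> g ` {0..j}" if "j \<le> q" for j
    using fg that by fastforce+
  have no4: False
    if j: "j \<le> q" and x: "x \<notin> g ` {0..j}" "x \<noteq> f p" "x \<noteq> f (p + 2)" "\<exists>c\<in>g ` {0..j}. adj x c"
      and y: "y \<notin> g ` {0..j}" "y \<noteq> f p" "y \<noteq> f (p + 2)" "\<exists>c\<in>g ` {0..j}. adj y c" and xy: "x \<noteq> y"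
    for j x y
  proof -
    have mem: "f (p + 1) \<in> g ` {0..j}" unfolding G(1)[symmetric] by (rule imageI) simp
    have "card {f p, f (p + 2), x, y} < 4"
    proof (rule conn_card[OF G(11)[OF j]])
      show "{f p, f (p + 2), x, y} \<inter> g ` {0..j} = {}" using fc[OF j] x(1) y(1) by blast
      show "\<exists>c\<in>g ` {0..j}. adj z c" if "z \<in> {f p, f (p + 2), x, y}" for z
        using that x(4) y(4) M(2,3) mem by blast
    qed simp
    moreover have "card {f p, f (p + 2), x, y} = 4" by (rule card4) (use M(4) x(2,3) y(2,3) xy in auto)
    ultimately show False by simp
  qed
  have "c = g q"
  proof (cases "c \<in> f ` {1..2 * p + 1}")
    case True
    then obtain i where i: "1 \<le> i" "i \<le> 2 * p + 1" "c = f i" by auto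
    then have "i = p + 1" using symch_attach[OF S mx tD t(1) i(1,2)] c(2) by auto
    then have "adj t (g 0)" using c(2) i G(1) by simp
    moreover have "adj (g 1) (g 0)" using G(5)[of 0] q adj_sym by simp
    ultimately show ?thesis
      using no4[of 0 t "g 1"] tg[of 0] tg[of 1] tf[of p] tf[of "p + 2"] G(9)[of 1 0] G(10)[of 1 p]
        G(10)[of 1 "p + 2"] M(1) q by auto
  next
    case False
    then obtain j where j: "1 \<le> j" "j \<le> q" "c = g j" using c by auto
    show ?thesis
    proof (rule ccontr)
      assume "c \<noteq> g q"
      then have jq: "j < q" using j by (metis le_neq_implies_less)
      have nin: "x \<notin> g ` {0..j}" if "\<And>k. k \<le> j \<Longrightarrow> g k \<noteq> x" for x
      proof
        assume "x \<in> g ` {0..j}"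
        then obtain k where "x = g k" "k \<le> j" by auto
        then show False using that[of k] by simp
      qed
      have tn: "t \<notin> g ` {0..j}" by (rule nin, rule tg) (use jq in simp)
      have gn: "g (Suc j) \<notin> g ` {0..j}" by (rule nin) (use G(9) jq in simp)
      have gj: "g j \<in> g ` {0..j}" by simp
      have et: "\<exists>c\<in>g ` {0..j}. adj t c" using gj c(2) j(3) by blast
      have eg: "\<exists>c\<in>g ` {0..j}. adj (g (Suc j)) c" using gj G(5)[OF jq] adj_sym by blast
      show False
        by (rule no4[OF less_imp_le[OF jq] tn _ _ et gn _ _ eg])
          (use jq tf[of p] tf[of "p + 2"] tg[of "Suc j"] G(10)[of "Suc j" p]
            G(10)[of "Suc j" "p + 2"] M(1) in auto)
    qed
  qed
  then have tq: "adj t (g q)" using c(2) by simp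
  have fixed: "ep t = t"
  proof (rule ccontr)
    assume ne: "ep t \<noteq> t"
    have eq: "adj (ep t) (g q)" using adj_ep[OF tq] G(7)[of q] by simp
    have en: "ep t \<notin> g ` {0..q}"
    proof
      assume "ep t \<in> g ` {0..q}"
      then obtain k where "k \<le> q" "ep t = g k" by auto
      then have "t = g k" using G(7) ep_ep by metis
      then show False using tg \<open>k \<le> q\<close> by blast
    qed
    have ef: "ep t \<noteq> f k" if "1 \<le> k" "k \<le> 2 * p + 1" for k
    proof
      assume "ep t = f k"
      then have te: "t = f (2 * p + 1 + 1 - k)" using D(6)[OF that] ep_ep by metis
      have "1 \<le> 2 * p + 1 + 1 - k" "2 * p + 1 + 1 - k \<le> 2 * p + 1" using that by auto
      then show False using tf te by blast
    qed
    have gq: "g q \<in> g ` {0..q}" by simp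
    have et: "\<exists>c\<in>g ` {0..q}. adj t c" "\<exists>c\<in>g ` {0..q}. adj (ep t) c" using gq tq eq by blast+
    show False
      by (rule no4[OF order_refl t0 _ _ et(1) en _ _ et(2)])
        (use tf[of p] tf[of "p + 2"] ef[of p] ef[of "p + 2"] ne M(1) in auto)
  qed
  have "(\<Sum>s\<in>{f p, f (p + 2), t}. bond s (if s = t then g q else f (p + 1))) < 4"
  proof (rule conn_bonds[OF G(11)[of q]])
    show "{f p, f (p + 2), t} \<subseteq> \<Delta>" using D(7) M(1) tD by auto
    show "{f p, f (p + 2), t} \<inter> g ` {0..q} = {}" using fc[of q] t0 by blast
    have "f (p + 1) \<in> g ` {0..q}" unfolding G(1)[symmetric] by (rule imageI) simp
    then show "(if s = t then g q else f (p + 1)) \<in> g ` {0..q}" for s by simp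
  qed simp_all
  then have "bond t (g q) < 2" using M(4,5,6) tf[of p] tf[of "p + 2"] M(1) by simp
  then have b: "bond t (g q) = 1" using bond_eq1 tq by blast
  define h where "h k = (if k = Suc q then t else g k)" for k
  have set: "{0..Suc q} = insert (Suc q) {0..q}" "{1..Suc q} = insert (Suc q) {1..q}" by auto
  have img: "h ` {0..q} = g ` {0..q}" "h ` {1..q} = g ` {1..q}"
    by (rule image_cong; auto simp: h_def)+
  have hq: "h (Suc q) = t" by (simp add: h_def)
  have "arm p f (Suc q) h"
    unfolding arm_def
  proof (intro conjI allI impI)
    show "h 0 = f (p + 1)" using G(1) by (simp add: h_def)
    have "inj_on h {0..q} = inj_on g {0..q}" by (rule inj_on_cong) (auto simp: h_def)
    then have "inj_on h {0..q}" using G(2) by simp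
    moreover have "h (Suc q) \<notin> h ` ({0..q} - {Suc q})" using img(1) hq t0 by auto
    ultimately show "inj_on h {0..Suc q}" unfolding set inj_on_insert by blast
    show "h ` {0..Suc q} \<subseteq> \<Delta>" unfolding set image_insert img hq using tD G(3) by simp
    show "h ` {1..Suc q} \<inter> f ` {1..2 * p + 1} = {}"
      unfolding set image_insert img hq using G(4) t(1) by simp
    fix k
    { assume "k < Suc q"
      then have "adj (h k) (h (Suc k)) \<and> bond (h k) (h (Suc k)) = 1"
        using G(5,6)[of k] tq b adj_sym bond_sym by (cases "k = q") (auto simp: h_def) }
    then show "k < Suc q \<Longrightarrow> adj (h k) (h (Suc k))" "k < Suc q \<Longrightarrow> bond (h k) (h (Suc k)) = 1" by auto
    show "k \<le> Suc q \<Longrightarrow> ep (h k) = h k" using G(7)[of k] fixed by (auto simp: h_def)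
  qed
  then show ?thesis by blast
qed

lemma arm_bounds:
  assumes S: "symch (2 * p + 1) f" and A: "arm p f q g" and q: "q \<ge> 1"
  shows "p \<le> 2" "p = 2 \<Longrightarrow> q = 1"
proof -
  note D = symchD[OF S] and M = mid_facts[OF S] and G = armD[OF A]
  have ag: "adj (g 1) (f (p + 1))" using G(1) G(5)[of 0] q adj_sym by simp
  show "p \<le> 2"
  proof (rule ccontr)
    assume "\<not> p \<le> 2"
    then obtain r where p: "p = r + 3" by (metis add.commute le_add_diff_inverse not_less_eq_eq numeral_3_eq_3 numeral_2_eq_2)
    \<comment> \<open>The central seven nodes of the path, with \<open>F 4\<close> the middle one,
      and the first new node of the arm: the diagram of affine E7, with null vector (1, 2, 3, 4, 3,
      2, 1; 2).\<close>
    define F where "F k = (if k \<le> 7 then f (r + k) else g 1)" for k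
    define P where "P k = (if k = 8 then 4 else k - 1)" for k :: nat
    define c :: "nat \<Rightarrow> real" where
      "c k = (if k = 1 \<or> k = 7 then 1 else if k = 2 \<or> k = 6 \<or> k = 8 then 2 else if k = 4 then 4 else 3)" for k
    have "inj_on F {1..8}"
    proof (rule inj_onI)
      fix x y :: nat assume xy: "x \<in> {1..8}" "y \<in> {1..8}" "F x = F y"
      then show "x = y"
        using D(8)[of "r + x" "r + y"] G(10)[of 1 "r + x"] G(10)[of 1 "r + y"] p q
        by (cases "x \<le> 7"; cases "y \<le> 7") (auto simp: F_def)
    qed
    moreover have "F ` {1..8} \<subseteq> \<Delta>" using D(7) G(8)[of 1] p q by (auto simp: F_def)
    moreover have "P j \<in> {1..<j} \<and> adj (F j) (F (P j))" if j: "j \<in> {2..8}" for j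
    proof (cases "j = 8")
      case True
      have "adj (g 1) (f (r + 4))" using ag p by (simp add: add.commute)
      then show ?thesis using True by (simp add: F_def P_def)
    next
      case False
      from j obtain l where l: "j = Suc l" by (cases j) auto
      have "adj (f (r + l)) (f (Suc (r + l)))" using D(4)[of "r + l"] False j p l by auto
      then show ?thesis using False j l adj_sym by (auto simp: F_def P_def)
    qed
    moreover have "c j \<ge> 0" "c 1 > 0" for j by (auto simp: c_def)
    ultimately have "(\<Sum>j\<in>{1..8}. (c j)\<^sup>2) > (\<Sum>j\<in>{2..8}. c j * c (P j))"
      using tree_form_pos[of 8 F P c] by simp
    moreover have "{1..8} = {1,2,3,4,5,6,7,8::nat}" "{2..8} = {2,3,4,5,6,7,8::nat}" by auto
    ultimately show False by (simp add: c_def P_def)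
  qed
  assume p: "p = 2"
  show "q = 1"
  proof (rule ccontr)
    assume "q \<noteq> 1"
    then have q2: "q \<ge> 2" using q by simp
    \<comment> \<open>Three legs with two nodes each around the middle node: affine E6, whose null
      vector has 3 at the centre and then 2 and 1 on every leg.\<close>
    define F where "F k = (if k \<le> 5 then f k else g (k - 5))" for k
    define P where "P k = (if k = 6 then 3 else k - 1)" for k :: nat
    define c :: "nat \<Rightarrow> real" where
      "c k = (if k = 1 \<or> k = 5 \<or> k = 7 then 1 else if k = 3 then 3 else 2)" for k
    have b: "1 \<le> z - 5 \<and> z - 5 \<le> q" if "\<not> z \<le> 5" "z \<le> 7" for z
      using that q2 by auto
    have "inj_on F {1..7}"
    proof (rule inj_onI)
      fix x y :: nat assume xy: "x \<in> {1..7}" "y \<in> {1..7}" "F x = F y"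
      then show "x = y"
        using D(8)[of x y] G(9)[of "x - 5" "y - 5"] G(10)[of "x - 5" y] G(10)[of "y - 5" x] b[of x] b[of y] p
        by (cases "x \<le> 5"; cases "y \<le> 5") (auto simp: F_def)
    qed
    moreover have "F ` {1..7} \<subseteq> \<Delta>" using D(7) G(8) p q2 by (auto simp: F_def)
    moreover have "P j \<in> {1..<j} \<and> adj (F j) (F (P j))" if j: "j \<in> {2..7}" for j
    proof -
      consider "j \<le> 5" | "j = 6" | "j = 7" using j by fastforce
      then show ?thesis
      proof cases
        case 1
        then have "adj (f (j - 1)) (f (Suc (j - 1)))" using D(4)[of "j - 1"] 1 j p by auto
        then show ?thesis using 1 j adj_sym by (auto simp: F_def P_def)
      next
        case 2 then show ?thesis using ag p by (simp add: F_def P_def)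
      next
        case 3 then show ?thesis using G(5)[of 1] q2 adj_sym by (simp add: F_def P_def numeral_2_eq_2)
      qed
    qed
    moreover have "c j \<ge> 0" "c 1 > 0" for j by (auto simp: c_def)
    ultimately have "(\<Sum>j\<in>{1..7}. (c j)\<^sup>2) > (\<Sum>j\<in>{2..7}. c j * c (P j))"
      using tree_form_pos[of 7 F P c] by simp
    moreover have "{1..7} = {1,2,3,4,5,6,7::nat}" "{2..7} = {2,3,4,5,6,7::nat}" by auto
    ultimately show False by (simp add: c_def P_def)
  qed
qed

section \<open>Reading off the types\<close>

lemma chain_type_A:
  assumes S: "symch m f" and full: "f ` {1..m} = \<Delta>"
  shows "has_type \<Delta> m adjA"
proof (rule tree_type[of f m "\<lambda>j. j - 1"])
  note D = symchD[OF S]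
  show "inj_on f {1..m}" "f ` {1..m} = \<Delta>" by (fact D(2), fact full)
  fix j assume j: "j \<in> {2..m}"
  then have "adj (f (j - 1)) (f j)" "bond (f (j - 1)) (f j) = 1" using D(4,5)[of "j - 1"] by auto
  then show "j - 1 \<in> {1..<j} \<and> adj (f j) (f (j - 1)) \<and> bond (f j) (f (j - 1)) = 1"
    using j adj_sym bond_sym by auto
qed (auto simp: adjA_def)

lemma arm_type_D:
  assumes S: "symch 3 f" and A: "arm 1 f q g" and q: "q \<ge> 1"
    and full: "f ` {1..3} \<union> g ` {1..q} = \<Delta>"
  shows "odd (q + 3)" "has_type \<Delta> (q + 3) (adjD (q + 3))"
proof -
  have S': "symch (2 * 1 + 1) f" using S by simp
  note D = symchD[OF S] and M = mid_facts[OF S'] and G = armD[OF A]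
  \<comment> \<open>Numbered from the free end of the arm, so that the branch node is
    \<open>q + 1\<close> and the two fork tips come last, as in Bourbaki's D_r with
    \<open>r = q + 3\<close>.\<close>
  define F where "F k = (if k \<le> q + 1 then g (q + 1 - k) else if k = q + 2 then f 1 else f 3)" for k
  define P where "P k = (if k = q + 3 then q + 1 else k - 1)" for k
  have set: "{1..q + 3} = insert (q + 3) (insert (q + 2) {1..q + 1})" by auto
  have im0: "(\<lambda>k. q + 1 - k) ` {1..q + 1} = {0..q}"
  proof (intro equalityI subsetI)
    fix x assume "x \<in> {0..q}"
    then show "x \<in> (\<lambda>k. q + 1 - k) ` {1..q + 1}" by (intro image_eqI[of _ _ "q + 1 - x"]) auto
  qed auto
  have im: "F ` {1..q + 1} = g ` {0..q}"
    unfolding im0[symmetric] image_image by (rule image_cong) (auto simp: F_def)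
  have Fe: "F (q + 2) = f 1" "F (q + 3) = f 3" by (simp_all add: F_def)
  have out: "f l \<notin> g ` {0..q}" if "l = 1 \<or> l = 3" for l
  proof
    assume "f l \<in> g ` {0..q}"
    then obtain k where "f l = g k" "k \<le> q" by auto
    then show False using G(10)[of k l] G(1) D(8)[of l 2] that by (cases k) (auto simp: numeral_2_eq_2)
  qed
  have "inj_on (g \<circ> (\<lambda>k. q + 1 - k)) {1..q + 1}"
    by (rule comp_inj_on) (use G(2) im0 in \<open>auto simp: inj_on_def\<close>)
  moreover have "inj_on F {1..q + 1} = inj_on (g \<circ> (\<lambda>k. q + 1 - k)) {1..q + 1}"
    by (rule inj_on_cong) (auto simp: F_def)
  ultimately have "inj_on F {1..q + 1}" by simp
  moreover have "f 1 \<noteq> f 3" using D(8)[of 1 3] by simp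
  ultimately have inj: "inj_on F {1..q + 3}"
    unfolding set inj_on_insert using out[of 1] out[of 3] im Fe by auto
  have "{0..q} = insert 0 {1..q}" "{1..3} = {1, 2, 3::nat}" by auto
  then have img: "F ` {1..q + 3} = \<Delta>"
    unfolding set image_insert im Fe full[symmetric] using G(1) by (auto simp: numeral_2_eq_2)
  have par: "P j \<in> {1..<j} \<and> adj (F j) (F (P j)) \<and> bond (F j) (F (P j)) = 1" if j: "j \<in> {2..q + 3}" for j
  proof -
    consider "j \<le> q + 1" | "j = q + 2" | "j = q + 3" using j by fastforce
    then show ?thesis
    proof cases
      case 1
      then have "F (P j) = g (Suc (q + 1 - j))" "F j = g (q + 1 - j)" "q + 1 - j < q"
        using j by (auto simp: F_def P_def Suc_diff_le)
      then show ?thesis using G(5,6)[of "q + 1 - j"] 1 j by (auto simp: P_def)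
    next
      case 2
      then show ?thesis using M G(1) by (simp add: F_def P_def numeral_2_eq_2)
    next
      case 3
      then show ?thesis using M G(1) by (simp add: F_def P_def numeral_2_eq_2 numeral_3_eq_3)
    qed
  qed
  have pat: "adjD (q + 3) i j \<longleftrightarrow> (i < j \<and> P j = i) \<or> (j < i \<and> P i = j)"
    if "i \<in> {1..q + 3}" "j \<in> {1..q + 3}" "i \<noteq> j" for i j
    using that by (auto simp: adjD_def P_def doubleton_eq_iff)
  show "has_type \<Delta> (q + 3) (adjD (q + 3))" by (rule tree_type[OF inj img par pat])
  have bij: "bij_betw F {1..q + 3} \<Delta>" using inj img by (simp add: bij_betw_def)
  have cart: "cartan (F i) (F j) = (if i = j then 2 else if adjD (q + 3) i j then -1 else 0)"
    if "i \<in> {1..q + 3}" "j \<in> {1..q + 3}" for i j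
    using tree_cartan[OF inj equalityD1[OF img] par that] pat[OF that] by auto
  \<comment> \<open>The fork tips are swapped, so the half-spin weight requires
    \<open>(r - 1) / 2\<close> to be an integer.\<close>
  have "ep (F (q + 3)) = F (q + 2)" using D(6)[of 3] Fe by simp
  then have "real (q + 3) / 4 + (real (q + 3) - 2) / 4 \<in> \<int>"
    using type_D_weight[OF bij _ cart, of "q + 2"] q by simp
  then obtain k where "real (q + 3) / 4 + (real (q + 3) - 2) / 4 = of_int k" by (rule Ints_cases)
  then have "real_of_int (int q + 2) = real_of_int (2 * k)" by (simp add: field_simps)
  then have "int q + 2 = 2 * k" by linarith
  then show "odd (q + 3)" by presburger
qed

lemma arm_type_E6:
  assumes S: "symch 5 f" and A: "arm 2 f 1 g" and full: "f ` {1..5} \<union> g ` {1..1} = \<Delta>"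
  shows "has_type \<Delta> 6 adjE6"
proof -
  note D = symchD[OF S] and G = armD[OF A]
  define F where "F k = (if k \<le> 5 then f k else g 1)" for k
  define P where "P k = (if k = 6 then 3 else k - 1)" for k :: nat
  \<comment> \<open>\<open>tree_cartan\<close> wants each parent before its child, which fails in
    Bourbaki's E6, where 2 hangs on 4. So the path has numbers 1 to 5 and the arm 6, and
    \<open>\<pi>\<close> translates.\<close>
  define \<pi> where "\<pi> k = (if k = 1 then 1 else if k = 2 then 6 else k - 1)" for k :: nat
  have set: "{1..6} = insert 6 {1..5::nat}" by auto
  have im: "F ` {1..5} = f ` {1..5}" by (rule image_cong) (auto simp: F_def)
  have F6: "F 6 = g 1" by (simp add: F_def)
  have "inj_on F {1..5} = inj_on f {1..5}" by (rule inj_on_cong) (auto simp: F_def)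
  then have inj: "inj_on F {1..6}"
    unfolding set inj_on_insert using D(2) im F6 G(4) by auto
  have img: "F ` {1..6} = \<Delta>" unfolding set image_insert im F6 full[symmetric] by auto
  have par: "P j \<in> {1..<j} \<and> adj (F j) (F (P j)) \<and> bond (F j) (F (P j)) = 1" if j: "j \<in> {2..6}" for j
  proof (cases "j = 6")
    case True
    have "g 0 = f 3" using G(1) by (simp add: numeral_3_eq_3)
    then show ?thesis using True G(5,6)[of 0] adj_sym bond_sym by (simp add: F_def P_def)
  next
    case False
    then have "adj (f (j - 1)) (f (Suc (j - 1)))" "bond (f (j - 1)) (f (Suc (j - 1))) = 1"
      using D(4,5)[of "j - 1"] j by auto
    then show ?thesis using False j adj_sym bond_sym by (auto simp: F_def P_def)
  qed
  have s6: "{1..6} = {1,2,3,4,5,6::nat}" by auto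
  have "\<pi> ` {1..6} = {1..6}" unfolding s6 by (auto simp: \<pi>_def)
  moreover have "inj_on \<pi> {1..6}" unfolding s6 by (auto simp: \<pi>_def inj_on_def)
  ultimately have bp: "bij_betw \<pi> {1..6} {1..6}" by (simp add: bij_betw_def)
  have bF: "bij_betw F {1..6} \<Delta>" using inj img by (simp add: bij_betw_def)
  show ?thesis unfolding has_type_def
  proof (intro exI[of _ "F \<circ> \<pi>"] conjI ballI)
    show "bij_betw (F \<circ> \<pi>) {1..6} \<Delta>" by (rule bij_betw_trans[OF bp bF])
    fix i j :: nat assume ij: "i \<in> {1..6}" "j \<in> {1..6}"
    have m: "\<pi> i \<in> {1..6}" "\<pi> j \<in> {1..6}" using bij_betwE[OF bp] ij by auto
    have eq: "\<pi> i = \<pi> j \<longleftrightarrow> i = j" using inj_on_eq_iff[OF bij_betw_imp_inj_on[OF bp]] ij by blast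
    have "adjE6 i j \<longleftrightarrow> (\<pi> i < \<pi> j \<and> P (\<pi> j) = \<pi> i) \<or> (\<pi> j < \<pi> i \<and> P (\<pi> i) = \<pi> j)" if "i \<noteq> j"
      using ij that unfolding s6
      by (elim insertE emptyE) (simp_all add: adjE6_def P_def \<pi>_def doubleton_eq_iff)
    moreover have "cartan (F (\<pi> i)) (F (\<pi> j)) = (if \<pi> i = \<pi> j then 2
        else if (\<pi> i < \<pi> j \<and> P (\<pi> j) = \<pi> i) \<or> (\<pi> j < \<pi> i \<and> P (\<pi> i) = \<pi> j) then -1 else 0)"
      by (rule tree_cartan[OF inj equalityD1[OF img] par m])
    ultimately show "cartan ((F \<circ> \<pi>) i) ((F \<circ> \<pi>) j) = (if i = j then 2 else if adjE6 i j then - 1 else 0)"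
      unfolding eq by (cases "i = j") simp_all
  qed
qed

text \<open>Path and arm are both taken of maximal length; connectedness then leaves no further
  nodes, and \<open>arm_bounds\<close> leaves \<open>p = 1\<close>, which is type D, or
  \<open>p = 2\<close> with \<open>q = 1\<close>, which is E6.\<close>

lemma moved_type:
  assumes ind: "indecomposable R" and mv: "\<exists>a\<in>\<Delta>. ep a \<noteq> a"
  shows "(\<exists>r\<ge>2. has_type \<Delta> r adjA) \<or> (\<exists>r\<ge>4. odd r \<and> has_type \<Delta> r (adjD r)) \<or> has_type \<Delta> 6 adjE6"
proof -
  obtain m f where S: "symch m f" and mx: "\<forall>m' f'. symch m' f' \<longrightarrow> m' \<le> m"
    using symch_start[OF ind mv] symch_maximal by blast
  note D = symchD[OF S]
  show ?thesis
  proof (cases "f ` {1..m} = \<Delta>")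
    case True
    then show ?thesis using chain_type_A[OF S] D(1) by blast
  next
    case False
    have "f ` {1..m} \<noteq> {}" using D(1) by simp
    then obtain c s where cs: "c \<in> f ` {1..m}" "s \<in> \<Delta> - f ` {1..m}" "adj c s"
      using base_connected[OF ind D(3) _ False] by blast
    then obtain i where i: "1 \<le> i" "i \<le> m" "c = f i" by auto
    have sf: "2 * i = m + 1" "ep s = s" "bond s (f i) = 1"
      using symch_attach[OF S mx, of s i] cs i adj_sym by auto
    define p where "p = i - 1"
    have mp: "m = 2 * p + 1" "i = p + 1" using sf(1) i by (auto simp: p_def)
    note S' = S[unfolded mp(1)] and mx' = mx[unfolded mp(1)]
    define g where "g k = (if k = 0 then f i else s)" for k :: nat
    have "{0..1} = {0, 1::nat}" by auto
    moreover have "ep (f i) = f i" using D(6)[OF i(1,2)] mp by simp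
    moreover have "s \<noteq> f i" using cs i by auto
    ultimately have "arm p f 1 g"
      unfolding arm_def using cs i sf mp adj_sym bond_sym D(7)[OF i(1,2)]
      by (auto simp: g_def)
    then have ex: "\<exists>g. arm p f 1 g" by blast
    have bd: "q \<le> card \<Delta>" if "\<exists>g. arm p f q g" for q
    proof -
      from that obtain g where A: "arm p f q g" by blast
      show ?thesis using card_image[OF armD(2)[OF A]] card_mono[OF finD armD(3)[OF A]] by simp
    qed
    obtain q where q: "\<exists>g. arm p f q g" "\<And>q'. \<exists>g. arm p f q' g \<Longrightarrow> q' \<le> q"
      using Nat.ex_has_greatest_nat[of "\<lambda>q. \<exists>g. arm p f q g" 1 "card \<Delta>"] ex bd by blast
    obtain g where A: "arm p f q g" using q(1) by blast
    have q1: "q \<ge> 1" using q(2)[OF ex] .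
    let ?U = "f ` {1..2 * p + 1} \<union> g ` {1..q}"
    have full: "?U = \<Delta>"
    proof (rule ccontr)
      assume ne: "?U \<noteq> \<Delta>"
      have "g ` {1..q} \<subseteq> \<Delta>" using armD(8)[OF A] by auto
      then have "?U \<subseteq> \<Delta>" using symchD(3)[OF S'] by blast
      moreover have "?U \<noteq> {}" by simp
      ultimately obtain c t where "c \<in> ?U" "t \<in> \<Delta> - ?U" "adj c t"
        using base_connected[OF ind _ _ ne] by blast
      then have "\<exists>g'. arm p f (Suc q) g'"
        using arm_extend[OF S' mx' A q1, of t c] adj_sym by blast
      then show False using q(2)[of "Suc q"] by simp
    qed
    have "p \<ge> 1" "p \<le> 2" using mid_facts(1)[OF S'] arm_bounds(1)[OF S' A q1] by auto
    then consider "p = 1" | "p = 2" by linarith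
    then show ?thesis
    proof cases
      case 1
      have "symch 3 f" "arm 1 f q g" "f ` {1..3} \<union> g ` {1..q} = \<Delta>"
        using S' A full unfolding 1 by simp_all
      then have "odd (q + 3)" "has_type \<Delta> (q + 3) (adjD (q + 3))" using arm_type_D[OF _ _ q1] by blast+
      moreover have "q + 3 \<ge> 4" using q1 by simp
      ultimately have "\<exists>r\<ge>4. odd r \<and> has_type \<Delta> r (adjD r)" by (intro exI[of _ "q + 3"] conjI)
      then show ?thesis by simp
    next
      case 2
      have "q = 1" using arm_bounds(2)[OF S' A q1 2] .
      have "symch 5 f" "arm 2 f 1 g" "f ` {1..5} \<union> g ` {1..1} = \<Delta>"
        using S' A full unfolding 2 \<open>q = 1\<close> by simp_all
      then show ?thesis using arm_type_E6 by blast
    qed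
  qed
qed

end

theorem theorem2:
  fixes R \<Delta> :: "'a::euclidean_space set"
  assumes "root_system R" and "indecomposable R" and "is_base R \<Delta>"
  shows "rat_graph_connected R \<Delta>
     \<and> (\<exists>\<phi>. is_eps_ext R \<Delta> \<phi>)
     \<and> (\<forall>\<phi>. is_eps_ext R \<Delta> \<phi> \<longrightarrow>
           (\<forall>u\<in>weyl R. rational R \<Delta> u \<longleftrightarrow> rational R \<Delta> (\<phi> u))
         \<and> (\<forall>u\<in>weyl R. \<phi> (\<phi> u) = u)
         \<and> \<phi> (longest R \<Delta>) = longest R \<Delta>)
     \<and> (card (rat_vertices R \<Delta>) > 1 \<longleftrightarrow> \<not> (\<forall>\<alpha>\<in>R. longest R \<Delta> \<alpha> = - \<alpha>))
     \<and> (\<not> (\<forall>\<alpha>\<in>R. longest R \<Delta> \<alpha> = - \<alpha>) \<longleftrightarrow>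
          (\<exists>r\<ge>2. has_type \<Delta> r adjA)
        \<or> (\<exists>r\<ge>4. odd r \<and> has_type \<Delta> r (adjD r))
        \<or> has_type \<Delta> 6 adjE6)"
proof -
  interpret based_roots R \<Delta> by unfold_locales (rule assms)+
  have types: "\<not> (\<forall>\<alpha>\<in>R. longest R \<Delta> \<alpha> = - \<alpha>) \<longleftrightarrow>
      (\<exists>r\<ge>2. has_type \<Delta> r adjA) \<or> (\<exists>r\<ge>4. odd r \<and> has_type \<Delta> r (adjD r)) \<or> has_type \<Delta> 6 adjE6"
    unfolding longest_minus_iff
  proof
    assume "\<not> (\<forall>a\<in>\<Delta>. diag_aut R \<Delta> a = a)"
    then have "\<exists>a\<in>\<Delta>. diag_aut R \<Delta> a \<noteq> a" by blast
    then show "(\<exists>r\<ge>2. has_type \<Delta> r adjA) \<or> (\<exists>r\<ge>4. odd r \<and> has_type \<Delta> r (adjD r)) \<or> has_type \<Delta> 6 adjE6"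
      by (rule moved_type[OF assms(2)])
  next
    assume "(\<exists>r\<ge>2. has_type \<Delta> r adjA) \<or> (\<exists>r\<ge>4. odd r \<and> has_type \<Delta> r (adjD r)) \<or> has_type \<Delta> 6 adjE6"
    then have "\<exists>a\<in>\<Delta>. diag_aut R \<Delta> a \<noteq> a"
      using type_A_moved type_D_odd_moved type_E6_moved by (elim disjE exE conjE)
    then show "\<not> (\<forall>a\<in>\<Delta>. diag_aut R \<Delta> a = a)" by blast
  qed
  show ?thesis
    by (intro conjI allI impI ballI graph_connected eps_part card_vertices types)
qed

end
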